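(* Let $R\subseteq[n-1]$ with elements $q_1<\dots<q_r$, $q_0:=0$, $q_{r+1}:=n$, $p_h:=q_h-q_{h-1}$, and let $\lambda$ be a partition with $R_\lambda=R$. The number $C_n^R$ of $R$-312-avoiding $R$-permutations equals each of the following: (ii) the number of words $w=(w_1,\dots,w_n)$ that are rearrangements of the multiset $\{1^{p_1},2^{p_2},\dots,(r+1)^{p_{r+1}}\}$ and avoid the pattern 231 (there are no $i<j<k$ with $w_k<w_i<w_j$); (iii) the number of gapless $R$-tuples; (iv) the number of $r$-tuples $(\mu^{(1)},\dots,\mu^{(r)})$ of partitions such that $\mu^{(h)}$ has at most $p_h$ nonzero parts, all at most $n-q_h$ ($h\in[r]$), and such that for each $h\in[r-1]$, regarding $\mu^{(h+1)}$ as having exactly $p_{h+1}$ (possibly zero) rows, the first row length of $\mu^{(h)}$ is at most $\ell+c$, where $\ell$ is the length of row $p_{h+1}$ of $\mu^{(h+1)}$ and $c$ is the number of rows of $\mu^{(h+1)}$ (among its $p_{h+1}$ rows) of length $\ell$; (v) the number of $R$-rightmost clump deleting $R$-chains, and the number of gapless $\lambda$-keys; (vi) the number of $R$-permutations $\sigma$ for which the Demazure tableau set $\mathcal{D}_\lambda(\sigma)$ is a convex polytope in $\mathbb{Z}^{|\lambda|}$ (equivalently, the number of distinct convex sets among the $\mathcal{D}_\lambda(\sigma)$).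
   Context: Fix $n\ge1$; $[m]=\{1,\dots,m\}$; interval notation denotes sets of integers. The $h$-th carrel is $\{q_{h-1}+1,\dots,q_h\}$. An $R$-tuple is an $n$-tuple with entries in $[n]$; it is upper if $\nu_i\ge i$ for all $i$ and $R$-increasing if strictly increasing on each carrel. An $R$-permutation is an $R$-increasing permutation of $[n]$ (one-line notation); it is $R$-312-containing if there exist $h\in[r-1]$ and $1\le a\le q_h<b\le q_{h+1}<c\le n$ with $\pi_b<\pi_c<\pi_a$, and $R$-312-avoiding otherwise. A gapless $R$-tuple is an upper $R$-increasing $R$-tuple $\gamma$ such that whenever $h\in[r]$ has $\gamma_{q_h}>\gamma_{q_h+1}$, setting $s:=\gamma_{q_h}-\gamma_{q_h+1}+1$ one has $s\le p_{h+1}$ and $\gamma_{q_h+t}=\gamma_{q_h}-s+t$ for $t\in[s]$. An $R$-chain is $\emptyset=B_0\subset B_1\subset\cdots\subset B_{r+1}=[n]$ with $|B_h|=q_h$. A clump of a finite set of integers is a maximal subset of consecutive integers; clumps are indexed $L_1,\dots,L_f$ increasingly. An $R$-chain is $R$-rightmost clump deleting if for each $h\in[r]$, writing $B_{h+1}=L_1\cup\cdots\cup L_f$ as clumps, there is $e\in[f]$ with $L_e\cup\cdots\cup L_f\supseteq B_{h+1}\setminus B_h\supseteq L_{e+1}\cup\cdots\cup L_f$. A partition is $\lambda=(\lambda_1\ge\cdots\ge\lambda_n\ge0)\in\mathbb{Z}^n$, $|\lambda|=\sum\lambda_i$, with boxes $(j,i)$ (column $j$, row $i$), $1\le i\le\zeta_j:=\#\{i:\lambda_i\ge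 j\}$; $R_\lambda:=\{\zeta_j:\zeta_j<n\}$. A tableau of shape $\lambda$ fills the boxes with values in $[n]$, strictly increasing down columns and weakly increasing along rows; $\mathcal{T}_\lambda$ is their set, ordered entrywise and identified with a subset of $\mathbb{Z}^{|\lambda|}$. A set in $\mathbb{Z}^N$ is a convex polytope if it is the solution set in $\mathbb{Z}^N$ of a finite system of linear inequalities. A $\lambda$-key is a tableau $Y$ whose column entry sets satisfy $B(Y_l)\supseteq B(Y_j)$ for $l\le j$. A $\lambda$-key is gapless if for every $h\in[r-1]$: letting $b$ be the smallest value in the columns of length $q_{h+1}$ not appearing in the columns of length $q_h$, and $m$ the largest value in the columns of length $q_h$, if $b\le m$ then every column of length $q_{h+1}$ contains all of $b,\dots,m$. The $\lambda$-key $Y_\lambda(\sigma)$ has column $j$ consisting of $\{\sigma_1,\dots,\sigma_{\zeta_j}\}$ in increasing order. Scanning tableau: the EWIS of $x_1,x_2,\dots$ is $x_{i_1},x_{i_2},\dots$ with $i_1=1$ and $i_u$ the smallest index $>i_{u-1}$ with $x_{i_u}\ge x_{i_{u-1}}$; for $T\in\mathcal{T}_\lambda$ and column $l$, starting with all boxes in columns $l,\dots,\lambda_1$ unmarked, for $k=\zeta_l,\dots,1$ take the EWIS of the lowest unmarked entries of columns $l,l+1,\dots$, mark its boxes, and set $S(T)$ at $(l,k)$ to its last term. $\mathcal{D}_\lambda(\sigma):=\{T\in\mathcal{T}_\lambda:S(T)\le Y_\lambda(\sigma)\}$. *)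

theory Defs
  imports Main "HOL-Combinatorics.Permutations"
begin

definition qq :: "nat \<Rightarrow> nat set \<Rightarrow> nat \<Rightarrow> nat" where
  "qq n R h = (if h = 0 then 0 else if h \<le> card R then sorted_list_of_set R ! (h - 1) else n)"

definition pp :: "nat \<Rightarrow> nat set \<Rightarrow> nat \<Rightarrow> nat" where
  "pp n R h = qq n R h - qq n R (h - 1)"

definition R_tuple :: "nat \<Rightarrow> (nat \<Rightarrow> nat) \<Rightarrow> bool" where
  "R_tuple n \<nu> \<longleftrightarrow> (\<forall>i\<in>{1..n}. \<nu> i \<in> {1..n}) \<and> (\<forall>i. i \<notin> {1..n} \<longrightarrow> \<nu> i = 0)"

definition upper :: "nat \<Rightarrow> (nat \<Rightarrow> nat) \<Rightarrow> bool" where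
  "upper n \<nu> \<longleftrightarrow> (\<forall>i\<in>{1..n}. i \<le> \<nu> i)"

definition R_increasing :: "nat \<Rightarrow> nat set \<Rightarrow> (nat \<Rightarrow> nat) \<Rightarrow> bool" where
  "R_increasing n R \<nu> \<longleftrightarrow>
     (\<forall>h\<in>{1..card R + 1}. \<forall>i j. qq n R (h - 1) < i \<and> i < j \<and> j \<le> qq n R h \<longrightarrow> \<nu> i < \<nu> j)"

definition R_permutation :: "nat \<Rightarrow> nat set \<Rightarrow> (nat \<Rightarrow> nat) \<Rightarrow> bool" where
  "R_permutation n R \<sigma> \<longleftrightarrow> \<sigma> permutes {1..n} \<and> R_increasing n R \<sigma>"

definition R_312_containing :: "nat \<Rightarrow> nat set \<Rightarrow> (nat \<Rightarrow> nat) \<Rightarrow> bool" where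
  "R_312_containing n R \<pi> \<longleftrightarrow>
     (\<exists>h\<in>{1..card R - 1}. \<exists>a b c. 1 \<le> a \<and> a \<le> qq n R h \<and> qq n R h < b \<and> b \<le> qq n R (h + 1)
        \<and> qq n R (h + 1) < c \<and> c \<le> n \<and> \<pi> b < \<pi> c \<and> \<pi> c < \<pi> a)"

definition C_count :: "nat \<Rightarrow> nat set \<Rightarrow> nat" where
  "C_count n R = card {\<sigma>. R_permutation n R \<sigma> \<and> \<not> R_312_containing n R \<sigma>}"

definition multiset_word :: "nat \<Rightarrow> nat set \<Rightarrow> (nat \<Rightarrow> nat) \<Rightarrow> bool" where
  "multiset_word n R w \<longleftrightarrow> (\<forall>i\<in>{1..n}. w i \<in> {1..card R + 1}) \<and> (\<forall>i. i \<notin> {1..n} \<longrightarrow> w i = 0)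
     \<and> (\<forall>h\<in>{1..card R + 1}. card {i\<in>{1..n}. w i = h} = pp n R h)"

definition avoids_231 :: "nat \<Rightarrow> (nat \<Rightarrow> nat) \<Rightarrow> bool" where
  "avoids_231 n w \<longleftrightarrow> \<not> (\<exists>i j k. 1 \<le> i \<and> i < j \<and> j < k \<and> k \<le> n \<and> w k < w i \<and> w i < w j)"

definition gapless_R_tuple :: "nat \<Rightarrow> nat set \<Rightarrow> (nat \<Rightarrow> nat) \<Rightarrow> bool" where
  "gapless_R_tuple n R \<gamma> \<longleftrightarrow> R_tuple n \<gamma> \<and> upper n \<gamma> \<and> R_increasing n R \<gamma> \<and>
     (\<forall>h\<in>{1..card R}. \<gamma> (qq n R h) > \<gamma> (qq n R h + 1) \<longrightarrow>
        (let s = \<gamma> (qq n R h) - \<gamma> (qq n R h + 1) + 1 in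
          s \<le> pp n R (h + 1) \<and> (\<forall>t\<in>{1..s}. \<gamma> (qq n R h + t) = \<gamma> (qq n R h) - s + t)))"

text \<open>mu h i is the length of row i of the h-th partition (h in [r], i in [p_h]),
  i.e. each partition with at most p_h nonzero parts is padded to exactly p_h rows;
  mu is 0 outside this range.\<close>
definition mu_tuple :: "nat \<Rightarrow> nat set \<Rightarrow> (nat \<Rightarrow> nat \<Rightarrow> nat) \<Rightarrow> bool" where
  "mu_tuple n R mu \<longleftrightarrow>
     (\<forall>h i. \<not> (h \<in> {1..card R} \<and> i \<in> {1..pp n R h}) \<longrightarrow> mu h i = 0) \<and>
     (\<forall>h\<in>{1..card R}. \<forall>i j. 1 \<le> i \<and> i \<le> j \<and> j \<le> pp n R h \<longrightarrow> mu h j \<le> mu h i) \<and>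
     (\<forall>h\<in>{1..card R}. \<forall>i\<in>{1..pp n R h}. mu h i \<le> n - qq n R h) \<and>
     (\<forall>h\<in>{1..card R - 1}.
        (let l = mu (h + 1) (pp n R (h + 1));
             c = card {i\<in>{1..pp n R (h + 1)}. mu (h + 1) i = l}
         in mu h 1 \<le> l + c))"

definition R_chain :: "nat \<Rightarrow> nat set \<Rightarrow> (nat \<Rightarrow> nat set) \<Rightarrow> bool" where
  "R_chain n R B \<longleftrightarrow> B 0 = {} \<and> B (card R + 1) = {1..n} \<and>
     (\<forall>h. h > card R + 1 \<longrightarrow> B h = {}) \<and>
     (\<forall>h\<le>card R. B h \<subset> B (Suc h)) \<and>
     (\<forall>h\<le>card R + 1. card (B h) = qq n R h)"

definition consecutive :: "nat set \<Rightarrow> bool" where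
  "consecutive L \<longleftrightarrow> (\<forall>x\<in>L. \<forall>z\<in>L. \<forall>y. x \<le> y \<and> y \<le> z \<longrightarrow> y \<in> L)"

definition is_clump :: "nat set \<Rightarrow> nat set \<Rightarrow> bool" where
  "is_clump S L \<longleftrightarrow> L \<subseteq> S \<and> L \<noteq> {} \<and> consecutive L \<and>
     (\<forall>L'. L \<subseteq> L' \<and> L' \<subseteq> S \<and> consecutive L' \<longrightarrow> L' = L)"

text \<open>Clumps are indexed increasingly; for the clump L = L_e, the union L_e \<union> ... \<union> L_f
  is the union of the clumps L' with Min L \<le> Min L', and L_(e+1) \<union> ... \<union> L_f the
  union of those with Min L < Min L'.\<close>
definition rightmost_clump_deleting :: "nat \<Rightarrow> nat set \<Rightarrow> (nat \<Rightarrow> nat set) \<Rightarrow> bool" where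
  "rightmost_clump_deleting n R B \<longleftrightarrow>
     (\<forall>h\<in>{1..card R}. \<exists>L. is_clump (B (h + 1)) L \<and>
        B (h + 1) - B h \<subseteq> \<Union>{L'. is_clump (B (h + 1)) L' \<and> Min L \<le> Min L'} \<and>
        \<Union>{L'. is_clump (B (h + 1)) L' \<and> Min L < Min L'} \<subseteq> B (h + 1) - B h)"

definition is_partition :: "nat \<Rightarrow> (nat \<Rightarrow> nat) \<Rightarrow> bool" where
  "is_partition n lam \<longleftrightarrow> (\<forall>i j. 1 \<le> i \<and> i \<le> j \<and> j \<le> n \<longrightarrow> lam j \<le> lam i)"

text \<open>zeta j = length of column j (for j \<ge> 1).\<close>
definition zeta :: "nat \<Rightarrow> (nat \<Rightarrow> nat) \<Rightarrow> nat \<Rightarrow> nat" where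
  "zeta n lam j = card {i\<in>{1..n}. j \<le> lam i}"

definition R_lam :: "nat \<Rightarrow> (nat \<Rightarrow> nat) \<Rightarrow> nat set" where
  "R_lam n lam = {zeta n lam j | j. j \<in> {1..lam 1} \<and> zeta n lam j < n}"

text \<open>Boxes (j,i): column j, row i.\<close>
definition boxes :: "nat \<Rightarrow> (nat \<Rightarrow> nat) \<Rightarrow> (nat \<times> nat) set" where
  "boxes n lam = {(j, i). 1 \<le> j \<and> 1 \<le> i \<and> i \<le> zeta n lam j}"

definition tableau :: "nat \<Rightarrow> (nat \<Rightarrow> nat) \<Rightarrow> (nat \<times> nat \<Rightarrow> nat) \<Rightarrow> bool" where
  "tableau n lam T \<longleftrightarrow> (\<forall>x. x \<notin> boxes n lam \<longrightarrow> T x = 0) \<and>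
     (\<forall>x\<in>boxes n lam. T x \<in> {1..n}) \<and>
     (\<forall>j i. 1 \<le> i \<and> (j, i + 1) \<in> boxes n lam \<longrightarrow> T (j, i) < T (j, i + 1)) \<and>
     (\<forall>j i. 1 \<le> j \<and> (j + 1, i) \<in> boxes n lam \<longrightarrow> T (j, i) \<le> T (j + 1, i))"

definition col_set :: "nat \<Rightarrow> (nat \<Rightarrow> nat) \<Rightarrow> (nat \<times> nat \<Rightarrow> nat) \<Rightarrow> nat \<Rightarrow> nat set" where
  "col_set n lam T j = {T (j, i) | i. 1 \<le> i \<and> i \<le> zeta n lam j}"

definition is_key :: "nat \<Rightarrow> (nat \<Rightarrow> nat) \<Rightarrow> (nat \<times> nat \<Rightarrow> nat) \<Rightarrow> bool" where
  "is_key n lam Y \<longleftrightarrow> tableau n lam Y \<and>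
     (\<forall>l j. 1 \<le> l \<and> l \<le> j \<and> j \<le> lam 1 \<longrightarrow> col_set n lam Y j \<subseteq> col_set n lam Y l)"

definition gapless_key :: "nat \<Rightarrow> nat set \<Rightarrow> (nat \<Rightarrow> nat) \<Rightarrow> (nat \<times> nat \<Rightarrow> nat) \<Rightarrow> bool" where
  "gapless_key n R lam Y \<longleftrightarrow> is_key n lam Y \<and>
     (\<forall>h\<in>{1..card R - 1}.
        (let C1 = \<Union>{col_set n lam Y j | j. j \<in> {1..lam 1} \<and> zeta n lam j = qq n R h};
             C2 = \<Union>{col_set n lam Y j | j. j \<in> {1..lam 1} \<and> zeta n lam j = qq n R (h + 1)};
             b = Min (C2 - C1);
             m = Max C1
         in b \<le> m \<longrightarrow>
            (\<forall>j\<in>{1..lam 1}. zeta n lam j = qq n R (h + 1) \<longrightarrow> {b..m} \<subseteq> col_set n lam Y j)))"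

definition Ykey :: "nat \<Rightarrow> (nat \<Rightarrow> nat) \<Rightarrow> (nat \<Rightarrow> nat) \<Rightarrow> (nat \<times> nat \<Rightarrow> nat)" where
  "Ykey n lam \<sigma> = (\<lambda>(j, i). if (j, i) \<in> boxes n lam
      then sorted_list_of_set (\<sigma> ` {1..zeta n lam j}) ! (i - 1) else 0)"

text \<open>Earliest weakly increasing subsequence, on lists of (column, value) pairs,
  compared by value.\<close>
fun ewis_from :: "nat \<Rightarrow> (nat \<times> nat) list \<Rightarrow> (nat \<times> nat) list" where
  "ewis_from v [] = []"
| "ewis_from v (x # xs) = (if v \<le> snd x then x # ewis_from (snd x) xs else ewis_from v xs)"

definition ewis :: "(nat \<times> nat) list \<Rightarrow> (nat \<times> nat) list" where
  "ewis xs = (case xs of [] \<Rightarrow> [] | x # ys \<Rightarrow> x # ewis_from (snd x) ys)"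

text \<open>Marking state m: m j = number of marked boxes of column j (always the lowest ones).
  Candidates: lowest unmarked entries of the columns l, l+1, ... that still have one.\<close>
definition scan_cands :: "nat \<Rightarrow> (nat \<Rightarrow> nat) \<Rightarrow> (nat \<times> nat \<Rightarrow> nat) \<Rightarrow> nat \<Rightarrow> (nat \<Rightarrow> nat) \<Rightarrow> (nat \<times> nat) list" where
  "scan_cands n lam T l m =
     [(j, T (j, zeta n lam j - m j)). j \<leftarrow> [l..<lam 1 + 1], m j < zeta n lam j]"

definition scan_step :: "nat \<Rightarrow> (nat \<Rightarrow> nat) \<Rightarrow> (nat \<times> nat \<Rightarrow> nat) \<Rightarrow> nat \<Rightarrow> (nat \<Rightarrow> nat) \<Rightarrow> (nat \<Rightarrow> nat)" where
  "scan_step n lam T l m =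
     (let s = ewis (scan_cands n lam T l m) in (\<lambda>j. if j \<in> fst ` set s then Suc (m j) else m j))"

definition scan_marks :: "nat \<Rightarrow> (nat \<Rightarrow> nat) \<Rightarrow> (nat \<times> nat \<Rightarrow> nat) \<Rightarrow> nat \<Rightarrow> nat \<Rightarrow> (nat \<Rightarrow> nat)" where
  "scan_marks n lam T l t = (scan_step n lam T l ^^ t) (\<lambda>_. 0)"

text \<open>S(T) at (l,k): k runs from zeta_l down to 1, so (l,k) is produced at step zeta_l - k.\<close>
definition scanning :: "nat \<Rightarrow> (nat \<Rightarrow> nat) \<Rightarrow> (nat \<times> nat \<Rightarrow> nat) \<Rightarrow> (nat \<times> nat \<Rightarrow> nat)" where
  "scanning n lam T = (\<lambda>(l, k). if (l, k) \<in> boxes n lam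
      then snd (last (ewis (scan_cands n lam T l (scan_marks n lam T l (zeta n lam l - k))))) else 0)"

definition Demazure :: "nat \<Rightarrow> (nat \<Rightarrow> nat) \<Rightarrow> (nat \<Rightarrow> nat) \<Rightarrow> (nat \<times> nat \<Rightarrow> nat) set" where
  "Demazure n lam \<sigma> = {T. tableau n lam T \<and> (\<forall>x. scanning n lam T x \<le> Ykey n lam \<sigma> x)}"

text \<open>Z^|lambda| is identified with integer functions on the boxes of lambda.
  D is a convex polytope iff it is the integer solution set of a finite linear system.\<close>
definition convex_polytope :: "(nat \<times> nat) set \<Rightarrow> (nat \<times> nat \<Rightarrow> nat) set \<Rightarrow> bool" where
  "convex_polytope Bx D \<longleftrightarrow>
     (\<exists>sys :: ((nat \<times> nat \<Rightarrow> int) \<times> int) set. finite sys \<and>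
        (\<forall>X :: nat \<times> nat \<Rightarrow> int. (\<forall>x. x \<notin> Bx \<longrightarrow> X x = 0) \<longrightarrow>
           ((\<exists>T\<in>D. X = (\<lambda>x. int (T x))) \<longleftrightarrow> (\<forall>(a, b)\<in>sys. (\<Sum>x\<in>Bx. a x * X x) \<le> b))))"

end

(* All families are compared with the chains B satisfying: if y lies in B (h + 1) but not in B h, and
   x in B h, then every z with y < z < x lies in B (h + 1).  Permutations, words and keys are encodings of
   arbitrary chains, and each of their side conditions (as well as the clump condition) says exactly this.
   A tuple lists, in its h-th carrel, the p h largest elements of B h; conversely B (h + 1) is recovered from
   B h and the tuple because the elements of B (h + 1) below its p (h + 1) largest ones have the form
   {x in B h. x < b} union {b..<g}, and such sets are nested as b varies, so that the cardinality fixes the set.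

   For convexity, S(T) >= T shows that the Demazure set is contained in {T. T <= Y}.  If the chain has no gaps,
   both sets agree: S(T) has strictly increasing columns and weakly increasing rows, and rows whose entry of Y
   lies below the first new value are controlled by the next column of S(T), while inside the run of
   consecutive values one counts down from its top.  Otherwise pick y < v < x with v missing.  Shifting the
   elements strictly between y and v down by one and replacing x by w turns Y into a filling that is affine in w,
   a key below Y for w = v - 1 and w = x, but has scanning tableau not below Y for w = v. *)

theory Submission
  imports Defs
begin

section \<open>Chains and permutations\<close>

text \<open>Chains serve as reference because their cardinalities are known:
  \<open>card (B h) = q h\<close> reduces many set equalities to an inclusion plus counting, and
  ranks recover a set through \<open>nth_smallest\<close>. For keys the link is
  \<open>R_lam n lam = R\<close>: every \<open>q h\<close> with \<open>1 \<le> h \<le> r\<close> is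
  a column length, so neighbouring columns carry equal or consecutive members of the chain.

  On the Demazure side the obstacle is that scanning is defined path after path across all columns,
  while its order properties compare all paths at one column. The two loops are interchanged: how a
  path passes a column depends only on its incoming value and on the number of boxes already marked
  there.

  Non-convexity needs no knowledge of the inequalities, since one that holds at two points of an
  affine line holds between them. The shift down by one is there because \<open>v - 1\<close> is
  already occupied whenever \<open>y < v - 1\<close>. At \<open>w = v\<close> the shorter column
  contains a value foreign to its left neighbour, which is what makes scanning raise an
  entry.\<close>

definition nth_smallest :: "nat set \<Rightarrow> nat \<Rightarrow> nat" where
  "nth_smallest A i = sorted_list_of_set A ! (i - 1)"

lemma nth_smallest_mem:
  assumes "finite A" "1 \<le> i" "i \<le> card A"
  shows "nth_smallest A i \<in> A"
proof -
  have "sorted_list_of_set A ! (i - 1) \<in> set (sorted_list_of_set A)"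
    using assms by (intro nth_mem) (auto simp: length_sorted_list_of_set)
  with assms show ?thesis by (simp add: nth_smallest_def)
qed

lemma nth_smallest_less:
  assumes "1 \<le> i" "i < j" "j \<le> card A"
  shows "nth_smallest A i < nth_smallest A j"
  unfolding nth_smallest_def
  using assms by (intro sorted_wrt_nth_less[OF strict_sorted_list_of_set]) (auto simp: length_sorted_list_of_set)

lemma nth_smallest_strict_mono: "strict_mono_on {1..card A} (nth_smallest A)"
  by (auto simp: strict_mono_on_def intro: nth_smallest_less)

lemma nth_smallest_image:
  assumes "finite A"
  shows "nth_smallest A ` {1..card A} = A"
proof (rule card_subset_eq[OF assms])
  show "nth_smallest A ` {1..card A} \<subseteq> A"
    using nth_smallest_mem[OF assms] by auto
  show "card (nth_smallest A ` {1..card A}) = card A"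
    using nth_smallest_strict_mono[THEN strict_mono_on_imp_inj_on] by (simp add: card_image)
qed

text \<open>At the first index where the functions differ, the smaller of the two values must be
  attained by the other function: not earlier, since both agree there and are injective, and not at
  this index or later, since its values there are too large.\<close>

lemma strict_mono_on_same_image:
  fixes f g :: "nat \<Rightarrow> nat"
  assumes f: "strict_mono_on S f" and g: "strict_mono_on S g" and im: "f ` S = g ` S"
    and i: "i \<in> S"
  shows "f i = g i"
  using i
proof (induction i rule: less_induct)
  case (less i)
  have *: False if f: "strict_mono_on S f" and g: "strict_mono_on S g" and im: "f ` S = g ` S"
    and eq: "\<And>j. j < i \<Longrightarrow> j \<in> S \<Longrightarrow> f j = g j" and lt: "f i < g i" for f g :: "nat \<Rightarrow> nat"
  proof -
    obtain j where j: "j \<in> S" "f i = g j" using im less.prems by (metis imageE imageI)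
    show False
    proof (cases "j < i")
      case True
      then have "f j = f i" using eq j by simp
      then show False using strict_mono_onD[OF f j(1) less.prems True] by simp
    next
      case False
      then have "g i \<le> g j"
        using strict_mono_onD[OF g less.prems j(1)] by (cases "i = j") auto
      then show False using j lt by simp
    qed
  qed
  show ?case
  proof (rule linorder_cases[of "f i" "g i"])
    assume "f i < g i" then show ?thesis using *[OF f g im] less.IH by blast
  next
    assume "g i < f i" then show ?thesis using *[OF g f im[symmetric]] less.IH by metis
  qed
qed

lemma nth_smallest_unique:
  assumes "strict_mono_on {1..k} f" "f ` {1..k} = A" "i \<in> {1..k}"
  shows "f i = nth_smallest A i"
proof -
  have "card A = k" using assms(1,2) by (metis card_atLeastAtMost card_image diff_Suc_1 strict_mono_on_imp_inj_on)
  moreover have "finite A" using assms(2) by auto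
  ultimately show ?thesis
    using strict_mono_on_same_image[OF assms(1) _ _ assms(3), of "nth_smallest A"]
      nth_smallest_strict_mono[of A] nth_smallest_image[of A] assms(2) by simp
qed

lemma card_le_nth_smallest:
  assumes "finite A" "1 \<le> i" "i \<le> card A"
  shows "card {x \<in> A. x \<le> nth_smallest A i} = i"
proof -
  have "{x \<in> A. x \<le> nth_smallest A i} = nth_smallest A ` {1..i}"
  proof (intro set_eqI iffI)
    fix x assume x: "x \<in> {x \<in> A. x \<le> nth_smallest A i}"
    then obtain j where j: "j \<in> {1..card A}" "x = nth_smallest A j"
      using nth_smallest_image[OF assms(1)] by (metis (mono_tags, lifting) imageE mem_Collect_eq)
    then have "j \<le> i" using x nth_smallest_less[of i j A] assms by (metis (mono_tags, lifting) atLeastAtMost_iff leD leI mem_Collect_eq)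
    then show "x \<in> nth_smallest A ` {1..i}" using j by auto
  next
    fix x assume "x \<in> nth_smallest A ` {1..i}"
    then obtain j where "j \<in> {1..i}" "x = nth_smallest A j" by auto
    then show "x \<in> {x \<in> A. x \<le> nth_smallest A i}"
      using nth_smallest_mem[of A j] nth_smallest_less[of j i A] assms by (cases "j = i") auto
  qed
  moreover have "inj_on (nth_smallest A) {1..i}"
    using strict_mono_on_imp_inj_on[OF nth_smallest_strict_mono[of A]] assms(3) by (auto intro: inj_on_subset)
  ultimately show ?thesis by (simp add: card_image)
qed

text \<open>Otherwise the \<open>i\<close> smallest elements of \<open>A\<close> would all lie
  strictly below the \<open>i\<close>-th element of \<open>C\<close>, where \<open>C\<close> has
  only \<open>i - 1\<close> elements. For nested columns this is the weak increase along
  rows.\<close>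

lemma nth_smallest_antimono:
  assumes "finite C" "A \<subseteq> C" "1 \<le> i" "i \<le> card A"
  shows "nth_smallest C i \<le> nth_smallest A i"
proof (rule ccontr)
  assume lt: "\<not> ?thesis"
  have A: "finite A" "card A \<le> card C" using assms finite_subset card_mono by auto
  have "{x \<in> A. x \<le> nth_smallest A i} \<subseteq> {x \<in> C. x \<le> nth_smallest C i} - {nth_smallest C i}"
    using lt assms by auto
  then have "card {x \<in> A. x \<le> nth_smallest A i} \<le> card ({x \<in> C. x \<le> nth_smallest C i} - {nth_smallest C i})"
    using assms(1) by (intro card_mono) auto
  also have "\<dots> = i - 1"
    using assms A card_le_nth_smallest[of C i] nth_smallest_mem[of C i] by (subst card_Diff_singleton) auto
  finally show False using card_le_nth_smallest[of A i] A assms by simp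
qed

lemma nth_smallest_ge:
  assumes "finite A" "0 \<notin> A" "1 \<le> i" "i \<le> card A"
  shows "i \<le> nth_smallest A i"
proof -
  have "card {x \<in> A. x \<le> nth_smallest A i} \<le> card {1..nth_smallest A i}"
    using assms(2) by (intro card_mono) (auto simp: Suc_le_eq intro!: gr0I)
  then show ?thesis using card_le_nth_smallest[OF assms(1,3,4)] by simp
qed

definition gapless_chain :: "nat \<Rightarrow> nat set \<Rightarrow> (nat \<Rightarrow> nat set) \<Rightarrow> bool" where
  "gapless_chain n R B \<longleftrightarrow> R_chain n R B \<and>
     (\<forall>h\<in>{1..card R}. \<forall>y\<in>B (h + 1) - B h. \<forall>x\<in>B h. \<forall>z. y < z \<and> z < x \<longrightarrow> z \<in> B (h + 1))"

text \<open>The value \<open>{}\<close> past \<open>card R + 1\<close> is the one that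
  \<open>R_chain\<close> prescribes, so that chains can be compared as total functions.\<close>

definition chain_of :: "nat \<Rightarrow> nat set \<Rightarrow> (nat \<Rightarrow> nat) \<Rightarrow> nat \<Rightarrow> nat set" where
  "chain_of n R \<sigma> h = (if h \<le> card R + 1 then \<sigma> ` {1..qq n R h} else {})"

locale carrels =
  fixes n :: nat and R :: "nat set"
  assumes n_pos: "1 \<le> n" and R_subset: "R \<subseteq> {1..n - 1}"
begin

abbreviation q where "q \<equiv> qq n R"
abbreviation p where "p \<equiv> pp n R"
abbreviation r where "r \<equiv> card R"

definition carrel :: "nat \<Rightarrow> nat" where "carrel i = (LEAST h. i \<le> q h)"

lemma finite_R: "finite R" using R_subset finite_subset by blast

lemma q_0 [simp]: "q 0 = 0" by (simp add: qq_def)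

lemma q_last [simp]: "q (Suc r) = n" by (simp add: qq_def)

lemma q_eq: "1 \<le> h \<Longrightarrow> h \<le> r \<Longrightarrow> q h = nth_smallest R h"
  by (simp add: qq_def nth_smallest_def)

lemma q_in_R: "1 \<le> h \<Longrightarrow> h \<le> r \<Longrightarrow> q h \<in> R"
  using q_eq nth_smallest_mem[OF finite_R] by simp

lemma q_surj: "x \<in> R \<Longrightarrow> \<exists>h\<in>{1..r}. q h = x"
  using nth_smallest_image[OF finite_R] q_eq by (metis (no_types, lifting) atLeastAtMost_iff imageE)

lemma q_pos: "1 \<le> h \<Longrightarrow> 1 \<le> q h"
  using q_in_R[of h] R_subset n_pos by (cases "h \<le> r") (auto simp: qq_def)

lemma q_less_n: "h \<le> r \<Longrightarrow> q h < n"
  using q_in_R[of h] R_subset n_pos by (cases "h = 0") force+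

lemma q_less:
  assumes "g < h" "h \<le> Suc r" shows "q g < q h"
proof (cases "g = 0")
  case True then show ?thesis using q_pos[of h] assms by simp
next
  case False
  show ?thesis
  proof (cases "h = Suc r")
    case True then show ?thesis using q_less_n[of g] assms by simp
  next
    case h: False
    then show ?thesis using nth_smallest_less[of g h R] q_eq[of g] q_eq[of h] False assms by simp
  qed
qed

lemma q_le: "g \<le> h \<Longrightarrow> h \<le> Suc r \<Longrightarrow> q g \<le> q h"
  using q_less[of g h] by (cases "g = h") auto

lemma q_le_n: "h \<le> Suc r \<Longrightarrow> q h \<le> n" using q_le[of h "Suc r"] by simp

lemma q_less_iff: "g \<le> Suc r \<Longrightarrow> h \<le> Suc r \<Longrightarrow> q g < q h \<longleftrightarrow> g < h"
  using q_less[of g h] q_le[of h g] by (meson leD leI)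

lemma carrel:
  assumes "1 \<le> i" "i \<le> n"
  shows "1 \<le> carrel i" "carrel i \<le> Suc r" "q (carrel i - 1) < i" "i \<le> q (carrel i)"
proof -
  have ex: "i \<le> q (Suc r)" using assms by simp
  show le: "i \<le> q (carrel i)" unfolding carrel_def using ex by (rule LeastI)
  show "carrel i \<le> Suc r" unfolding carrel_def using ex by (rule Least_le)
  show pos: "1 \<le> carrel i" using le assms by (metis Suc_leI One_nat_def gr0I q_0 not_one_le_zero order_trans)
  then have "carrel i - 1 < carrel i" by simp
  then show "q (carrel i - 1) < i"
    unfolding carrel_def using not_less_Least leI by blast
qed

lemma carrel_eq:
  assumes "h \<le> r" "q h < i" "i \<le> q (Suc h)"
  shows "carrel i = Suc h"
  unfolding carrel_def
proof (rule Least_equality)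
  fix g assume "i \<le> q g"
  then show "Suc h \<le> g" using q_le[of g h] assms by (meson leD le_trans not_less_eq_eq le_Suc_eq)
qed fact

lemma R_increasing_iff:
  "R_increasing n R \<nu> \<longleftrightarrow> (\<forall>h\<le>r. strict_mono_on {q h<..q (Suc h)} \<nu>)"
proof
  assume *: "R_increasing n R \<nu>"
  show "\<forall>h\<le>r. strict_mono_on {q h<..q (Suc h)} \<nu>"
  proof (intro allI impI)
    fix h assume "h \<le> r"
    then have "Suc h \<in> {1..r + 1}" by simp
    then have "\<forall>i j. q (Suc h - 1) < i \<and> i < j \<and> j \<le> q (Suc h) \<longrightarrow> \<nu> i < \<nu> j"
      using * unfolding R_increasing_def by blast
    then show "strict_mono_on {q h<..q (Suc h)} \<nu>" by (auto simp: strict_mono_on_def)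
  qed
next
  assume *: "\<forall>h\<le>r. strict_mono_on {q h<..q (Suc h)} \<nu>"
  show "R_increasing n R \<nu>"
    unfolding R_increasing_def
  proof (intro ballI allI impI)
    fix h i j assume h: "h \<in> {1..r + 1}" and ij: "q (h - 1) < i \<and> i < j \<and> j \<le> q h"
    have "h - 1 \<le> r" using h by auto
    then have "strict_mono_on {q (h - 1)<..q (Suc (h - 1))} \<nu>" using * by blast
    then show "\<nu> i < \<nu> j" using h ij by (auto simp: strict_mono_on_def)
  qed
qed

lemma q_Suc_split: "h \<le> r \<Longrightarrow> {1..q (Suc h)} = {1..q h} \<union> {q h<..q (Suc h)}"
  using q_less[of h "Suc h"] by auto

lemma R_chain_mono:
  assumes "R_chain n R B" "g \<le> h" "h \<le> Suc r"
  shows "B g \<subseteq> B h"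
  using assms(2,3)
proof (induction rule: dec_induct)
  case (step h)
  then have "B h \<subset> B (Suc h)" using assms(1) by (simp add: R_chain_def)
  then show ?case using step by auto
qed simp

lemma R_chain_subset: "R_chain n R B \<Longrightarrow> B h \<subseteq> {1..n}"
  using R_chain_mono[of B h "Suc r"] by (cases "h \<le> Suc r") (auto simp: R_chain_def)

lemma R_chain_finite: "R_chain n R B \<Longrightarrow> finite (B h)"
  using R_chain_subset finite_subset by blast

lemma R_chain_card: "R_chain n R B \<Longrightarrow> h \<le> Suc r \<Longrightarrow> card (B h) = q h"
  by (simp add: R_chain_def)

text \<open>Cardinalities supply the rest: \<open>q 0 = 0\<close> empties \<open>B 0\<close>,
  \<open>q (Suc r) = n\<close> makes the top all of \<open>{1..n}\<close>, and
  \<open>q h < q (Suc h)\<close> makes each inclusion proper.\<close>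

lemma R_chainI:
  assumes "\<And>h. h > Suc r \<Longrightarrow> B h = {}" "\<And>h. h \<le> r \<Longrightarrow> B h \<subseteq> B (Suc h)"
    "\<And>h. h \<le> Suc r \<Longrightarrow> finite (B h) \<and> card (B h) = q h" "B (Suc r) \<subseteq> {1..n}"
  shows "R_chain n R B"
  unfolding R_chain_def
proof (intro conjI allI impI)
  show "B 0 = {}" using assms(3)[of 0] by auto
  show "B (r + 1) = {1..n}" using assms(3)[of "Suc r"] assms(4) by (simp add: card_subset_eq)
  fix h assume h: "h \<le> r"
  then have "card (B h) < card (B (Suc h))" using assms(3)[of h] assms(3)[of "Suc h"] q_less[of h "Suc h"] by simp
  then show "B h \<subset> B (Suc h)" using assms(2)[OF h] by auto
qed (use assms in auto)

lemma chain_of_R_chain: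
  assumes "R_permutation n R \<sigma>"
  shows "R_chain n R (chain_of n R \<sigma>)"
proof (rule R_chainI)
  have s: "\<sigma> permutes {1..n}" using assms by (simp add: R_permutation_def)
  show "chain_of n R \<sigma> (Suc r) \<subseteq> {1..n}"
    using permutes_image[OF s] by (simp add: chain_of_def)
  fix h
  show "finite (chain_of n R \<sigma> h) \<and> card (chain_of n R \<sigma> h) = q h" if "h \<le> Suc r"
    using that permutes_inj_on[OF s, of "{1..q h}"] by (simp add: chain_of_def card_image)
  show "chain_of n R \<sigma> h \<subseteq> chain_of n R \<sigma> (Suc h)" if "h \<le> r"
    using that q_Suc_split[OF that] by (auto simp: chain_of_def)
qed (simp add: chain_of_def)

lemma carrel_image:
  assumes "R_permutation n R \<sigma>" "h \<le> r"
  shows "\<sigma> ` {q h<..q (Suc h)} = chain_of n R \<sigma> (Suc h) - chain_of n R \<sigma> h"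
proof -
  have s: "inj \<sigma>" using assms by (auto simp: R_permutation_def permutes_inj)
  have "{q h<..q (Suc h)} = {1..q (Suc h)} - {1..q h}" by auto
  then show ?thesis using assms(2) image_set_diff[OF s] by (simp add: chain_of_def)
qed

text \<open>On each carrel both permutations list \<open>B (Suc h) - B h\<close> in increasing
  order, which leaves no choice; outside \<open>{1..n}\<close> both are the identity.\<close>

lemma chain_of_inj:
  assumes s: "R_permutation n R \<sigma>" and t: "R_permutation n R \<tau>"
    and eq: "chain_of n R \<sigma> = chain_of n R \<tau>"
  shows "\<sigma> = \<tau>"
proof
  fix i
  show "\<sigma> i = \<tau> i"
  proof (cases "i \<in> {1..n}")
    case True
    then obtain h where h: "carrel i = Suc h" "h \<le> r" "q h < i" "i \<le> q (Suc h)"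
      using carrel[of i] by (cases "carrel i") auto
    show ?thesis
      using strict_mono_on_same_image[of "{q h<..q (Suc h)}" \<sigma> \<tau> i] carrel_image[OF s h(2)]
        carrel_image[OF t h(2)] eq s t h by (auto simp: R_permutation_def R_increasing_iff)
  next
    case False
    then show ?thesis using s t by (metis R_permutation_def permutes_not_in)
  qed
qed

lemma chain_of_surj:
  assumes B: "R_chain n R B"
  shows "\<exists>\<sigma>. R_permutation n R \<sigma> \<and> chain_of n R \<sigma> = B"
proof -
  \<comment> \<open>Each carrel lists the elements new at its step in increasing order; the identity
    outside \<open>{1..n}\<close> is what \<open>permutes\<close> demands.\<close>
  define \<sigma> where "\<sigma> i = (if i \<in> {1..n} then
     nth_smallest (B (carrel i) - B (carrel i - 1)) (i - q (carrel i - 1)) else i)" for i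
  have val: "\<sigma> i = nth_smallest (B (Suc h) - B h) (i - q h)" if "h \<le> r" "i \<in> {q h<..q (Suc h)}" for h i
    using that carrel_eq[of h i] q_le_n[of "Suc h"] by (auto simp: \<sigma>_def)
  have cardD: "card (B (Suc h) - B h) = q (Suc h) - q h" if "h \<le> r" for h
    using that R_chain_card[OF B] R_chain_mono[OF B, of h "Suc h"] R_chain_finite[OF B]
    by (simp add: card_Diff_subset)
  have inc: "strict_mono_on {q h<..q (Suc h)} \<sigma>" if "h \<le> r" for h
    using val[OF that] cardD[OF that] by (auto simp: strict_mono_on_def intro!: nth_smallest_less)
  have im: "\<sigma> ` {q h<..q (Suc h)} = B (Suc h) - B h" if "h \<le> r" for h
  proof -
    have "(\<lambda>i. i - q h) ` {q h<..q (Suc h)} = {1..q (Suc h) - q h}"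
    proof (intro set_eqI iffI)
      fix x assume "x \<in> {1..q (Suc h) - q h}"
      then have "x + q h \<in> {q h<..q (Suc h)}" "x = (x + q h) - q h" by auto
      then show "x \<in> (\<lambda>i. i - q h) ` {q h<..q (Suc h)}" by (metis imageI)
    qed auto
    then have "nth_smallest (B (Suc h) - B h) ` (\<lambda>i. i - q h) ` {q h<..q (Suc h)} = B (Suc h) - B h"
      using nth_smallest_image[of "B (Suc h) - B h"] cardD[OF that] R_chain_finite[OF B] by simp
    then show ?thesis using val[OF that] by (simp add: image_image)
  qed
  have img: "\<sigma> ` {1..q h} = B h" if "h \<le> Suc r" for h
    using that
  proof (induction h)
    case 0 then show ?case using B by (simp add: R_chain_def)
  next
    case (Suc h)
    then show ?case using q_Suc_split[of h] im[of h] R_chain_mono[OF B, of h "Suc h"]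
      by (auto simp: image_Un)
  qed
  have all: "\<sigma> ` {1..n} = {1..n}" using img[of "Suc r"] B by (simp add: R_chain_def)
  then have "bij_betw \<sigma> {1..n} {1..n}"
    by (simp add: bij_betw_def finite_surj_inj)
  then have "\<sigma> permutes {1..n}" by (rule bij_imp_permutes) (auto simp: \<sigma>_def)
  then have "R_permutation n R \<sigma>" using inc by (simp add: R_permutation_def R_increasing_iff)
  moreover have "chain_of n R \<sigma> = B"
  proof
    fix h show "chain_of n R \<sigma> h = B h" using img[of h] B by (auto simp: chain_of_def R_chain_def)
  qed
  ultimately show ?thesis by blast
qed

text \<open>In a pattern, \<open>\<sigma> a\<close> is the old element \<open>x\<close>,
  \<open>\<sigma> b\<close> the new element \<open>y\<close>, and \<open>\<sigma> c\<close> the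
  missing value \<open>z\<close> between them: membership in \<open>B h\<close> and
  \<open>B (h + 1)\<close> only records on which side of \<open>q h\<close> and
  \<open>q (h + 1)\<close> a position lies.\<close>

lemma avoiding_iff_gapless:
  assumes s: "R_permutation n R \<sigma>"
  shows "\<not> R_312_containing n R \<sigma> \<longleftrightarrow> gapless_chain n R (chain_of n R \<sigma>)"
proof -
  let ?B = "chain_of n R \<sigma>"
  have B: "R_chain n R ?B" by (rule chain_of_R_chain[OF s])
  have perm: "\<sigma> permutes {1..n}" using s by (simp add: R_permutation_def)
  have "R_312_containing n R \<sigma> \<longleftrightarrow> \<not> gapless_chain n R ?B"
  proof
    assume "R_312_containing n R \<sigma>"
    then obtain h a b c where *: "h \<in> {1..r - 1}" "1 \<le> a" "a \<le> q h" "q h < b" "b \<le> q (h + 1)"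
        "q (h + 1) < c" "c \<le> n" "\<sigma> b < \<sigma> c" "\<sigma> c < \<sigma> a"
      unfolding R_312_containing_def by blast
    then have "\<sigma> a \<in> ?B h" by (auto simp: chain_of_def)
    moreover have "\<sigma> b \<in> ?B (h + 1) - ?B h" using carrel_image[OF s, of h] *
      by (metis (no_types, lifting) Suc_eq_plus1 atLeastAtMost_iff diff_le_self greaterThanAtMost_iff imageI le_trans)
    moreover have "\<sigma> c \<notin> ?B (h + 1)"
      using * permutes_inj[OF perm] by (auto simp: chain_of_def inj_eq)
    ultimately show "\<not> gapless_chain n R ?B" using * unfolding gapless_chain_def by fastforce
  next
    assume "\<not> gapless_chain n R ?B"
    then obtain h x y z where *: "h \<in> {1..r}" "y \<in> ?B (h + 1) - ?B h" "x \<in> ?B h" "y < z" "z < x" "z \<notin> ?B (h + 1)"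
      using B unfolding gapless_chain_def by blast
    have zn: "z \<in> {1..n}" using * R_chain_subset[OF B, of h] by auto
    \<comment> \<open>A missing \<open>z\<close> cannot occur at \<open>h = r\<close>, because
      \<open>B (r + 1)\<close> is all of \<open>{1..n}\<close>; this reconciles the ranges
      \<open>{1..r}\<close> and \<open>{1..r - 1}\<close>.\<close>
    have hr: "h \<noteq> r" using * zn B by (auto simp: R_chain_def)
    obtain a where a: "x = \<sigma> a" "1 \<le> a" "a \<le> q h" using * by (auto simp: chain_of_def)
    have "y \<in> \<sigma> ` {q h<..q (h + 1)}" using * carrel_image[OF s, of h] by simp
    then obtain b where b: "y = \<sigma> b" "q h < b" "b \<le> q (h + 1)" by auto
    obtain c where c: "z = \<sigma> c" "c \<in> {1..n}" using zn permutes_image[OF perm] by (metis imageE)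
    then have "q (h + 1) < c" using * by (auto simp: chain_of_def)
    then show "R_312_containing n R \<sigma>"
      unfolding R_312_containing_def using * hr a b c
      by (intro bexI[of _ h] exI[of _ a] exI[of _ b] exI[of _ c]) auto
  qed
  then show ?thesis by blast
qed

lemma bij_chain_of:
  "bij_betw (chain_of n R) {\<sigma>. R_permutation n R \<sigma> \<and> \<not> R_312_containing n R \<sigma>} {B. gapless_chain n R B}"
  unfolding bij_betw_def
proof (intro conjI inj_onI set_eqI iffI)
  fix B assume "B \<in> {B. gapless_chain n R B}"
  then show "B \<in> chain_of n R ` {\<sigma>. R_permutation n R \<sigma> \<and> \<not> R_312_containing n R \<sigma>}"
    using chain_of_surj[of B] avoiding_iff_gapless by (auto simp: gapless_chain_def)
qed (use chain_of_inj avoiding_iff_gapless in auto)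

lemma C_count_eq: "C_count n R = card {B. gapless_chain n R B}"
  unfolding C_count_def by (rule bij_betw_same_card[OF bij_chain_of])

end

section \<open>Words and clumps\<close>

context carrels
begin

definition chain_of_word :: "(nat \<Rightarrow> nat) \<Rightarrow> nat \<Rightarrow> nat set" where
  "chain_of_word w h = (if h \<le> Suc r then {i \<in> {1..n}. w i \<le> h} else {})"

definition word_of_chain :: "(nat \<Rightarrow> nat set) \<Rightarrow> nat \<Rightarrow> nat" where
  "word_of_chain B i = (if i \<in> {1..n} then LEAST h. i \<in> B h else 0)"

lemma q_Suc_eq: "h \<le> r \<Longrightarrow> q (Suc h) = q h + p (Suc h)"
  using q_le[of h "Suc h"] by (simp add: pp_def)

lemma word_carrel_card:
  assumes w: "multiset_word n R w" and h: "h \<le> Suc r"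
  shows "card {i \<in> {1..n}. w i \<le> h} = q h"
  using h
proof (induction h)
  case 0
  have "{i \<in> {1..n}. w i \<le> 0} = {}" using w by (force simp: multiset_word_def)
  then show ?case by simp
next
  case (Suc h)
  have "{i \<in> {1..n}. w i \<le> Suc h} = {i \<in> {1..n}. w i \<le> h} \<union> {i \<in> {1..n}. w i = Suc h}" by auto
  moreover have "card \<dots> = card {i \<in> {1..n}. w i \<le> h} + card {i \<in> {1..n}. w i = Suc h}"
    by (rule card_Un_disjoint) auto
  moreover have "card {i \<in> {1..n}. w i = Suc h} = p (Suc h)"
    using w Suc.prems by (simp add: multiset_word_def)
  ultimately show ?case using Suc q_Suc_eq[of h] by simp
qed

lemma chain_of_word_R_chain:
  assumes "multiset_word n R w"
  shows "R_chain n R (chain_of_word w)"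
  by (rule R_chainI) (use word_carrel_card[OF assms] in \<open>auto simp: chain_of_word_def\<close>)

text \<open>Positions play the role of values: for an occurrence \<open>i < j < k\<close> take
  \<open>h = w i - 1\<close>. Then \<open>i\<close> is the new element \<open>y\<close>,
  \<open>j\<close> has too large a letter and is the missing \<open>z\<close>, and \<open>k\<close>
  has a smaller letter and is the old \<open>x\<close>.\<close>

lemma avoids_231_iff_gapless:
  assumes w: "multiset_word n R w"
  shows "avoids_231 n w \<longleftrightarrow> gapless_chain n R (chain_of_word w)"
proof -
  let ?B = "chain_of_word w"
  have B: "R_chain n R ?B" by (rule chain_of_word_R_chain[OF w])
  have "\<not> avoids_231 n w \<longleftrightarrow> \<not> gapless_chain n R ?B"
  proof
    assume "\<not> avoids_231 n w"
    then obtain i j k where *: "1 \<le> i" "i < j" "j < k" "k \<le> n" "w k < w i" "w i < w j"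
      by (auto simp: avoids_231_def)
    have "i \<in> {1..n}" "j \<in> {1..n}" "k \<in> {1..n}" using * by auto
    then have r: "w i \<in> {1..r + 1}" "w j \<in> {1..r + 1}" "w k \<in> {1..r + 1}"
      using w unfolding multiset_word_def by blast+
    have "w i - 1 \<in> {1..r}" "i \<in> ?B (w i - 1 + 1) - ?B (w i - 1)" "j \<notin> ?B (w i - 1 + 1)"
      "k \<in> ?B (w i - 1)" using * r by (auto simp: chain_of_word_def)
    then show "\<not> gapless_chain n R ?B" using * unfolding gapless_chain_def by blast
  next
    assume "\<not> gapless_chain n R ?B"
    then obtain h x y z where *: "h \<in> {1..r}" "y \<in> ?B (h + 1) - ?B h" "x \<in> ?B h" "y < z" "z < x" "z \<notin> ?B (h + 1)"
      using B unfolding gapless_chain_def by blast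
    then have "w x < w y" "w y < w z" "1 \<le> y" "x \<le> n" by (auto simp: chain_of_word_def)
    then show "\<not> avoids_231 n w" using * by (auto simp: avoids_231_def)
  qed
  then show ?thesis by blast
qed

lemma word_of_chain_le_iff:
  assumes B: "R_chain n R B" and "i \<in> {1..n}" "h \<le> Suc r"
  shows "word_of_chain B i \<le> h \<longleftrightarrow> i \<in> B h"
proof
  assume "i \<in> B h" then show "word_of_chain B i \<le> h" using assms(2) by (auto simp: word_of_chain_def intro: Least_le)
next
  assume le: "word_of_chain B i \<le> h"
  have "i \<in> B (Suc r)" using B assms(2) by (simp add: R_chain_def)
  then have "i \<in> B (word_of_chain B i)" using assms(2) by (auto simp: word_of_chain_def intro: LeastI)
  then show "i \<in> B h" using R_chain_mono[OF B le assms(3)] by auto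
qed

lemma chain_of_word_of_chain:
  assumes B: "R_chain n R B"
  shows "chain_of_word (word_of_chain B) = B"
proof
  fix h
  show "chain_of_word (word_of_chain B) h = B h"
  proof (cases "h \<le> Suc r")
    case True
    then show ?thesis using word_of_chain_le_iff[OF B] R_chain_subset[OF B, of h] by (auto simp: chain_of_word_def)
  next
    case False then show ?thesis using B by (simp add: chain_of_word_def R_chain_def)
  qed
qed

lemma word_of_chain_multiset_word:
  assumes B: "R_chain n R B"
  shows "multiset_word n R (word_of_chain B)"
  unfolding multiset_word_def
proof (intro conjI ballI allI impI)
  fix i assume i: "i \<in> {1..n}"
  have "i \<in> B (Suc r)" "i \<notin> B 0" using B i by (auto simp: R_chain_def)
  then show "word_of_chain B i \<in> {1..r + 1}"
    using word_of_chain_le_iff[OF B i, of 0] word_of_chain_le_iff[OF B i, of "Suc r"] by simp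
next
  fix h assume "h \<in> {1..r + 1}"
  then obtain g where g: "h = Suc g" "g \<le> r" by (cases h) auto
  have "{i \<in> {1..n}. word_of_chain B i = h} = B (Suc g) - B g"
  proof (intro set_eqI iffI)
    fix i assume "i \<in> {i \<in> {1..n}. word_of_chain B i = h}"
    then show "i \<in> B (Suc g) - B g"
      using word_of_chain_le_iff[OF B, of i "Suc g"] word_of_chain_le_iff[OF B, of i g] g by auto
  next
    fix i assume i: "i \<in> B (Suc g) - B g"
    then have "i \<in> {1..n}" using R_chain_subset[OF B] by blast
    then show "i \<in> {i \<in> {1..n}. word_of_chain B i = h}"
      using word_of_chain_le_iff[OF B, of i "Suc g"] word_of_chain_le_iff[OF B, of i g] g i by auto
  qed
  then show "card {i \<in> {1..n}. word_of_chain B i = h} = p h"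
    using g R_chain_card[OF B] R_chain_mono[OF B, of g "Suc g"] R_chain_finite[OF B]
    by (simp add: card_Diff_subset pp_def)
next
  fix i assume "i \<notin> {1..n}"
  then show "word_of_chain B i = 0" unfolding word_of_chain_def by (rule if_not_P)
qed

lemma word_of_chain_of_word:
  assumes w: "multiset_word n R w"
  shows "word_of_chain (chain_of_word w) = w"
proof
  fix i
  show "word_of_chain (chain_of_word w) i = w i"
  proof (cases "i \<in> {1..n}")
    case True
    then have wi: "w i \<le> Suc r" using w by (auto simp: multiset_word_def)
    have "(LEAST h. i \<in> chain_of_word w h) = w i"
      by (rule Least_equality) (use True wi in \<open>auto simp: chain_of_word_def split: if_splits\<close>)
    then show ?thesis using True by (simp add: word_of_chain_def)
  next
    case False then show ?thesis using w by (auto simp: word_of_chain_def multiset_word_def)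
  qed
qed

lemma card_words: "card {w. multiset_word n R w \<and> avoids_231 n w} = card {B. gapless_chain n R B}"
proof (rule bij_betw_same_card[of chain_of_word], rule bij_betw_byWitness[of _ word_of_chain])
  show "chain_of_word ` {w. multiset_word n R w \<and> avoids_231 n w} \<subseteq> {B. gapless_chain n R B}"
    using avoids_231_iff_gapless by auto
  show "word_of_chain ` {B. gapless_chain n R B} \<subseteq> {w. multiset_word n R w \<and> avoids_231 n w}"
    using avoids_231_iff_gapless word_of_chain_multiset_word chain_of_word_of_chain
    by (auto simp: gapless_chain_def)
qed (use word_of_chain_of_word chain_of_word_of_chain in \<open>auto simp: gapless_chain_def\<close>)

end

section \<open>Clumps described by missing integers\<close>

definition clump_of :: "nat set \<Rightarrow> nat \<Rightarrow> nat set" where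
  "clump_of S b = {x. {min b x..max b x} \<subseteq> S}"

lemma clump_of_is_clump:
  assumes "b \<in> S" shows "is_clump S (clump_of S b)"
  unfolding is_clump_def
proof (intro conjI allI impI)
  show "clump_of S b \<subseteq> S" by (auto simp: clump_of_def)
  have "b \<in> clump_of S b" using assms by (simp add: clump_of_def)
  then show "clump_of S b \<noteq> {}" by blast
  show "consecutive (clump_of S b)"
    unfolding consecutive_def
  proof (intro ballI allI impI)
    fix x z y assume x: "x \<in> clump_of S b" and z: "z \<in> clump_of S b" and y: "x \<le> y \<and> y \<le> z"
    have "{min b y..max b y} \<subseteq> {min b x..max b x} \<union> {min b z..max b z}" using y by auto
    then show "y \<in> clump_of S b" using x z by (auto simp: clump_of_def)
  qed
  fix L assume L: "clump_of S b \<subseteq> L \<and> L \<subseteq> S \<and> consecutive L"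
  have b: "b \<in> L" using L assms by (auto simp: clump_of_def)
  have "x \<in> clump_of S b" if x: "x \<in> L" for x
  proof -
    have "min b x \<in> L" "max b x \<in> L" using b x by (auto simp: min_def max_def)
    then have "{min b x..max b x} \<subseteq> L" using L unfolding consecutive_def by (meson atLeastAtMost_iff subsetI)
    then show ?thesis using L by (auto simp: clump_of_def)
  qed
  then show "L = clump_of S b" using L by blast
qed

lemma is_clump_eq_clump_of:
  assumes "is_clump S L" "b \<in> L" shows "L = clump_of S b"
proof -
  have b: "b \<in> S" using assms by (auto simp: is_clump_def)
  have "x \<in> clump_of S b" if x: "x \<in> L" for x
  proof -
    have "min b x \<in> L" "max b x \<in> L" using assms(2) x by (auto simp: min_def max_def)
    then have "{min b x..max b x} \<subseteq> L"
      using assms(1) unfolding is_clump_def consecutive_def by (meson atLeastAtMost_iff subsetI)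
    then show ?thesis using assms(1) by (auto simp: clump_of_def is_clump_def)
  qed
  then have "L \<subseteq> clump_of S b" by blast
  moreover have "clump_of S b \<subseteq> S" "consecutive (clump_of S b)"
    using clump_of_is_clump[OF b] by (simp_all add: is_clump_def)
  ultimately show ?thesis using assms(1) unfolding is_clump_def by metis
qed

text \<open>A clump contains every integer between its minimum and any of its members. So if
  \<open>L\<close> starts first, a missing integer separates \<open>Min L\<close> from
  \<open>x\<close>, and it must come after \<open>b\<close>; conversely a missing \<open>z\<close>
  below \<open>x\<close> lies below \<open>Min L'\<close>. This removes clumps from the deletion
  condition.\<close>

lemma clump_less_iff_gap:
  assumes fin: "finite S" and L: "is_clump S L" "b \<in> L" and L': "is_clump S L'" "x \<in> L'"
  shows "Min L < Min L' \<longleftrightarrow> (\<exists>z. b < z \<and> z < x \<and> z \<notin> S)"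
proof -
  have sub: "L \<subseteq> S" "L' \<subseteq> S" using L(1) L'(1) by (simp_all add: is_clump_def)
  then have S: "b \<in> S" "x \<in> S" using L(2) L'(2) by auto
  have fL: "finite L" "finite L'" using fin sub finite_subset by blast+
  have mL: "Min L \<in> L" "Min L' \<in> L'" using fL L L' by (auto intro: Min_in)
  note e = is_clump_eq_clump_of[OF L] is_clump_eq_clump_of[OF L']
    is_clump_eq_clump_of[OF L(1) mL(1)] is_clump_eq_clump_of[OF L'(1) mL(2)]
  show ?thesis
  proof
    assume lt: "Min L < Min L'"
    then have "Min L \<notin> L'" using fL by (meson Min_le leD)
    then have "Min L \<notin> clump_of S x" using e(2) by simp
    then have "\<not> {min (Min L) x..max (Min L) x} \<subseteq> S" by (simp add: clump_of_def min.commute max.commute)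
    moreover have "Min L < x" using lt fL L' by (meson Min_le less_le_trans)
    ultimately obtain z where z: "Min L \<le> z" "z \<le> x" "z \<notin> S"
      by (metis (no_types, lifting) atLeastAtMost_iff less_imp_le max.absorb2 min.absorb1 subsetI)
    moreover have "b \<in> clump_of S (Min L)" using e(3) L by simp
    then have "{min (Min L) b..max (Min L) b} \<subseteq> S" by (simp add: clump_of_def)
    moreover have "Min L \<le> b" using fL L by simp
    ultimately have "b < z" by (metis (no_types, lifting) atLeastAtMost_iff leI max.absorb2 min.absorb1 subsetD)
    moreover have "z < x" using z S by (metis le_neq_implies_less)
    ultimately show "\<exists>z. b < z \<and> z < x \<and> z \<notin> S" using z by blast
  next
    assume "\<exists>z. b < z \<and> z < x \<and> z \<notin> S"
    then obtain z where z: "b < z" "z < x" "z \<notin> S" by blast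
    have "x \<in> clump_of S (Min L')" using e(4) L' by simp
    then have "{min (Min L') x..max (Min L') x} \<subseteq> S" by (simp add: clump_of_def)
    moreover have "Min L' \<le> x" using fL L' by simp
    ultimately have "{Min L'..x} \<subseteq> S" by (simp add: min.absorb1 max.absorb2)
    then have "z < Min L'" using z by (metis atLeastAtMost_iff leI less_imp_le subsetD)
    moreover have "Min L \<le> b" using fL L by simp
    ultimately show "Min L < Min L'" using z by simp
  qed
qed

text \<open>With \<open>clump_less_iff_gap\<close>, a missing integer between \<open>y\<close> in
  \<open>D\<close> and \<open>x\<close> puts \<open>x\<close> into a clump strictly right of
  \<open>L\<close>, which must be deleted entirely. Conversely the clump of the least deleted
  element can be taken as \<open>L\<close>.\<close>

lemma clump_deleting_iff:
  assumes fin: "finite S" and D: "D \<subseteq> S" "D \<noteq> {}"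
  shows "(\<exists>L. is_clump S L \<and> D \<subseteq> \<Union>{L'. is_clump S L' \<and> Min L \<le> Min L'} \<and>
            \<Union>{L'. is_clump S L' \<and> Min L < Min L'} \<subseteq> D)
     \<longleftrightarrow> (\<forall>y\<in>D. \<forall>x\<in>S - D. \<forall>z. y < z \<and> z < x \<longrightarrow> z \<in> S)" (is "?l \<longleftrightarrow> ?r")
proof
  assume ?l
  then obtain L where L: "is_clump S L" "D \<subseteq> \<Union>{L'. is_clump S L' \<and> Min L \<le> Min L'}"
     "\<Union>{L'. is_clump S L' \<and> Min L < Min L'} \<subseteq> D" by blast
  show ?r
  proof (intro ballI allI impI, rule ccontr)
    fix y x z assume *: "y \<in> D" "x \<in> S - D" "y < z \<and> z < x" "z \<notin> S"
    obtain L1 where L1: "is_clump S L1" "Min L \<le> Min L1" "y \<in> L1" using L(2) *(1) by blast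
    have x: "is_clump S (clump_of S x)" "x \<in> clump_of S x" using * clump_of_is_clump by (auto simp: clump_of_def)
    have "Min L1 < Min (clump_of S x)" using clump_less_iff_gap[OF fin L1(1,3) x] * by blast
    then have "x \<in> D" using L(3) L1(2) x by fastforce
    then show False using * by simp
  qed
next
  assume r: ?r
  have fD: "finite D" using fin D finite_subset by blast
  define b where "b = Min D"
  have b: "b \<in> D" using fD D(2) by (simp add: b_def)
  then have bS: "b \<in> S" using D(1) by blast
  let ?L = "clump_of S b"
  have L: "is_clump S ?L" "b \<in> ?L" using clump_of_is_clump[OF bS] bS by (simp_all add: clump_of_def)
  have "D \<subseteq> \<Union>{L'. is_clump S L' \<and> Min ?L \<le> Min L'}"
  proof
    fix d assume d: "d \<in> D"
    have d': "is_clump S (clump_of S d)" "d \<in> clump_of S d" using clump_of_is_clump D d by (auto simp: clump_of_def)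
    have "b \<le> d" using d fD by (simp add: b_def)
    then have "\<not> Min (clump_of S d) < Min ?L" using clump_less_iff_gap[OF fin d' L] by auto
    then show "d \<in> \<Union>{L'. is_clump S L' \<and> Min ?L \<le> Min L'}" using d' by auto
  qed
  moreover have "\<Union>{L'. is_clump S L' \<and> Min ?L < Min L'} \<subseteq> D"
  proof
    fix u assume "u \<in> \<Union>{L'. is_clump S L' \<and> Min ?L < Min L'}"
    then obtain L' where L': "is_clump S L'" "Min ?L < Min L'" "u \<in> L'" by blast
    then have "u \<in> S" by (auto simp: is_clump_def)
    moreover have "\<exists>z. b < z \<and> z < u \<and> z \<notin> S" using clump_less_iff_gap[OF fin L L'(1,3)] L' by blast
    ultimately show "u \<in> D" using r b by blast
  qed
  ultimately show ?l using L by blast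
qed

context carrels
begin

lemma clump_deleting_iff_gapless:
  "R_chain n R B \<and> rightmost_clump_deleting n R B \<longleftrightarrow> gapless_chain n R B"
proof (cases "R_chain n R B")
  case B: True
  have "(\<exists>L. is_clump (B (h + 1)) L \<and>
        B (h + 1) - B h \<subseteq> \<Union>{L'. is_clump (B (h + 1)) L' \<and> Min L \<le> Min L'} \<and>
        \<Union>{L'. is_clump (B (h + 1)) L' \<and> Min L < Min L'} \<subseteq> B (h + 1) - B h)
     \<longleftrightarrow> (\<forall>y\<in>B (h + 1) - B h. \<forall>x\<in>B h. \<forall>z. y < z \<and> z < x \<longrightarrow> z \<in> B (h + 1))"
    if "h \<in> {1..r}" for h
  proof -
    have "B h \<subset> B (h + 1)" using B that by (auto simp: R_chain_def)
    then have "B (h + 1) - B h \<noteq> {}" "B (h + 1) - (B (h + 1) - B h) = B h" by auto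
    then show ?thesis
      using clump_deleting_iff[OF R_chain_finite[OF B], of "B (h + 1) - B h" "h + 1"] by simp
  qed
  then show ?thesis unfolding rightmost_clump_deleting_def gapless_chain_def using B
    by (simp only: simp_thms cong: ball_cong)
qed (simp add: gapless_chain_def)

end

section \<open>Gapless tuples\<close>

lemma nth_smallest_eqI:
  assumes "finite A" "x \<in> A" "card {y \<in> A. y \<le> x} = i"
  shows "nth_smallest A i = x"
proof -
  have "x \<in> nth_smallest A ` {1..card A}" using nth_smallest_image[OF assms(1)] assms(2) by simp
  then obtain j where j: "1 \<le> j" "j \<le> card A" "x = nth_smallest A j" by auto
  then show ?thesis using card_le_nth_smallest[OF assms(1) j(1,2)] assms(3) by simp
qed

lemma card_less_nth_smallest:
  assumes "finite A" "k < card A"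
  shows "card {x \<in> A. x < nth_smallest A (Suc k)} = k"
proof -
  let ?g = "nth_smallest A (Suc k)"
  have "{x \<in> A. x < ?g} = {x \<in> A. x \<le> ?g} - {?g}" by auto
  moreover have "?g \<in> {x \<in> A. x \<le> ?g}" using nth_smallest_mem[of A "Suc k"] assms by simp
  ultimately show ?thesis using card_le_nth_smallest[of A "Suc k"] assms by simp
qed

lemma upper_part_eq_image:
  assumes "finite A" "k < card A"
  shows "{x \<in> A. nth_smallest A (Suc k) \<le> x} = nth_smallest A ` {k<..card A}"
proof (intro set_eqI iffI)
  fix x assume x: "x \<in> {x \<in> A. nth_smallest A (Suc k) \<le> x}"
  then have "x \<in> nth_smallest A ` {1..card A}" using nth_smallest_image[OF assms(1)] by simp
  then obtain j where j: "1 \<le> j" "j \<le> card A" "x = nth_smallest A j" by auto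
  then have "k < j" using x nth_smallest_less[of j "Suc k" A] assms(2)
    by (metis (no_types, lifting) Suc_leI linorder_not_le mem_Collect_eq not_less_eq)
  then show "x \<in> nth_smallest A ` {k<..card A}" using j by simp
next
  fix x assume "x \<in> nth_smallest A ` {k<..card A}"
  then obtain j where j: "k < j" "j \<le> card A" "x = nth_smallest A j" by auto
  then show "x \<in> {x \<in> A. nth_smallest A (Suc k) \<le> x}"
    using nth_smallest_mem[OF assms(1), of j] nth_smallest_less[of "Suc k" j A] by (cases "j = Suc k") auto
qed

text \<open>Consecutive values have consecutive ranks: the next value belongs to \<open>A\<close>
  and has some rank \<open>j > i + t\<close>, so the element of rank \<open>i + t + 1\<close> is at
  most this value, and strict increase excludes anything smaller.\<close>

lemma nth_smallest_interval:
  assumes "finite A" "1 \<le> i" "i \<le> card A" "{nth_smallest A i..m} \<subseteq> A" "nth_smallest A i + t \<le> m"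
  shows "i + t \<le> card A \<and> nth_smallest A (i + t) = nth_smallest A i + t"
  using assms(5)
proof (induction t)
  case 0 then show ?case using assms(3) by simp
next
  case (Suc t)
  let ?x = "nth_smallest A i + Suc t"
  have IH: "i + t \<le> card A" "nth_smallest A (i + t) = nth_smallest A i + t" using Suc by auto
  have "?x \<in> nth_smallest A ` {1..card A}" using Suc.prems assms(4) nth_smallest_image[OF assms(1)] by auto
  then obtain j where j: "1 \<le> j" "j \<le> card A" "?x = nth_smallest A j" by auto
  have lt: "i + t < j"
  proof (rule ccontr)
    assume "\<not> i + t < j"
    then have "nth_smallest A j \<le> nth_smallest A (i + t)"
      using nth_smallest_less[of j "i + t" A] j IH(1) by (cases "j = i + t") auto
    then show False using IH(2) j(3) by simp
  qed
  then have "nth_smallest A (i + Suc t) \<le> ?x"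
    using nth_smallest_less[of "i + Suc t" j A] j by (cases "j = i + Suc t") auto
  moreover have "nth_smallest A (i + t) < nth_smallest A (i + Suc t)"
    using nth_smallest_less[of "i + t" "i + Suc t" A] assms(2) lt j(2) by simp
  ultimately show ?case using IH lt j(2) by simp
qed

context carrels
begin

lemma carrel_cases:
  assumes "i \<in> {1..n}"
  obtains h where "h \<le> r" "carrel i = Suc h" "i \<in> {q h<..q (Suc h)}"
proof -
  have "1 \<le> carrel i" "carrel i \<le> Suc r" "q (carrel i - 1) < i" "i \<le> q (carrel i)"
    using carrel[of i] assms by auto
  then show ?thesis using that[of "carrel i - 1"] by simp
qed

lemma carrel_in_range: "h \<le> r \<Longrightarrow> i \<in> {q h<..q (Suc h)} \<Longrightarrow> i \<in> {1..n}"
  using q_le_n[of "Suc h"] by auto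

text \<open>The rank is the global index \<open>i\<close>. Since \<open>B (Suc h)\<close> has
  \<open>q (Suc h)\<close> elements, the ranks in the carrel above \<open>q h\<close> are exactly
  those of its \<open>p (Suc h)\<close> largest elements.\<close>

definition tuple_of_chain :: "(nat \<Rightarrow> nat set) \<Rightarrow> nat \<Rightarrow> nat" where
  "tuple_of_chain B i = (if i \<in> {1..n} then nth_smallest (B (carrel i)) i else 0)"

lemma tuple_of_chain_eq:
  assumes "h \<le> r" "i \<in> {q h<..q (Suc h)}"
  shows "tuple_of_chain B i = nth_smallest (B (Suc h)) i"
proof -
  have "carrel i = Suc h" using carrel_eq[of h i] assms by simp
  then show ?thesis using carrel_in_range[OF assms] unfolding tuple_of_chain_def by simp
qed

text \<open>Pigeonhole: \<open>q h + 1\<close> elements of \<open>B (Suc h)\<close> are at most the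
  bound, and only \<open>q h\<close> of them can be old.\<close>

lemma ex_new_le:
  assumes B: "R_chain n R B" and h: "h \<le> r"
  shows "\<exists>y\<in>B (Suc h) - B h. y \<le> nth_smallest (B (Suc h)) (Suc (q h))"
proof (rule ccontr)
  let ?g = "nth_smallest (B (Suc h)) (Suc (q h))"
  assume "\<not> ?thesis"
  then have "{x \<in> B (Suc h). x \<le> ?g} \<subseteq> B h" by auto
  then have "card {x \<in> B (Suc h). x \<le> ?g} \<le> q h"
    using card_mono[OF R_chain_finite[OF B, of h]] R_chain_card[OF B, of h] h by simp
  moreover have "Suc (q h) \<le> card (B (Suc h))" using R_chain_card[OF B, of "Suc h"] q_less[of h "Suc h"] h by simp
  ultimately show False using card_le_nth_smallest[OF R_chain_finite[OF B], of "Suc (q h)" "Suc h"] by simp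
qed

text \<open>Suppose the maximum \<open>m\<close> of \<open>B h\<close> exceeds the first entry
  \<open>g\<close> of the next carrel. Some new element is at most \<open>g\<close>, so gaplessness
  puts all of \<open>{g..m}\<close> into \<open>B (Suc h)\<close>, and consecutive values occupy
  consecutive ranks.\<close>

lemma tuple_of_chain_gapless:
  assumes G: "gapless_chain n R B"
  shows "gapless_R_tuple n R (tuple_of_chain B)"
proof -
  let ?\<gamma> = "tuple_of_chain B"
  have B: "R_chain n R B" using G by (simp add: gapless_chain_def)
  note fin = R_chain_finite[OF B]
  have crd: "card (B (Suc h)) = q (Suc h)" if "h \<le> r" for h using R_chain_card[OF B] that by simp
  have rng: "?\<gamma> i \<in> {1..n} \<and> i \<le> ?\<gamma> i" if i: "i \<in> {1..n}" for i
  proof -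
    obtain h where h: "h \<le> r" "i \<in> {q h<..q (Suc h)}" using carrel_cases[OF i] by metis
    have i': "1 \<le> i" "i \<le> card (B (Suc h))" using i h crd[OF h(1)] by auto
    have "nth_smallest (B (Suc h)) i \<in> {1..n}" using nth_smallest_mem[OF fin i'] R_chain_subset[OF B] by blast
    moreover have "0 \<notin> B (Suc h)" using R_chain_subset[OF B, of "Suc h"] by auto
    then have "i \<le> nth_smallest (B (Suc h)) i" using nth_smallest_ge[OF fin _ i'] by blast
    ultimately show ?thesis using tuple_of_chain_eq[OF h] by simp
  qed
  have inc: "strict_mono_on {q h<..q (Suc h)} ?\<gamma>" if "h \<le> r" for h
    using tuple_of_chain_eq[OF that] crd[OF that] by (auto simp: strict_mono_on_def intro!: nth_smallest_less)
  have gap: "?\<gamma> (q h) - ?\<gamma> (q h + 1) + 1 \<le> p (h + 1) \<and>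
      (\<forall>t\<in>{1..?\<gamma> (q h) - ?\<gamma> (q h + 1) + 1}. ?\<gamma> (q h + t) = ?\<gamma> (q h) - (?\<gamma> (q h) - ?\<gamma> (q h + 1) + 1) + t)"
    if h: "h \<in> {1..r}" and gt: "?\<gamma> (q h) > ?\<gamma> (q h + 1)" for h
  proof -
    have h': "h \<le> r" "1 \<le> h" using h by auto
    define m where "m = ?\<gamma> (q h)"
    define g where "g = ?\<gamma> (q h + 1)"
    have qlt: "q h < q (Suc h)" using q_less[of h "Suc h"] h' by simp
    have g: "g = nth_smallest (B (Suc h)) (Suc (q h))"
      using tuple_of_chain_eq[OF h'(1), of "q h + 1"] qlt by (simp add: g_def)
    have m: "m = nth_smallest (B h) (q h)"
      using tuple_of_chain_eq[of "h - 1" "q h"] q_less[of "h - 1" h] h' by (simp add: m_def)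
    have mB: "m \<in> B h" using nth_smallest_mem[OF fin, of "q h" h] q_pos[of h] R_chain_card[OF B, of h] h' m by simp
    then have mB': "m \<in> B (Suc h)" using R_chain_mono[OF B, of h "Suc h"] h' by auto
    have gB: "g \<in> B (Suc h)" using nth_smallest_mem[OF fin, of "Suc (q h)" "Suc h"] crd[OF h'(1)] qlt g by simp
    then have "1 \<le> g" using R_chain_subset[OF B, of "Suc h"] by auto
    obtain y where y: "y \<in> B (Suc h) - B h" "y \<le> g" using ex_new_le[OF B h'(1)] g by auto
    have sub: "{g..m} \<subseteq> B (Suc h)"
    proof
      fix z assume z: "z \<in> {g..m}"
      consider "z = g" | "z = m" | "y < z" "z < m" using y z by force
      then show "z \<in> B (Suc h)"
      proof cases
        case 3 then show ?thesis using G h y mB unfolding gapless_chain_def by (metis Suc_eq_plus1)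
      qed (use gB mB' in auto)
    qed
    have run: "Suc (q h) + t \<le> q (Suc h) \<and> nth_smallest (B (Suc h)) (Suc (q h) + t) = g + t" if "g + t \<le> m" for t
      using nth_smallest_interval[OF fin, of "Suc (q h)" "Suc h" m t] qlt crd[OF h'(1)] sub g that by simp
    have gm: "g < m" using gt by (simp add: g_def m_def)
    \<comment> \<open>The rank of \<open>m\<close> in \<open>B (Suc h)\<close> is
      \<open>q h + 1 + (m - g)\<close>, and no rank exceeds \<open>q (Suc h)\<close>.\<close>
    have "g + (m - g) \<le> m" using gm by simp
    from run[OF this] qlt have "m - g + 1 \<le> q (Suc h) - q h" by linarith
    then have s: "m - g + 1 \<le> p (h + 1)" by (simp add: pp_def)
    have "?\<gamma> (q h + t) = m - (m - g + 1) + t" if t: "t \<in> {1..m - g + 1}" for t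
    proof -
      have "?\<gamma> (q h + t) = nth_smallest (B (Suc h)) (q h + t)"
        using tuple_of_chain_eq[OF h'(1), of "q h + t"] t run[of "t - 1"] gm by auto
      then show ?thesis using run[of "t - 1"] t gm \<open>1 \<le> g\<close> by auto
    qed
    then show ?thesis using s by (simp add: m_def g_def)
  qed
  show ?thesis
    unfolding gapless_R_tuple_def R_tuple_def upper_def Let_def
    using rng inc gap by (simp add: R_increasing_iff) (simp add: tuple_of_chain_def)
qed

text \<open>If \<open>B h\<close> reaches \<open>g\<close>, let \<open>b\<close> be the least new
  element: below \<open>b\<close> everything is old, and from \<open>b\<close> up to
  \<open>g\<close> gaplessness leaves no hole. If \<open>B h\<close> stays below \<open>g\<close>,
  it is the whole lower part by cardinality, and \<open>b = g\<close> with an empty interval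
  works.\<close>

lemma lower_part_eq:
  assumes G: "gapless_chain n R B" and h: "h \<le> r" and g: "g = nth_smallest (B (Suc h)) (Suc (q h))"
  shows "\<exists>b\<le>g. {x \<in> B (Suc h). x < g} = {x \<in> B h. x < b} \<union> {b..<g}"
proof -
  have B: "R_chain n R B" using G by (simp add: gapless_chain_def)
  note fin = R_chain_finite[OF B]
  have sub: "B h \<subseteq> B (Suc h)" using R_chain_mono[OF B, of h "Suc h"] h by simp
  have cl: "card {x \<in> B (Suc h). x < g} = q h"
    using card_less_nth_smallest[OF fin, of "q h" "Suc h"] R_chain_card[OF B, of "Suc h"] q_less[of h "Suc h"] h g by simp
  show ?thesis
  proof (cases "\<exists>m\<in>B h. g \<le> m")
    case True
    then obtain m where m: "m \<in> B h" "g \<le> m" by blast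
    then have h1: "h \<in> {1..r}" using h B by (cases "h = 0") (auto simp: R_chain_def)
    define b where "b = Min (B (Suc h) - B h)"
    obtain y where y: "y \<in> B (Suc h) - B h" "y \<le> g" using ex_new_le[OF B h] g by auto
    have b: "b \<in> B (Suc h) - B h" "\<And>y. y \<in> B (Suc h) - B h \<Longrightarrow> b \<le> y"
      using y(1) fin unfolding b_def by (metis Min_in empty_iff finite_Diff, simp)
    have "{x \<in> B (Suc h). x < g} = {x \<in> B h. x < b} \<union> {b..<g}"
    proof (intro set_eqI iffI)
      fix x assume "x \<in> {x \<in> B (Suc h). x < g}"
      then show "x \<in> {x \<in> B h. x < b} \<union> {b..<g}" using b(2)[of x] by (cases "x \<in> B h") auto
    next
      fix x assume x: "x \<in> {x \<in> B h. x < b} \<union> {b..<g}"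
      have "x \<in> B (Suc h)" if "b < x" "x < m"
        using G h1 b(1) m that unfolding gapless_chain_def by (metis Suc_eq_plus1)
      then have "x \<in> B (Suc h)" using x sub b(1) m by (cases "x = b") auto
      moreover have "x < g" using x b(2)[OF y(1)] y(2) by auto
      ultimately show "x \<in> {x \<in> B (Suc h). x < g}" by simp
    qed
    then show ?thesis using b(2)[OF y(1)] y(2) by (intro exI[of _ b]) simp
  next
    case False
    then have "B h \<subseteq> {x \<in> B (Suc h). x < g}" using sub by auto
    then have eq: "B h = {x \<in> B (Suc h). x < g}"
      using cl R_chain_card[OF B, of h] h fin by (intro card_subset_eq) auto
    then have "{x \<in> B h. x < g} \<union> {g..<g} = {x \<in> B (Suc h). x < g}" by auto
    then show ?thesis by (metis order_refl)
  qed
qed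

lemma tuple_of_chain_inj:
  assumes G: "gapless_chain n R B" and G': "gapless_chain n R B'"
    and eq: "tuple_of_chain B = tuple_of_chain B'"
  shows "B = B'"
proof -
  have B: "R_chain n R B" and B': "R_chain n R B'" using G G' by (simp_all add: gapless_chain_def)
  have "B h = B' h" if "h \<le> Suc r" for h
    using that
  proof (induction h)
    case 0 then show ?case using B B' by (simp add: R_chain_def)
  next
    case (Suc h)
    then have h: "h \<le> r" and IH: "B h = B' h" by auto
    have qlt: "q h < q (Suc h)" using q_less[of h "Suc h"] h by simp
    have crd: "card (B (Suc h)) = q (Suc h)" "card (B' (Suc h)) = q (Suc h)"
      using R_chain_card[OF B, of "Suc h"] R_chain_card[OF B', of "Suc h"] h by simp_all
    note fin = R_chain_finite[OF B, of "Suc h"] R_chain_finite[OF B', of "Suc h"]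
    have val: "nth_smallest (B (Suc h)) i = nth_smallest (B' (Suc h)) i" if "i \<in> {q h<..q (Suc h)}" for i
      using tuple_of_chain_eq[OF h that] eq by metis
    define g where "g = nth_smallest (B (Suc h)) (Suc (q h))"
    have g': "g = nth_smallest (B' (Suc h)) (Suc (q h))" using val[of "Suc (q h)"] qlt by (simp add: g_def)
    obtain b where b: "{x \<in> B (Suc h). x < g} = {x \<in> B h. x < b} \<union> {b..<g}" "b \<le> g"
      using lower_part_eq[OF G h g_def] by blast
    obtain b' where b': "{x \<in> B' (Suc h). x < g} = {x \<in> B h. x < b'} \<union> {b'..<g}" "b' \<le> g"
      using lower_part_eq[OF G' h g'] IH by auto
    have c: "card {x \<in> B (Suc h). x < g} = card {x \<in> B' (Suc h). x < g}"
      using card_less_nth_smallest[OF fin(1), of "q h"] card_less_nth_smallest[OF fin(2), of "q h"] crd qlt g'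
      by (simp add: g_def)
    \<comment> \<open>The smaller bound gives the larger set: old elements between the two bounds
      lie below \<open>g\<close>, hence in the longer interval.\<close>
    have "{x \<in> B (Suc h). x < g} \<subseteq> {x \<in> B' (Suc h). x < g} \<or> {x \<in> B' (Suc h). x < g} \<subseteq> {x \<in> B (Suc h). x < g}"
      unfolding b(1) b'(1) using b(2) b'(2) by (cases "b \<le> b'") auto
    moreover have "finite {x \<in> B (Suc h). x < g}" "finite {x \<in> B' (Suc h). x < g}" using fin by auto
    ultimately have low: "{x \<in> B (Suc h). x < g} = {x \<in> B' (Suc h). x < g}"
      using c by (elim disjE) (rule card_subset_eq, assumption+, rule card_subset_eq[symmetric], assumption+, simp)
    have high: "{x \<in> B (Suc h). g \<le> x} = {x \<in> B' (Suc h). g \<le> x}"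
    proof -
      have "nth_smallest (B (Suc h)) ` {q h<..q (Suc h)} = nth_smallest (B' (Suc h)) ` {q h<..q (Suc h)}"
        using val by (intro image_cong) auto
      then show ?thesis
        using upper_part_eq_image[OF fin(1), of "q h"] upper_part_eq_image[OF fin(2), of "q h"]
        unfolding crd g_def[symmetric] g'[symmetric] using qlt by simp
    qed
    have split: "A = {x \<in> A. x < g} \<union> {x \<in> A. g \<le> x}" for A by auto
    show ?case using low high split[of "B (Suc h)"] split[of "B' (Suc h)"] by simp
  qed
  moreover have "B h = B' h" if "\<not> h \<le> Suc r" for h using B B' that by (simp add: R_chain_def)
  ultimately show ?thesis by blast
qed

end

text \<open>A discrete intermediate value argument: the cardinality is at least
  \<open>g - 1 \<ge> k\<close> at \<open>b = 1\<close>, at most \<open>card A \<le> k\<close> at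
  \<open>b = g\<close>, and drops by at most one when \<open>b\<close> grows by one. The last
  \<open>b\<close> with cardinality at least \<open>k\<close> therefore hits
  \<open>k\<close>.\<close>

lemma ex_fill_bound:
  fixes A :: "nat set"
  assumes fin: "finite A" and k: "card A \<le> k" "k < g"
  shows "\<exists>b. 1 \<le> b \<and> b \<le> g \<and> card ({x \<in> A. x < b} \<union> {b..<g}) = k"
proof -
  define F where "F b = card ({x \<in> A. x < b} \<union> {b..<g})" for b
  have "{1..<g} \<subseteq> {x \<in> A. x < 1} \<union> {1..<g}" by auto
  then have "card {1..<g} \<le> F 1" unfolding F_def using fin by (intro card_mono) auto
  then have F1: "k \<le> F 1" using k by simp
  define b where "b = Max {b \<in> {1..g}. k \<le> F b}"
  have "1 \<in> {b \<in> {1..g}. k \<le> F b}" using F1 k by simp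
  then have b: "b \<in> {b \<in> {1..g}. k \<le> F b}" unfolding b_def by (intro Max_in) auto
  have "F b \<le> k"
  proof (cases "b = g")
    case True
    have "F g \<le> card A" unfolding F_def using fin by (intro card_mono) auto
    then show ?thesis using True k by simp
  next
    case False
    have less: "\<not> k \<le> F (Suc b)"
    proof
      assume "k \<le> F (Suc b)"
      then have "Suc b \<in> {b \<in> {1..g}. k \<le> F b}" using False b by auto
      then have "Suc b \<le> b" unfolding b_def by (intro Max_ge) auto
      then show False by simp
    qed
    have "{x \<in> A. x < b} \<union> {b..<g} \<subseteq> insert b ({x \<in> A. x < Suc b} \<union> {Suc b..<g})" by auto
    then have "F b \<le> card (insert b ({x \<in> A. x < Suc b} \<union> {Suc b..<g}))"
      unfolding F_def using fin by (intro card_mono) auto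
    also have "\<dots> \<le> Suc (F (Suc b))" unfolding F_def using fin by (simp add: card_insert_if)
    finally show ?thesis using less by simp
  qed
  then show ?thesis using b unfolding F_def by (intro exI[of _ b]) auto
qed

text \<open>The choice does not affect the resulting set: for finite \<open>A\<close> and
  \<open>b \<le> g\<close> these sets are nested, so those of cardinality \<open>k\<close>
  coincide.\<close>

definition fill_bound :: "nat set \<Rightarrow> nat \<Rightarrow> nat \<Rightarrow> nat" where
  "fill_bound A g k = (SOME b. 1 \<le> b \<and> b \<le> g \<and> card ({x \<in> A. x < b} \<union> {b..<g}) = k)"

lemma fill_bound:
  assumes "finite A" "card A \<le> k" "k < g"
  shows "1 \<le> fill_bound A g k" "fill_bound A g k \<le> g"
    "card ({x \<in> A. x < fill_bound A g k} \<union> {fill_bound A g k..<g}) = k"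
  using someI_ex[OF ex_fill_bound[OF assms]] unfolding fill_bound_def by blast+

section \<open>Rebuilding the chain from a gapless tuple\<close>

context carrels
begin

text \<open>The recursion imposes the shape found in \<open>lower_part_eq\<close>:
  \<open>q h\<close> elements below \<open>g\<close>, obtained by filling an interval just under
  \<open>g\<close>, and above them the entries of the carrel.\<close>

primrec chain_of_tuple :: "(nat \<Rightarrow> nat) \<Rightarrow> nat \<Rightarrow> nat set" where
  "chain_of_tuple \<gamma> 0 = {}"
| "chain_of_tuple \<gamma> (Suc h) =
    (let g = \<gamma> (Suc (q h)); b = fill_bound (chain_of_tuple \<gamma> h) g (q h)
     in {x \<in> chain_of_tuple \<gamma> h. x < b} \<union> {b..<g} \<union> \<gamma> ` {q h<..q (Suc h)})"

declare chain_of_tuple.simps(2) [simp del]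

text \<open>The lower part has the prescribed size by the choice of \<open>b\<close>; what remains
  is that old elements from \<open>g\<close> upwards are not lost, which is the gap condition, and
  that no gap arises, which is built into the shape of \<open>L h\<close>.\<close>

lemma tuple_of_chain_surj:
  assumes \<gamma>: "gapless_R_tuple n R \<gamma>"
  shows "\<exists>B. gapless_chain n R B \<and> tuple_of_chain B = \<gamma>"
proof -
  let ?C = "chain_of_tuple \<gamma>"
  have tup: "\<And>i. i \<in> {1..n} \<Longrightarrow> \<gamma> i \<in> {1..n}" "\<And>i. i \<notin> {1..n} \<Longrightarrow> \<gamma> i = 0"
    and up: "\<And>i. i \<in> {1..n} \<Longrightarrow> i \<le> \<gamma> i"
    and inc: "\<And>h. h \<le> r \<Longrightarrow> strict_mono_on {q h<..q (Suc h)} \<gamma>"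
    using \<gamma> by (auto simp: gapless_R_tuple_def R_tuple_def upper_def R_increasing_iff)
  define g where "g h = \<gamma> (Suc (q h))" for h
  define b where "b h = fill_bound (?C h) (g h) (q h)" for h
  define L where "L h = {x \<in> ?C h. x < b h} \<union> {b h..<g h}" for h
  have C_Suc: "?C (Suc h) = L h \<union> \<gamma> ` {q h<..q (Suc h)}" for h
    by (simp add: L_def b_def g_def Let_def chain_of_tuple.simps(2))
  have qlt: "q h < q (Suc h)" if "h \<le> r" for h using q_less[of h "Suc h"] that by simp
  have ge_g: "g h \<le> \<gamma> i" if "h \<le> r" "i \<in> {q h<..q (Suc h)}" for h i
    using strict_mono_onD[OF inc[OF that(1)], of "Suc (q h)" i] qlt[OF that(1)] that by (cases "i = Suc (q h)") (auto simp: g_def)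
  have qg: "q h < g h" if "h \<le> r" for h
    using up[of "Suc (q h)"] carrel_in_range[OF that, of "Suc (q h)"] qlt[OF that] by (simp add: g_def)
  have gn: "g h \<le> n" if "h \<le> r" for h
    using tup(1)[of "Suc (q h)"] carrel_in_range[OF that, of "Suc (q h)"] qlt[OF that] by (simp add: g_def)
  have bnd: "1 \<le> b h" "b h \<le> g h" "card (L h) = q h" if "finite (?C h)" "card (?C h) = q h" "h \<le> r" for h
    using fill_bound[of "?C h" "q h" "g h"] that qg[of h] by (simp_all add: b_def L_def)
  have L_less: "x < g h" if "finite (?C h)" "card (?C h) = q h" "h \<le> r" "x \<in> L h" for h x
    using bnd(2)[OF that(1-3)] that(4) by (auto simp: L_def)
  \<comment> \<open>The last conjunct bounds \<open>?C h\<close> by the last entry of its carrel,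
    the value at which the run in the gap condition ends.\<close>
  have inv: "finite (?C h) \<and> card (?C h) = q h \<and> ?C h \<subseteq> {1..n} \<and> (\<forall>x\<in>?C h. x \<le> \<gamma> (q h))" if "h \<le> Suc r" for h
    using that
  proof (induction h)
    case (Suc h)
    then have h: "h \<le> r" and IH: "finite (?C h)" "card (?C h) = q h" "?C h \<subseteq> {1..n}" by auto
    have finL: "finite (L h)" using IH by (simp add: L_def)
    have disj: "L h \<inter> \<gamma> ` {q h<..q (Suc h)} = {}" using L_less[OF IH(1,2) h] ge_g[OF h] by fastforce
    have "card (?C (Suc h)) = q h + (q (Suc h) - q h)"
      using card_Un_disjoint[OF finL _ disj] bnd(3)[OF IH(1,2) h]
        card_image[OF strict_mono_on_imp_inj_on[OF inc[OF h]]] by (simp add: C_Suc)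
    moreover have "x \<in> {1..n}" if "x \<in> L h" for x
      using that IH(3) bnd(1)[OF IH(1,2) h] gn[OF h] L_less[OF IH(1,2) h that] by (auto simp: L_def)
    moreover have "\<gamma> i \<in> {1..n}" if "i \<in> {q h<..q (Suc h)}" for i using tup(1) carrel_in_range[OF h that] by blast
    moreover have last: "\<gamma> i \<le> \<gamma> (q (Suc h))" if "i \<in> {q h<..q (Suc h)}" for i
      using strict_mono_onD[OF inc[OF h] that, of "q (Suc h)"] that qlt[OF h] by (cases "i = q (Suc h)") auto
    moreover have "x \<le> \<gamma> (q (Suc h))" if "x \<in> L h" for x
      using L_less[OF IH(1,2) h that] last[of "Suc (q h)"] qlt[OF h] by (simp add: g_def)
    ultimately show ?case using qlt[OF h] finL unfolding C_Suc by auto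
  qed simp
  have inv': "finite (?C h)" "card (?C h) = q h" if "h \<le> r" for h using inv[of h] that by auto
  have above: "{g h..x} \<subseteq> \<gamma> ` {q h<..q (Suc h)}" if h: "h \<le> r" and x: "x \<in> ?C h" for h x
  proof
    fix z assume z: "z \<in> {g h..x}"
    have h1: "h \<in> {1..r}" using x h by (cases "h = 0") auto
    have m: "x \<le> \<gamma> (q h)" using inv[of h] h x by auto
    show "z \<in> \<gamma> ` {q h<..q (Suc h)}"
    proof (cases "g h < \<gamma> (q h)")
      case True
      let ?s = "\<gamma> (q h) - g h + 1"
      have s: "?s \<le> p (h + 1)" "\<And>t. t \<in> {1..?s} \<Longrightarrow> \<gamma> (q h + t) = \<gamma> (q h) - ?s + t"
        using \<gamma> h1 True unfolding gapless_R_tuple_def Let_def g_def by (auto simp del: atLeastAtMost_iff)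
      have t: "z - g h + 1 \<in> {1..?s}" using z m by auto
      have "\<gamma> (q h + (z - g h + 1)) = z" using s(2)[OF t] z m True qg[OF h] by auto
      moreover have "q h + (z - g h + 1) \<in> {q h<..q (Suc h)}" using s(1) t qlt[OF h] by (auto simp: pp_def)
      ultimately show ?thesis by (metis imageI)
    next
      case False
      then have "z = \<gamma> (Suc (q h))" using z m by (simp add: g_def)
      then show ?thesis using qlt[OF h] by auto
    qed
  qed
  have sub: "?C h \<subseteq> ?C (Suc h)" if h: "h \<le> r" for h
  proof
    fix x assume x: "x \<in> ?C h"
    show "x \<in> ?C (Suc h)"
    proof (cases "g h \<le> x")
      case True then show ?thesis using above[OF h x] by (auto simp: C_Suc)
    next
      case False then show ?thesis using x by (auto simp: C_Suc L_def)
    qed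
  qed
  define B where "B h = (if h \<le> Suc r then ?C h else {})" for h
  have RB: "R_chain n R B" by (rule R_chainI) (use inv sub in \<open>auto simp: B_def\<close>)
  have "gapless_chain n R B"
    unfolding gapless_chain_def
  proof (intro conjI RB ballI allI impI, rule ccontr)
    fix h y x z assume h: "h \<in> {1..r}" and y: "y \<in> B (h + 1) - B h" and x: "x \<in> B h"
      and z: "y < z \<and> z < x" and nz: "z \<notin> B (h + 1)"
    have h': "h \<le> r" using h by simp
    have xC: "x \<in> ?C h" and yC: "y \<in> ?C (Suc h)" "y \<notin> ?C h" and zC: "z \<notin> ?C (Suc h)"
      using x y nz h by (auto simp: B_def)
    \<comment> \<open>A missing \<open>z\<close> lies below \<open>g h\<close>, hence below the
      filled interval, that is, below \<open>b h\<close>. Then \<open>y < z\<close> lies there too,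
      where \<open>L h\<close> keeps only old elements.\<close>
    have zg: "z < g h"
    proof (rule ccontr)
      assume "\<not> z < g h"
      then have "z \<in> {g h..x}" using z by simp
      then show False using above[OF h' xC] zC by (auto simp: C_Suc)
    qed
    then have "z < b h" using zC by (auto simp: C_Suc L_def)
    moreover have "y \<in> L h" using yC zg z ge_g[OF h'] by (fastforce simp: C_Suc)
    ultimately show False using yC(2) z by (auto simp: L_def)
  qed
  moreover have "tuple_of_chain B = \<gamma>"
  proof
    fix i
    show "tuple_of_chain B i = \<gamma> i"
    proof (cases "i \<in> {1..n}")
      case True
      then obtain h where h: "h \<le> r" "i \<in> {q h<..q (Suc h)}" using carrel_cases by metis
      \<comment> \<open>The rank of \<open>\<gamma> i\<close> is counted: \<open>q h\<close>
        elements from \<open>L h\<close> and \<open>i - q h\<close> from the carrel give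
        \<open>i\<close>.\<close>
      have "{y \<in> ?C (Suc h). y \<le> \<gamma> i} = L h \<union> \<gamma> ` {q h<..i}"
      proof (intro set_eqI iffI)
        fix y assume y: "y \<in> {y \<in> ?C (Suc h). y \<le> \<gamma> i}"
        show "y \<in> L h \<union> \<gamma> ` {q h<..i}"
        proof (cases "y \<in> L h")
          case False
          then obtain j where j: "j \<in> {q h<..q (Suc h)}" "y = \<gamma> j" using y by (auto simp: C_Suc)
          then have "\<not> i < j" using strict_mono_onD[OF inc[OF h(1)] h(2) j(1)] y by auto
          then show ?thesis using j by auto
        qed simp
      next
        fix y assume y: "y \<in> L h \<union> \<gamma> ` {q h<..i}"
        then show "y \<in> {y \<in> ?C (Suc h). y \<le> \<gamma> i}"
        proof
          assume "y \<in> L h"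
          then show ?thesis using L_less[OF inv'[OF h(1)] h(1)] ge_g[OF h] by (fastforce simp: C_Suc)
        next
          assume "y \<in> \<gamma> ` {q h<..i}"
          then obtain j where j: "j \<in> {q h<..i}" "y = \<gamma> j" by auto
          then have j': "j \<in> {q h<..q (Suc h)}" using h(2) by auto
          then have "\<gamma> j \<le> \<gamma> i" using strict_mono_onD[OF inc[OF h(1)] j' h(2)] j(1) by (cases "j = i") auto
          then show ?thesis using j j' by (auto simp: C_Suc)
        qed
      qed
      moreover have "card (L h \<union> \<gamma> ` {q h<..i}) = q h + (i - q h)"
      proof -
        have "L h \<subseteq> {..<g h}" using L_less[OF inv'[OF h(1)] h(1)] by blast
        moreover have "\<gamma> ` {q h<..i} \<subseteq> {g h..}" using ge_g[OF h(1)] h(2) by auto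
        moreover have "{..<g h} \<inter> {g h..} = {}" by auto
        ultimately have "L h \<inter> \<gamma> ` {q h<..i} = {}" by blast
        moreover have "inj_on \<gamma> {q h<..i}"
          by (rule inj_on_subset[OF strict_mono_on_imp_inj_on[OF inc[OF h(1)]]]) (use h(2) in auto)
        moreover have "finite (L h)" using inv'[OF h(1)] by (simp add: L_def)
        ultimately show ?thesis using bnd(3)[OF inv'[OF h(1)] h(1)] by (simp add: card_Un_disjoint card_image)
      qed
      ultimately have "card {y \<in> ?C (Suc h). y \<le> \<gamma> i} = i" using h(2) by simp
      moreover have "finite (?C (Suc h))" "\<gamma> i \<in> ?C (Suc h)" using inv[of "Suc h"] h by (auto simp: C_Suc)
      ultimately have "nth_smallest (?C (Suc h)) i = \<gamma> i" by (intro nth_smallest_eqI)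
      then show ?thesis using tuple_of_chain_eq[OF h] h(1) by (simp add: B_def)
    next
      case False then show ?thesis using tup(2)[OF False] unfolding tuple_of_chain_def by (simp only: if_False)
    qed
  qed
  ultimately show ?thesis by blast
qed

lemma card_gapless_tuples: "card {\<gamma>. gapless_R_tuple n R \<gamma>} = card {B. gapless_chain n R B}"
proof -
  have "bij_betw tuple_of_chain {B. gapless_chain n R B} {\<gamma>. gapless_R_tuple n R \<gamma>}"
    unfolding bij_betw_def
  proof
    show "inj_on tuple_of_chain {B. gapless_chain n R B}"
      by (rule inj_onI) (use tuple_of_chain_inj in blast)
    show "tuple_of_chain ` {B. gapless_chain n R B} = {\<gamma>. gapless_R_tuple n R \<gamma>}"
      using tuple_of_chain_gapless tuple_of_chain_surj by blast
  qed
  then show ?thesis by (metis bij_betw_same_card)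
qed

end

section \<open>Partition tuples\<close>

text \<open>The gap condition of a tuple read off from \<open>e i = \<gamma> (q (h + 1) + 1 - i) - (q (h + 1) + 1 - i)\<close>.\<close>

lemma constant_tail_iff:
  fixes e :: "nat \<Rightarrow> nat"
  assumes anti: "\<And>i j. 1 \<le> i \<Longrightarrow> i \<le> j \<Longrightarrow> j \<le> P \<Longrightarrow> e j \<le> e i" and s: "1 \<le> s"
  shows "s \<le> card {i \<in> {1..P}. e i = e P} \<longleftrightarrow> s \<le> P \<and> (\<forall>t\<in>{1..s}. e (P + 1 - t) = e P)"
proof
  assume *: "s \<le> P \<and> (\<forall>t\<in>{1..s}. e (P + 1 - t) = e P)"
  have "{P + 1 - s..P} \<subseteq> {i \<in> {1..P}. e i = e P}"
  proof
    fix i assume i: "i \<in> {P + 1 - s..P}"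
    then have "P + 1 - i \<in> {1..s}" "P + 1 - (P + 1 - i) = i" using * s by auto
    then have "e i = e P" using * by metis
    then show "i \<in> {i \<in> {1..P}. e i = e P}" using i * by auto
  qed
  then have "card {P + 1 - s..P} \<le> card {i \<in> {1..P}. e i = e P}" by (intro card_mono) auto
  then show "s \<le> card {i \<in> {1..P}. e i = e P}" using * by simp
next
  assume *: "s \<le> card {i \<in> {1..P}. e i = e P}"
  have "card {i \<in> {1..P}. e i = e P} \<le> card {1..P}" by (intro card_mono) auto
  then have sP: "s \<le> P" using * by simp
  moreover have "e (P + 1 - t) = e P" if t: "t \<in> {1..s}" for t
  proof (rule ccontr)
    assume ne: "e (P + 1 - t) \<noteq> e P"
    have "1 \<le> P + 1 - t" "P + 1 - t \<le> P" using t sP by auto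
    then have gt: "e P < e (P + 1 - t)" using anti[of "P + 1 - t" P] ne by simp
    \<comment> \<open>Every row equal to the last one comes after row \<open>P + 1 - t\<close>,
      which leaves at most \<open>t - 1 < s\<close> of them.\<close>
    have "{i \<in> {1..P}. e i = e P} \<subseteq> {P + 2 - t..P}"
    proof
      fix i assume i: "i \<in> {i \<in> {1..P}. e i = e P}"
      have "\<not> i \<le> P + 1 - t"
      proof
        assume "i \<le> P + 1 - t"
        then have "e (P + 1 - t) \<le> e i" using anti[of i "P + 1 - t"] i t by auto
        then show False using gt i by simp
      qed
      then show "i \<in> {P + 2 - t..P}" using i by auto
    qed
    then have "card {i \<in> {1..P}. e i = e P} \<le> card {P + 2 - t..P}" by (intro card_mono) auto
    then show False using * t by auto
  qed
  ultimately show "s \<le> P \<and> (\<forall>t\<in>{1..s}. e (P + 1 - t) = e P)" by blast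
qed

context carrels
begin

definition gap_condition :: "(nat \<Rightarrow> nat) \<Rightarrow> nat \<Rightarrow> bool" where
  "gap_condition \<gamma> h \<longleftrightarrow> (\<gamma> (q h) > \<gamma> (q h + 1) \<longrightarrow>
     (let s = \<gamma> (q h) - \<gamma> (q h + 1) + 1 in
       s \<le> p (h + 1) \<and> (\<forall>t\<in>{1..s}. \<gamma> (q h + t) = \<gamma> (q h) - s + t)))"

definition mu_condition :: "(nat \<Rightarrow> nat \<Rightarrow> nat) \<Rightarrow> nat \<Rightarrow> bool" where
  "mu_condition mu h \<longleftrightarrow> (let l = mu (h + 1) (p (h + 1));
     c = card {i \<in> {1..p (h + 1)}. mu (h + 1) i = l} in mu h 1 \<le> l + c)"

text \<open>Rows are the excesses \<open>\<gamma> k - k\<close>. Strict increase of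
  \<open>\<gamma>\<close> makes them weakly increasing along a carrel, so the carrel is read
  backwards to obtain a partition.\<close>

definition mu_of_tuple :: "(nat \<Rightarrow> nat) \<Rightarrow> nat \<Rightarrow> nat \<Rightarrow> nat" where
  "mu_of_tuple \<gamma> h i = (if h \<in> {1..r} \<and> i \<in> {1..p h} then \<gamma> (q h + 1 - i) - (q h + 1 - i) else 0)"

definition tuple_of_mu :: "(nat \<Rightarrow> nat \<Rightarrow> nat) \<Rightarrow> nat \<Rightarrow> nat" where
  "tuple_of_mu mu k = (if k \<in> {1..n} then k + mu (carrel k) (q (carrel k) + 1 - k) else 0)"

text \<open>At a descent, \<open>s\<close> is the first row of \<open>mu h\<close> minus the last
  row \<open>l\<close> of \<open>mu (h + 1)\<close>, and the run says that the last \<open>s\<close>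
  rows of \<open>mu (h + 1)\<close> equal \<open>l\<close>, that is, \<open>s \<le> c\<close>.
  Without a descent the first row is at most \<open>l + 1\<close>, and \<open>c \<ge> 1\<close>
  always.\<close>

lemma gap_condition_iff_mu_condition:
  assumes h: "1 \<le> h" "h < r"
    and anti: "\<And>i j. 1 \<le> i \<Longrightarrow> i \<le> j \<Longrightarrow> j \<le> p (h + 1) \<Longrightarrow> mu (h + 1) j \<le> mu (h + 1) i"
    and rel: "\<And>g i. g \<in> {1..r} \<Longrightarrow> i \<in> {1..p g} \<Longrightarrow> \<gamma> (q g + 1 - i) = (q g + 1 - i) + mu g i"
  shows "gap_condition \<gamma> h \<longleftrightarrow> mu_condition mu h"
proof -
  let ?P = "p (h + 1)"
  let ?e = "mu (h + 1)"
  let ?c = "card {i \<in> {1..?P}. ?e i = ?e ?P}"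
  have q1: "q (h + 1) = q h + ?P" "1 \<le> ?P" "1 \<le> p h" "1 \<le> q h"
    using q_less[of h "h + 1"] q_less[of "h - 1" h] h by (auto simp: pp_def)
  have e: "\<gamma> (q h + t) = q h + t + ?e (?P + 1 - t)" if t: "t \<in> {1..?P}" for t
  proof -
    have "h + 1 \<in> {1..r}" "?P + 1 - t \<in> {1..?P}" using h t by auto
    from rel[OF this] show ?thesis using q1(1) t by auto
  qed
  have g1: "\<gamma> (q h + 1) = q h + 1 + ?e ?P" using e[of 1] q1 by simp
  have g0: "\<gamma> (q h) = q h + mu h 1" using rel[of h 1] h q1 by simp
  have c1: "1 \<le> ?c" using constant_tail_iff[of ?P ?e 1] anti q1 by auto
  have *: "(\<gamma> (q h + t) = \<gamma> (q h) - (mu h 1 - ?e ?P) + t) = (?e (?P + 1 - t) = ?e ?P)"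
    if "t \<in> {1..?P}" "?e ?P \<le> mu h 1" for t using e[OF that(1)] g0 that by auto
  have s: "\<gamma> (q h) - \<gamma> (q h + 1) + 1 = mu h 1 - ?e ?P" if "mu h 1 > ?e ?P + 1" using g0 g1 that by simp
  have "gap_condition \<gamma> h \<longleftrightarrow> (mu h 1 > ?e ?P + 1 \<longrightarrow> mu h 1 - ?e ?P \<le> ?P \<and>
      (\<forall>t\<in>{1..mu h 1 - ?e ?P}. ?e (?P + 1 - t) = ?e ?P))"
  proof (cases "mu h 1 > ?e ?P + 1")
    case True
    then have "\<gamma> (q h) > \<gamma> (q h + 1)" using g0 g1 by simp
    then show ?thesis unfolding gap_condition_def Let_def s[OF True] using True * by auto
  next
    case False
    then have "\<not> \<gamma> (q h) > \<gamma> (q h + 1)" using g0 g1 by simp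
    then show ?thesis using False by (simp add: gap_condition_def)
  qed
  also have "\<dots> \<longleftrightarrow> (mu h 1 > ?e ?P + 1 \<longrightarrow> mu h 1 - ?e ?P \<le> ?c)"
    using constant_tail_iff[of ?P ?e "mu h 1 - ?e ?P"] anti by auto
  also have "\<dots> \<longleftrightarrow> mu h 1 \<le> ?e ?P + ?c" using c1 by auto
  finally show ?thesis by (simp add: mu_condition_def Let_def)
qed

text \<open>Strict increase up to the last index gives \<open>\<gamma> k + (n - k) \<le> n\<close>,
  while upperness gives \<open>k \<le> \<gamma> k\<close>. Hence the last carrel carries no
  partition.\<close>

lemma upper_last_carrel:
  assumes \<gamma>: "R_tuple n \<gamma>" "upper n \<gamma>" "R_increasing n R \<gamma>" and k: "k \<in> {q r<..n}"
  shows "\<gamma> k = k"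
proof -
  have inc: "strict_mono_on {q r<..n} \<gamma>" using \<gamma>(3) by (auto simp: R_increasing_iff)
  have "\<gamma> k + t \<le> \<gamma> (k + t)" if "k + t \<le> n" for t
    using that
  proof (induction t)
    case (Suc t)
    have "\<gamma> (k + t) < \<gamma> (k + Suc t)" by (rule strict_mono_onD[OF inc]) (use k Suc.prems in auto)
    then show ?case using Suc by simp
  qed simp
  from this[of "n - k"] have "\<gamma> k + (n - k) \<le> \<gamma> n" using k by simp
  moreover have "\<gamma> n \<le> n" using \<gamma>(1) n_pos by (auto simp: R_tuple_def)
  moreover have "k \<le> \<gamma> k" using \<gamma>(2) k by (auto simp: upper_def)
  ultimately show ?thesis using k by auto
qed

lemma row_index:
  assumes "h \<in> {1..r}" "i \<in> {1..p h}"
  shows "carrel (q h + 1 - i) = h" "q h + 1 - i \<in> {1..n}" "q h + 1 - (q h + 1 - i) = i"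
    "q (h - 1) < q h + 1 - i" "q h + 1 - i \<le> q h"
proof -
  have *: "q (h - 1) < q h" "q h \<le> n" "p h = q h - q (h - 1)"
    using assms q_less[of "h - 1" h] q_le_n[of h] by (auto simp: pp_def)
  then show b: "q (h - 1) < q h + 1 - i" "q h + 1 - i \<le> q h" using assms by auto
  then show "carrel (q h + 1 - i) = h" using carrel_eq[of "h - 1" "q h + 1 - i"] assms by auto
  show "q h + 1 - i \<in> {1..n}" "q h + 1 - (q h + 1 - i) = i" using b * assms by auto
qed

lemma gapless_R_tuple_iff:
  "gapless_R_tuple n R \<gamma> \<longleftrightarrow> R_tuple n \<gamma> \<and> upper n \<gamma> \<and> R_increasing n R \<gamma> \<and> (\<forall>h\<in>{1..r}. gap_condition \<gamma> h)"
  unfolding gapless_R_tuple_def gap_condition_def ..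

lemma mu_tuple_iff:
  "mu_tuple n R mu \<longleftrightarrow> (\<forall>h i. \<not> (h \<in> {1..r} \<and> i \<in> {1..p h}) \<longrightarrow> mu h i = 0) \<and>
     (\<forall>h\<in>{1..r}. \<forall>i j. 1 \<le> i \<and> i \<le> j \<and> j \<le> p h \<longrightarrow> mu h j \<le> mu h i) \<and>
     (\<forall>h\<in>{1..r}. \<forall>i\<in>{1..p h}. mu h i \<le> n - q h) \<and> (\<forall>h\<in>{1..r - 1}. mu_condition mu h)"
  unfolding mu_tuple_def mu_condition_def ..

lemma strict_mono_on_diff_le:
  fixes \<gamma> :: "nat \<Rightarrow> nat"
  assumes inc: "strict_mono_on {a<..b} \<gamma>" and "a < i" "i \<le> j" "j \<le> b"
  shows "\<gamma> i + (j - i) \<le> \<gamma> j"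
  using assms(3,4)
proof (induction rule: dec_induct)
  case (step j)
  have "\<gamma> j < \<gamma> (Suc j)" by (rule strict_mono_onD[OF inc]) (use assms step in auto)
  then show ?case using step by auto
qed simp

lemma mu_of_tuple:
  assumes \<gamma>: "gapless_R_tuple n R \<gamma>"
  shows "mu_tuple n R (mu_of_tuple \<gamma>)" "tuple_of_mu (mu_of_tuple \<gamma>) = \<gamma>"
proof -
  let ?mu = "mu_of_tuple \<gamma>"
  have tup: "R_tuple n \<gamma>" "upper n \<gamma>" "R_increasing n R \<gamma>" "\<And>h. h \<in> {1..r} \<Longrightarrow> gap_condition \<gamma> h"
    using \<gamma> by (simp_all add: gapless_R_tuple_iff)
  have rel: "\<gamma> (q g + 1 - i) = (q g + 1 - i) + ?mu g i" if "g \<in> {1..r}" "i \<in> {1..p g}" for g i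
  proof -
    have "q g + 1 - i \<le> \<gamma> (q g + 1 - i)" using tup(2) row_index(2)[OF that] by (simp only: upper_def)
    then show ?thesis using that by (simp add: mu_of_tuple_def)
  qed
  have inc: "strict_mono_on {q (h - 1)<..q h} \<gamma>" if "h \<in> {1..r}" for h
  proof -
    have "h - 1 \<le> r" "Suc (h - 1) = h" using that by auto
    then show ?thesis using tup(3) by (metis R_increasing_iff)
  qed
  have anti: "?mu h j \<le> ?mu h i" if h: "h \<in> {1..r}" and ij: "1 \<le> i" "i \<le> j" "j \<le> p h" for h i j
  proof -
    have i: "i \<in> {1..p h}" and j: "j \<in> {1..p h}" using ij by auto
    have le: "q h + 1 - j \<le> q h + 1 - i" using ij by linarith
    have "\<gamma> (q h + 1 - j) + ((q h + 1 - i) - (q h + 1 - j)) \<le> \<gamma> (q h + 1 - i)"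
      by (rule strict_mono_on_diff_le[OF inc[OF h] row_index(4)[OF h j] le row_index(5)[OF h i]])
    then show ?thesis using le unfolding rel[OF h i] rel[OF h j] by simp
  qed
  \<comment> \<open>The first row is the longest; it equals \<open>\<gamma> (q h) - q h\<close>, and
    \<open>\<gamma> (q h) \<le> n\<close>.\<close>
  have bound: "?mu h i \<le> n - q h" if h: "h \<in> {1..r}" and i: "i \<in> {1..p h}" for h i
  proof -
    have 1: "1 \<in> {1..p h}" using i by auto
    have "q h \<in> {1..n}" using row_index(2)[OF h 1] by simp
    then have "\<gamma> (q h) \<le> n" using tup(1) by (auto simp: R_tuple_def)
    then show ?thesis using rel[OF h 1] anti[OF h, of 1 i] i by auto
  qed
  have "mu_condition ?mu h" if "h \<in> {1..r - 1}" for h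
    using gap_condition_iff_mu_condition[of h ?mu \<gamma>] that anti[of "h + 1"] rel tup(4)[of h] by auto
  then show "mu_tuple n R ?mu" unfolding mu_tuple_iff using anti bound by (auto simp: mu_of_tuple_def)
  show "tuple_of_mu ?mu = \<gamma>"
  proof
    fix k
    show "tuple_of_mu ?mu k = \<gamma> k"
    proof (cases "k \<in> {1..n}")
      case True
      then obtain h where h: "h \<le> r" "carrel k = Suc h" "k \<in> {q h<..q (Suc h)}" using carrel_cases by metis
      have t: "tuple_of_mu ?mu k = k + ?mu (Suc h) (q (Suc h) + 1 - k)"
        unfolding tuple_of_mu_def h(2) using True by (rule if_P)
      show ?thesis
      proof (cases "h = r")
        case True
        then show ?thesis using t upper_last_carrel[OF tup(1-3), of k] h(3) by (simp add: mu_of_tuple_def)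
      next
        case False
        then have "Suc h \<in> {1..r}" "q (Suc h) + 1 - k \<in> {1..p (Suc h)}" using h by (auto simp: pp_def)
        from rel[OF this] show ?thesis using t h(3) by simp
      qed
    next
      case False
      then show ?thesis using tup(1) by (metis tuple_of_mu_def R_tuple_def)
    qed
  qed
qed

lemma tuple_of_mu:
  assumes mu: "mu_tuple n R mu"
  shows "gapless_R_tuple n R (tuple_of_mu mu)" "mu_of_tuple (tuple_of_mu mu) = mu"
proof -
  let ?\<gamma> = "tuple_of_mu mu"
  have zero: "\<And>h i. \<not> (h \<in> {1..r} \<and> i \<in> {1..p h}) \<Longrightarrow> mu h i = 0"
    and anti: "\<And>h i j. h \<in> {1..r} \<Longrightarrow> 1 \<le> i \<Longrightarrow> i \<le> j \<Longrightarrow> j \<le> p h \<Longrightarrow> mu h j \<le> mu h i"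
    and bound: "\<And>h i. h \<in> {1..r} \<Longrightarrow> i \<in> {1..p h} \<Longrightarrow> mu h i \<le> n - q h"
    and cond: "\<And>h. h \<in> {1..r - 1} \<Longrightarrow> mu_condition mu h"
    using mu unfolding mu_tuple_iff by blast+
  have val: "?\<gamma> k = k + mu (Suc h) (q (Suc h) + 1 - k)" if "h \<le> r" "k \<in> {q h<..q (Suc h)}" for h k
  proof -
    have c: "carrel k = Suc h" using carrel_eq[of h k] that by simp
    show ?thesis unfolding tuple_of_mu_def c using carrel_in_range[OF that] by (rule if_P)
  qed
  have rel: "?\<gamma> (q g + 1 - i) = (q g + 1 - i) + mu g i" if "g \<in> {1..r}" "i \<in> {1..p g}" for g i
    unfolding tuple_of_mu_def row_index(1,3)[OF that] using row_index(2)[OF that] by (rule if_P)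
  have last: "?\<gamma> k = k" if "k \<in> {q r<..n}" for k using val[of r k] that zero[of "Suc r"] by simp
  have row: "Suc h \<in> {1..r} \<and> q (Suc h) + 1 - k \<in> {1..p (Suc h)}" if "h < r" "k \<in> {q h<..q (Suc h)}" for h k
    using that by (auto simp: pp_def)
  have tup: "R_tuple n ?\<gamma>"
    unfolding R_tuple_def
  proof (intro conjI ballI allI impI)
    fix k assume k: "k \<in> {1..n}"
    then obtain h where h: "h \<le> r" "k \<in> {q h<..q (Suc h)}" using carrel_cases by metis
    show "?\<gamma> k \<in> {1..n}"
    proof (cases "h = r")
      case True then show ?thesis using last[of k] h k by simp
    next
      case False
      then have "mu (Suc h) (q (Suc h) + 1 - k) \<le> n - q (Suc h)" using bound row[of h k] h by auto
      then show ?thesis using val[OF h] h k q_le_n[of "Suc h"] by auto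
    qed
  next
    fix k assume "k \<notin> {1..n}"
    then show "?\<gamma> k = 0" unfolding tuple_of_mu_def by (rule if_not_P)
  qed
  have up: "upper n ?\<gamma>" by (auto simp: upper_def tuple_of_mu_def)
  have inc: "R_increasing n R ?\<gamma>"
    unfolding R_increasing_iff strict_mono_on_def
  proof (intro allI impI)
    fix h i j assume h: "h \<le> r" and ij: "i \<in> {q h<..q (Suc h)} \<and> j \<in> {q h<..q (Suc h)} \<and> i < j"
    show "?\<gamma> i < ?\<gamma> j"
    proof (cases "h = r")
      case True then show ?thesis using last[of i] last[of j] ij by simp
    next
      case False
      then have "mu (Suc h) (q (Suc h) + 1 - i) \<le> mu (Suc h) (q (Suc h) + 1 - j)"
        using row[of h i] row[of h j] h ij by (intro anti) auto
      then show ?thesis using val[OF h, of i] val[OF h, of j] ij by simp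
    qed
  qed
  have gap: "gap_condition ?\<gamma> h" if h: "h \<in> {1..r}" for h
  proof (cases "h = r")
    case True
    \<comment> \<open>On the last carrel \<open>?\<gamma>\<close> is the identity, so the run
      demanded at \<open>h = r\<close> is present; its length \<open>?\<gamma> (q r) - q r\<close>
      fits because \<open>?\<gamma> (q r) \<le> n\<close>.\<close>
    have "q r < n" using q_less_n[of r] by simp
    then have q1: "?\<gamma> (q r + 1) = q r + 1" "p (r + 1) = n - q r" using last by (auto simp: pp_def)
    have "q r \<in> {1..n}" using h True q_pos[of r] q_less_n[of r] by auto
    then have gn: "?\<gamma> (q r) \<le> n" using tup by (auto simp: R_tuple_def)
    have "?\<gamma> (q r + t) = q r + t" if "t \<in> {1..?\<gamma> (q r) - q r}" for t
      using that gn by (intro last) auto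
    then show ?thesis unfolding gap_condition_def Let_def True using q1 gn by auto
  next
    case False
    then show ?thesis
      using gap_condition_iff_mu_condition[of h mu ?\<gamma>] h rel anti[of "h + 1"] cond[of h] by auto
  qed
  show "gapless_R_tuple n R ?\<gamma>" using tup up inc gap by (simp add: gapless_R_tuple_iff)
  show "mu_of_tuple ?\<gamma> = mu"
  proof (intro ext)
    fix h i
    show "mu_of_tuple ?\<gamma> h i = mu h i"
    proof (cases "h \<in> {1..r} \<and> i \<in> {1..p h}")
      case True
      have "mu_of_tuple ?\<gamma> h i = ?\<gamma> (q h + 1 - i) - (q h + 1 - i)"
        unfolding mu_of_tuple_def using True by (rule if_P)
      then show ?thesis using rel True by simp
    next
      case False
      have "mu_of_tuple ?\<gamma> h i = 0" unfolding mu_of_tuple_def using False by (rule if_not_P)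
      then show ?thesis using zero[OF False] by simp
    qed
  qed
qed

lemma card_mu_tuples: "card {mu. mu_tuple n R mu} = card {\<gamma>. gapless_R_tuple n R \<gamma>}"
  by (rule bij_betw_same_card[of tuple_of_mu], rule bij_betw_byWitness[of _ mu_of_tuple])
    (use mu_of_tuple tuple_of_mu in auto)

end

section \<open>Keys\<close>

locale shape = carrels +
  fixes lam :: "nat \<Rightarrow> nat"
  assumes partition: "is_partition n lam" and R_lam: "R_lam n lam = R"
begin

abbreviation \<zeta> where "\<zeta> \<equiv> zeta n lam"
abbreviation bxs where "bxs \<equiv> boxes n lam"
abbreviation col where "col \<equiv> col_set n lam"

lemma zeta_antimono: "l \<le> j \<Longrightarrow> \<zeta> j \<le> \<zeta> l"
  unfolding zeta_def by (intro card_mono) auto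

lemma zeta_le_n: "\<zeta> j \<le> n"
proof -
  have "\<zeta> j \<le> card {1..n}" unfolding zeta_def by (intro card_mono) auto
  then show ?thesis by simp
qed

lemma zeta_eq_0: "lam 1 < j \<Longrightarrow> \<zeta> j = 0"
proof -
  assume j: "lam 1 < j"
  have "lam i < j" if "i \<in> {1..n}" for i using partition that j unfolding is_partition_def by fastforce
  then have "{i \<in> {1..n}. j \<le> lam i} = {}" by fastforce
  then show ?thesis unfolding zeta_def by simp
qed

lemma boxes_iff: "(j, i) \<in> bxs \<longleftrightarrow> 1 \<le> j \<and> j \<le> lam 1 \<and> 1 \<le> i \<and> i \<le> \<zeta> j"
  using zeta_eq_0[of j] by (cases "j \<le> lam 1") (auto simp: boxes_def)

lemma finite_boxes: "finite bxs"
proof (rule finite_subset)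
  show "bxs \<subseteq> {1..lam 1} \<times> {1..n}" using le_trans[OF _ zeta_le_n] by (auto simp: boxes_iff)
qed simp

lemma zeta_cases:
  assumes "1 \<le> j" "j \<le> lam 1"
  obtains h where "h \<le> r" "\<zeta> j = q (Suc h)"
proof (cases "\<zeta> j < n")
  case True
  then have "\<zeta> j \<in> R" using R_lam assms by (auto simp: R_lam_def)
  then obtain h where h: "h \<in> {1..r}" "q h = \<zeta> j" using q_surj by blast
  then show ?thesis using that[of "h - 1"] by auto
next
  case False
  then show ?thesis using that[of r] zeta_le_n[of j] by simp
qed

lemma ex_column:
  assumes "h \<in> {1..r}" shows "\<exists>j. 1 \<le> j \<and> j \<le> lam 1 \<and> \<zeta> j = q h"
  using q_in_R[of h] assms R_lam by (auto simp: R_lam_def)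

lemma tableau_column_mono:
  assumes T: "tableau n lam T" and j: "1 \<le> j"
  shows "strict_mono_on {1..\<zeta> j} (\<lambda>i. T (j, i))"
proof (rule strict_mono_onI)
  fix i k assume i: "i \<in> {1..\<zeta> j}" and k: "k \<in> {1..\<zeta> j}" and lt: "i < k"
  have step: "T (j, m) < T (j, m + 1)" if "1 \<le> m" "m + 1 \<le> \<zeta> j" for m
  proof -
    have "(j, m + 1) \<in> bxs" using that j by (simp add: boxes_def)
    then show ?thesis using T that unfolding tableau_def by blast
  qed
  have "i + 1 + d \<le> \<zeta> j \<longrightarrow> T (j, i) < T (j, i + 1 + d)" for d
    using i step[of i] step[of "i + 1 + d" for d] by (induction d) (fastforce+)
  from this[of "k - i - 1"] show "T (j, i) < T (j, k)" using lt k by simp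
qed

lemma tableau_row_mono:
  assumes T: "tableau n lam T" and "1 \<le> l" "l \<le> j" "1 \<le> i" "i \<le> \<zeta> j"
  shows "T (l, i) \<le> T (j, i)"
  using assms(3,5)
proof (induction rule: dec_induct)
  case (step j)
  have "(j + 1, i) \<in> bxs" using step assms by (simp add: boxes_def)
  then have "T (j, i) \<le> T (j + 1, i)" using T step assms unfolding tableau_def by (meson le_trans)
  then show ?case using step zeta_antimono[of j "Suc j"] by simp
qed simp

lemma tableau_range: "tableau n lam T \<Longrightarrow> x \<in> bxs \<Longrightarrow> T x \<in> {1..n}"
  by (simp only: tableau_def)

lemma col_eq: "col T j = (\<lambda>i. T (j, i)) ` {1..\<zeta> j}"
  by (auto simp: col_set_def)

lemma col_finite: "finite (col T j)" by (simp add: col_eq)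

lemma col_card: "tableau n lam T \<Longrightarrow> 1 \<le> j \<Longrightarrow> card (col T j) = \<zeta> j"
  using strict_mono_on_imp_inj_on[OF tableau_column_mono] by (simp add: col_eq card_image)

lemma col_subset: "tableau n lam T \<Longrightarrow> 1 \<le> j \<Longrightarrow> col T j \<subseteq> {1..n}"
  using tableau_range[of T] by (auto simp: col_eq boxes_def)

lemma tableau_eq_nth_smallest:
  assumes "tableau n lam T" "(j, i) \<in> bxs"
  shows "T (j, i) = nth_smallest (col T j) i"
  using nth_smallest_unique[OF tableau_column_mono[OF assms(1)] col_eq[symmetric]] assms(2)
  by (simp add: boxes_iff)

text \<open>Entries are ranks in their columns, so nested columns already force weakly increasing
  rows by \<open>nth_smallest_antimono\<close>.\<close>

lemma is_keyI:
  assumes zero: "\<And>x. x \<notin> bxs \<Longrightarrow> T x = 0" and range: "\<And>x. x \<in> bxs \<Longrightarrow> T x \<in> {1..n}"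
    and inc: "\<And>j. 1 \<le> j \<Longrightarrow> j \<le> lam 1 \<Longrightarrow> strict_mono_on {1..\<zeta> j} (\<lambda>i. T (j, i))"
    and nested: "\<And>l j. 1 \<le> l \<Longrightarrow> l \<le> j \<Longrightarrow> j \<le> lam 1 \<Longrightarrow> col T j \<subseteq> col T l"
  shows "is_key n lam T"
proof -
  have nth: "T (j, i) = nth_smallest (col T j) i" if "(j, i) \<in> bxs" for j i
    using nth_smallest_unique[OF inc col_eq[symmetric]] that by (simp add: boxes_iff)
  have crd: "card (col T j) = \<zeta> j" if "1 \<le> j" "j \<le> lam 1" for j
    using strict_mono_on_imp_inj_on[OF inc[OF that]] by (simp add: col_eq card_image)
  have col_inc: "T (j, i) < T (j, i + 1)" if "1 \<le> i" "(j, i + 1) \<in> bxs" for i j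
    using strict_mono_onD[OF inc, of j i "i + 1"] that by (auto simp: boxes_iff)
  have row_inc: "T (j, i) \<le> T (j + 1, i)" if "1 \<le> j" "(j + 1, i) \<in> bxs" for i j
  proof -
    have 1: "j + 1 \<le> lam 1" "1 \<le> i" "i \<le> \<zeta> (j + 1)" using that by (simp_all add: boxes_iff)
    then have "(j, i) \<in> bxs" using that zeta_antimono[of j "j + 1"] by (auto simp: boxes_iff)
    then show ?thesis
      using nth_smallest_antimono[OF col_finite nested[of j "j + 1"], of i] 1 crd[of "j + 1"] that
      by (simp add: nth)
  qed
  have "tableau n lam T" unfolding tableau_def using zero range col_inc row_inc by blast
  then show ?thesis unfolding is_key_def using nested by blast
qed

lemma Ykey_eq:
  assumes "(j, i) \<in> bxs" shows "Ykey n lam \<sigma> (j, i) = nth_smallest (\<sigma> ` {1..\<zeta> j}) i"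
  using assms by (simp add: Ykey_def nth_smallest_def)

lemma Ykey_col:
  assumes s: "\<sigma> permutes {1..n}" and j: "1 \<le> j"
  shows "col (Ykey n lam \<sigma>) j = \<sigma> ` {1..\<zeta> j}"
proof -
  have c: "card (\<sigma> ` {1..\<zeta> j}) = \<zeta> j" using permutes_inj_on[OF s] by (simp add: card_image)
  have "col (Ykey n lam \<sigma>) j = nth_smallest (\<sigma> ` {1..\<zeta> j}) ` {1..\<zeta> j}"
    unfolding col_eq by (intro image_cong refl Ykey_eq) (use j in \<open>auto simp: boxes_def\<close>)
  then show ?thesis using nth_smallest_image[of "\<sigma> ` {1..\<zeta> j}"] c by simp
qed

lemma Ykey_is_key:
  assumes s: "\<sigma> permutes {1..n}"
  shows "is_key n lam (Ykey n lam \<sigma>)"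
proof (rule is_keyI)
  have c: "card (\<sigma> ` {1..\<zeta> j}) = \<zeta> j" for j using permutes_inj_on[OF s] by (simp add: card_image)
  fix x
  show "x \<notin> bxs \<Longrightarrow> Ykey n lam \<sigma> x = 0" by (auto simp: Ykey_def split: prod.splits)
  assume x: "x \<in> bxs"
  obtain j i where ji: "x = (j, i)" by fastforce
  have "Ykey n lam \<sigma> x \<in> \<sigma> ` {1..\<zeta> j}"
    using Ykey_eq[of j i \<sigma>] nth_smallest_mem[of "\<sigma> ` {1..\<zeta> j}" i] c[of j] x ji by (simp add: boxes_iff)
  also have "\<dots> \<subseteq> \<sigma> ` {1..n}" using zeta_le_n by (intro image_mono) auto
  finally show "Ykey n lam \<sigma> x \<in> {1..n}" using permutes_image[OF s] by simp
next
  fix j assume j: "1 \<le> j" "j \<le> lam 1"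
  show "strict_mono_on {1..\<zeta> j} (\<lambda>i. Ykey n lam \<sigma> (j, i))"
  proof (rule strict_mono_onI)
    fix i k assume ik: "i \<in> {1..\<zeta> j}" "k \<in> {1..\<zeta> j}" "i < k"
    have "card (\<sigma> ` {1..\<zeta> j}) = \<zeta> j" using permutes_inj_on[OF s] by (simp add: card_image)
    then show "Ykey n lam \<sigma> (j, i) < Ykey n lam \<sigma> (j, k)"
      using nth_smallest_less[of i k "\<sigma> ` {1..\<zeta> j}"] ik j Ykey_eq[of j i \<sigma>] Ykey_eq[of j k \<sigma>]
      by (simp add: boxes_iff)
  qed
next
  fix l j :: nat assume "1 \<le> l" "l \<le> j" "j \<le> lam 1"
  then show "col (Ykey n lam \<sigma>) j \<subseteq> col (Ykey n lam \<sigma>) l"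
    using Ykey_col[OF s] zeta_antimono[of l j] by (auto intro!: image_mono)
qed

lemma Ykey_col_chain:
  assumes s: "R_permutation n R \<sigma>" and h: "h \<le> Suc r" and j: "1 \<le> j" "\<zeta> j = q h"
  shows "col (Ykey n lam \<sigma>) j = chain_of n R \<sigma> h"
  using Ykey_col[of \<sigma> j] s h j by (simp add: chain_of_def R_permutation_def)

text \<open>For every \<open>h\<close> in \<open>{1..r}\<close> some column has length
  \<open>q h\<close> and displays \<open>B h\<close>; the two ends of the chain are fixed.\<close>

lemma Ykey_inj:
  assumes s: "R_permutation n R \<sigma>" and t: "R_permutation n R \<tau>"
    and eq: "Ykey n lam \<sigma> = Ykey n lam \<tau>"
  shows "\<sigma> = \<tau>"
proof (rule chain_of_inj[OF s t], rule ext)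
  fix h
  have B: "R_chain n R (chain_of n R \<sigma>)" "R_chain n R (chain_of n R \<tau>)"
    using chain_of_R_chain s t by auto
  consider "h = 0" | "h \<in> {1..r}" | "h = Suc r" | "h > Suc r" by fastforce
  then show "chain_of n R \<sigma> h = chain_of n R \<tau> h"
  proof cases
    case 2
    then obtain j where j: "1 \<le> j" "j \<le> lam 1" "\<zeta> j = q h" using ex_column by blast
    then show ?thesis using Ykey_col_chain[OF s, of h j] Ykey_col_chain[OF t, of h j] eq 2 by simp
  qed (use B in \<open>auto simp: R_chain_def\<close>)
qed

lemma key_same_length:
  assumes Y: "is_key n lam Y" and j: "j \<in> {1..lam 1}" "l \<in> {1..lam 1}" "\<zeta> l = \<zeta> j"
  shows "col Y l = col Y j"
proof -
  have T: "tableau n lam Y" using Y by (simp add: is_key_def)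
  have "col Y l \<subseteq> col Y j \<or> col Y j \<subseteq> col Y l"
    using Y j unfolding is_key_def by (meson atLeastAtMost_iff linorder_linear)
  moreover have "card (col Y l) = card (col Y j)" using col_card[OF T] j by simp
  ultimately show ?thesis using col_finite by (metis card_subset_eq)
qed

lemma Ykey_surj:
  assumes Y: "is_key n lam Y"
  shows "\<exists>\<sigma>. R_permutation n R \<sigma> \<and> Ykey n lam \<sigma> = Y"
proof -
  have T: "tableau n lam Y" using Y by (simp add: is_key_def)
  define c where "c h = (SOME j. 1 \<le> j \<and> j \<le> lam 1 \<and> \<zeta> j = q h)" for h
  have c: "1 \<le> c h \<and> c h \<le> lam 1 \<and> \<zeta> (c h) = q h" if "h \<in> {1..r}" for h
    unfolding c_def using someI_ex[OF ex_column[OF that]] .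
  \<comment> \<open>The top set is given directly, since \<open>lam\<close> may have no column of
    length \<open>n\<close>.\<close>
  define B where "B h = (if h \<in> {1..r} then col Y (c h) else if h = Suc r then {1..n} else {})" for h
  have "R_chain n R B"
  proof (rule R_chainI)
    fix h
    show "B h = {}" if "h > Suc r" using that by (simp add: B_def)
    show "finite (B h) \<and> card (B h) = q h" if "h \<le> Suc r"
    proof -
      consider "h = 0" | "h \<in> {1..r}" | "h = Suc r" using \<open>h \<le> Suc r\<close> by fastforce
      then show ?thesis
        by cases (use c[of h] col_card[OF T] col_finite in \<open>auto simp: B_def\<close>)
    qed
    show "B h \<subseteq> B (Suc h)" if h: "h \<le> r"
    proof (cases "h = 0")
      case False
      then have h1: "h \<in> {1..r}" using h by simp
      show ?thesis
      proof (cases "h = r")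
        case True
        then show ?thesis using c[OF h1] col_subset[OF T] h1 by (simp add: B_def)
      next
        case hr: False
        then have h2: "Suc h \<in> {1..r}" using h by simp
        have "q h < q (Suc h)" using q_less[of h "Suc h"] h by simp
        \<comment> \<open>Longer columns stand further left, so nestedness of the key gives the
          inclusion in the right direction.\<close>
        then have "c (Suc h) \<le> c h" using c[OF h1] c[OF h2] zeta_antimono[of "c h" "c (Suc h)"] by (metis leD linorder_linear)
        then have "col Y (c h) \<subseteq> col Y (c (Suc h))" using Y c[OF h1] c[OF h2] by (simp add: is_key_def)
        then show ?thesis using h1 h2 by (simp add: B_def)
      qed
    qed (simp add: B_def)
  qed (simp add: B_def)
  then obtain \<sigma> where s: "R_permutation n R \<sigma>" "chain_of n R \<sigma> = B" using chain_of_surj by blast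
  have "Ykey n lam \<sigma> x = Y x" for x
  proof (cases "x \<in> bxs")
    case True
    obtain j i where ji: "x = (j, i)" by fastforce
    then have j: "1 \<le> j" "j \<le> lam 1" using True by (auto simp: boxes_iff)
    obtain h where h: "h \<le> r" "\<zeta> j = q (Suc h)" using zeta_cases[OF j] .
    have "col Y j = B (Suc h)"
    proof (cases "h = r")
      case True
      then show ?thesis using h col_subset[OF T j(1)] col_card[OF T j(1)] by (simp add: B_def card_subset_eq)
    next
      case False
      then have "Suc h \<in> {1..r}" using h by simp
      then show ?thesis using key_same_length[OF Y, of "c (Suc h)" j] c[of "Suc h"] j h by (simp add: B_def)
    qed
    then have "col Y j = col (Ykey n lam \<sigma>) j" using Ykey_col_chain[OF s(1), of "Suc h" j] h j s(2) by simp
    moreover have "tableau n lam (Ykey n lam \<sigma>)"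
      using Ykey_is_key[of \<sigma>] s by (simp add: R_permutation_def is_key_def)
    ultimately show ?thesis
      using tableau_eq_nth_smallest[OF T] tableau_eq_nth_smallest[of "Ykey n lam \<sigma>"] True ji by simp
  next
    case False
    then show ?thesis using T by (auto simp: Ykey_def tableau_def split: prod.splits)
  qed
  then show ?thesis using s by blast
qed

text \<open>All columns of length \<open>q h\<close> have the same set \<open>B h\<close>, so the
  unions collapse. The extreme pair \<open>b\<close>, \<open>m\<close> spans every interval between
  a new \<open>y\<close> and an old \<open>x\<close>, hence testing it is enough.\<close>

lemma gapless_key_iff:
  assumes s: "R_permutation n R \<sigma>"
  shows "gapless_key n R lam (Ykey n lam \<sigma>) \<longleftrightarrow> gapless_chain n R (chain_of n R \<sigma>)"
proof -
  let ?B = "chain_of n R \<sigma>"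
  let ?Y = "Ykey n lam \<sigma>"
  have B: "R_chain n R ?B" by (rule chain_of_R_chain[OF s])
  have key: "is_key n lam ?Y" using Ykey_is_key s by (simp add: R_permutation_def)
  have U: "\<Union>{col ?Y j | j. j \<in> {1..lam 1} \<and> \<zeta> j = q h} = ?B h" if h: "h \<in> {1..r}" for h
  proof -
    obtain j where j: "1 \<le> j" "j \<le> lam 1" "\<zeta> j = q h" using ex_column[OF h] by blast
    have "{col ?Y j | j. j \<in> {1..lam 1} \<and> \<zeta> j = q h} = {?B h}"
      using Ykey_col_chain[OF s, of h] h j by fastforce
    then show ?thesis by simp
  qed
  have gap: "(let C1 = \<Union>{col ?Y j | j. j \<in> {1..lam 1} \<and> \<zeta> j = q h};
             C2 = \<Union>{col ?Y j | j. j \<in> {1..lam 1} \<and> \<zeta> j = q (h + 1)};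
             b = Min (C2 - C1); m = Max C1
         in b \<le> m \<longrightarrow> (\<forall>j\<in>{1..lam 1}. \<zeta> j = q (h + 1) \<longrightarrow> {b..m} \<subseteq> col ?Y j))
     \<longleftrightarrow> (\<forall>y\<in>?B (h + 1) - ?B h. \<forall>x\<in>?B h. \<forall>z. y < z \<and> z < x \<longrightarrow> z \<in> ?B (h + 1))" (is "?l \<longleftrightarrow> ?r")
    if h: "h \<in> {1..r - 1}" for h
  proof -
    have h': "h \<in> {1..r}" "h + 1 \<in> {1..r}" using h by auto
    define b where "b = Min (?B (h + 1) - ?B h)"
    define m where "m = Max (?B h)"
    have psub: "?B h \<subset> ?B (h + 1)" using B h' by (simp add: R_chain_def)
    then have b: "b \<in> ?B (h + 1) - ?B h" "\<And>y. y \<in> ?B (h + 1) - ?B h \<Longrightarrow> b \<le> y"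
      using R_chain_finite[OF B, of "h + 1"] unfolding b_def by (auto intro!: Min_in[of "?B (h + 1) - ?B h", simplified])
    have "?B h \<noteq> {}" using R_chain_card[OF B, of h] h' q_pos[of h] by auto
    then have m: "m \<in> ?B h" "\<And>y. y \<in> ?B h \<Longrightarrow> y \<le> m"
      using R_chain_finite[OF B, of h] unfolding m_def by auto
    obtain j where j: "1 \<le> j" "j \<le> lam 1" "\<zeta> j = q (h + 1)" using ex_column[OF h'(2)] by blast
    have "?l \<longleftrightarrow> (b \<le> m \<longrightarrow> (\<forall>j\<in>{1..lam 1}. \<zeta> j = q (h + 1) \<longrightarrow> {b..m} \<subseteq> col ?Y j))"
      unfolding U[OF h'(1)] U[OF h'(2)] Let_def b_def m_def ..
    also have "\<dots> \<longleftrightarrow> (b \<le> m \<longrightarrow> {b..m} \<subseteq> ?B (h + 1))"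
      using Ykey_col_chain[OF s, of "h + 1"] h' j by auto
    also have "\<dots> \<longleftrightarrow> ?r"
    proof
      assume *: "b \<le> m \<longrightarrow> {b..m} \<subseteq> ?B (h + 1)"
      show ?r
      proof (intro ballI allI impI)
        fix y x z assume "y \<in> ?B (h + 1) - ?B h" "x \<in> ?B h" "y < z \<and> z < x"
        then have "z \<in> {b..m}" using b(2)[of y] m(2)[of x] by auto
        then show "z \<in> ?B (h + 1)" using * by auto
      qed
    next
      assume r: ?r
      have "z \<in> ?B (h + 1)" if z: "z \<in> {b..m}" for z
      proof -
        consider "z = b" | "z = m" | "b < z" "z < m"
          using z unfolding atLeastAtMost_iff le_less by blast
        then show ?thesis by cases (use b(1) m(1) psub r in auto)
      qed
      then show "b \<le> m \<longrightarrow> {b..m} \<subseteq> ?B (h + 1)" by blast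
    qed
    finally show ?thesis .
  qed
  \<comment> \<open>At \<open>h = r\<close>, an index absent from the key condition, nothing below
    \<open>x \<le> n\<close> can be missing from \<open>{1..n}\<close>.\<close>
  have last: "z \<in> ?B (h + 1)" if "h = r" "x \<in> ?B h" "y < z \<and> z < x" for h x y z
    using that B R_chain_subset[OF B, of h] by (auto simp: R_chain_def)
  have "gapless_key n R lam ?Y \<longleftrightarrow>
    (\<forall>h\<in>{1..r - 1}. \<forall>y\<in>?B (h + 1) - ?B h. \<forall>x\<in>?B h. \<forall>z. y < z \<and> z < x \<longrightarrow> z \<in> ?B (h + 1))"
    unfolding gapless_key_def using key gap by (simp only: simp_thms cong: ball_cong)
  also have "\<dots> \<longleftrightarrow> (\<forall>h\<in>{1..r}. \<forall>y\<in>?B (h + 1) - ?B h. \<forall>x\<in>?B h. \<forall>z. y < z \<and> z < x \<longrightarrow> z \<in> ?B (h + 1))"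
    (is "(\<forall>h\<in>_. ?P h) \<longleftrightarrow> _")
  proof
    assume *: "\<forall>h\<in>{1..r - 1}. ?P h"
    show "\<forall>h\<in>{1..r}. ?P h"
    proof
      fix h assume "h \<in> {1..r}"
      then consider "h = r" | "h \<in> {1..r - 1}" by fastforce
      then show "?P h" by cases (use last * in blast)+
    qed
  qed auto
  finally show ?thesis unfolding gapless_chain_def using B by blast
qed

lemma card_gapless_keys: "card {Y. gapless_key n R lam Y} = C_count n R"
proof -
  have "bij_betw (Ykey n lam) {\<sigma>. R_permutation n R \<sigma> \<and> \<not> R_312_containing n R \<sigma>} {Y. gapless_key n R lam Y}"
    unfolding bij_betw_def
  proof
    show "inj_on (Ykey n lam) {\<sigma>. R_permutation n R \<sigma> \<and> \<not> R_312_containing n R \<sigma>}"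
      by (rule inj_onI) (use Ykey_inj in blast)
    show "Ykey n lam ` {\<sigma>. R_permutation n R \<sigma> \<and> \<not> R_312_containing n R \<sigma>} = {Y. gapless_key n R lam Y}"
    proof (intro equalityI subsetI)
      fix Y assume "Y \<in> {Y. gapless_key n R lam Y}"
      then have "gapless_key n R lam Y" "is_key n lam Y" by (simp_all add: gapless_key_def)
      then show "Y \<in> Ykey n lam ` {\<sigma>. R_permutation n R \<sigma> \<and> \<not> R_312_containing n R \<sigma>}"
        using Ykey_surj[of Y] gapless_key_iff avoiding_iff_gapless by fastforce
    qed (use gapless_key_iff avoiding_iff_gapless in auto)
  qed
  then show ?thesis unfolding C_count_def by (metis bij_betw_same_card)
qed

end

section \<open>The scanning tableau\<close>

text \<open>One column \<open>c\<close> (rows \<open>1..p\<close>) of the scanning process: \<open>w k\<close> is the current value of the path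
  started in row \<open>k\<close>, and \<open>scan_ptr K w p c t\<close> the row of the lowest unmarked box of the column once
  the \<open>t\<close> lowest paths have been treated.\<close>

primrec scan_ptr :: "nat \<Rightarrow> (nat \<Rightarrow> nat) \<Rightarrow> nat \<Rightarrow> (nat \<Rightarrow> nat) \<Rightarrow> nat \<Rightarrow> nat" where
  "scan_ptr K w p c 0 = p"
| "scan_ptr K w p c (Suc t) = (if 1 \<le> scan_ptr K w p c t \<and> w (K - t) \<le> c (scan_ptr K w p c t)
     then scan_ptr K w p c t - 1 else scan_ptr K w p c t)"

text \<open>Paths are treated from the bottom row upwards, so \<open>K - k\<close> of them precede
  row \<open>k\<close>. Pointer \<open>0\<close> means that the column is used up; the path then
  keeps its value.\<close>

definition scan_col :: "nat \<Rightarrow> (nat \<Rightarrow> nat) \<Rightarrow> nat \<Rightarrow> (nat \<Rightarrow> nat) \<Rightarrow> nat \<Rightarrow> nat" where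
  "scan_col K w p c k = (let u = scan_ptr K w p c (K - k) in if 1 \<le> u \<and> w k \<le> c u then c u else w k)"

lemma scan_ptr_step:
  assumes "k < K"
  shows "scan_ptr K w p c (K - k) = (let u = scan_ptr K w p c (K - Suc k) in
    if 1 \<le> u \<and> w (Suc k) \<le> c u then u - 1 else u)"
proof -
  have "K - k = Suc (K - Suc k)" "K - (K - Suc k) = Suc k" using assms by auto
  then show ?thesis by (simp add: Let_def)
qed

lemma scan_ptr_le: "scan_ptr K w p c t \<le> p"
  by (induction t) auto

lemma scan_col_ge: "w k \<le> scan_col K w p c k"
  by (simp add: scan_col_def Let_def)

locale scan =
  fixes K :: nat and w :: "nat \<Rightarrow> nat" and p :: nat and c :: "nat \<Rightarrow> nat"
  assumes w_mono: "strict_mono_on {1..K} w" and c_mono: "strict_mono_on {1..p} c"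
    and p_le: "p \<le> K" and w_le_c: "\<And>i. 1 \<le> i \<Longrightarrow> i \<le> p \<Longrightarrow> w i \<le> c i"
begin

lemma c_le: "1 \<le> i \<Longrightarrow> i \<le> j \<Longrightarrow> j \<le> p \<Longrightarrow> c i \<le> c j"
  using strict_mono_onD[OF c_mono, of i j] by (cases "i = j") auto

lemma c_less: "1 \<le> i \<Longrightarrow> i < j \<Longrightarrow> j \<le> p \<Longrightarrow> c i < c j"
  using strict_mono_onD[OF c_mono, of i j] by auto

lemma w_less: "1 \<le> i \<Longrightarrow> i < j \<Longrightarrow> j \<le> K \<Longrightarrow> w i < w j"
  using strict_mono_onD[OF w_mono, of i j] by auto

text \<open>The pointer could stay too low only by standing in row \<open>Suc k\<close> when path
  \<open>Suc k\<close> arrives, but \<open>w (Suc k) \<le> c (Suc k)\<close> forces that box to be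
  marked.\<close>

lemma scan_ptr_le_row: "k \<le> K \<Longrightarrow> scan_ptr K w p c (K - k) \<le> k"
proof (induction k rule: inc_induct)
  case base then show ?case using p_le by simp
next
  case (step k)
  have "w (Suc k) \<le> c (Suc k)" if "scan_ptr K w p c (K - Suc k) = Suc k"
    using w_le_c[of "Suc k"] that scan_ptr_le[of K w p c "K - Suc k"] by simp
  then show ?case using step.IH step.hyps by (cases "scan_ptr K w p c (K - Suc k) = Suc k") (auto simp: scan_ptr_step Let_def)
qed

lemma scan_col_cases:
  assumes "k \<le> K"
  obtains "scan_col K w p c k = w k"
  | u where "1 \<le> u" "u \<le> k" "u \<le> p" "u = scan_ptr K w p c (K - k)" "w k \<le> c u" "scan_col K w p c k = c u"
  using scan_ptr_le_row[OF assms] scan_ptr_le[of K w p c "K - k"]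
  unfolding scan_col_def Let_def by (metis (no_types, lifting))

text \<open>If path \<open>Suc k\<close> marks row \<open>u\<close>, path \<open>k\<close> sees row
  \<open>u - 1\<close> or keeps \<open>w k\<close>, and both values are smaller than
  \<open>c u\<close>. If it marks nothing, the pointer is unchanged and its entry, if any, is below
  \<open>w (Suc k)\<close>.\<close>

lemma scan_col_mono: "strict_mono_on {1..K} (scan_col K w p c)"
proof -
  have step: "scan_col K w p c k < scan_col K w p c (Suc k)" if k: "1 \<le> k" "Suc k \<le> K" for k
  proof -
    let ?u = "scan_ptr K w p c (K - Suc k)"
    have uk: "scan_ptr K w p c (K - k) = (if 1 \<le> ?u \<and> w (Suc k) \<le> c ?u then ?u - 1 else ?u)"
      using scan_ptr_step[of k K w p c] k by (simp add: Let_def)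
    have w: "w k < w (Suc k)" using w_less k by simp
    have up: "?u \<le> p" by (rule scan_ptr_le)
    show ?thesis
    proof (cases "1 \<le> ?u \<and> w (Suc k) \<le> c ?u")
      case True
      have "c (?u - 1) < c ?u" if "1 \<le> ?u - 1" using c_less[of "?u - 1" ?u] that up by simp
      then show ?thesis using True w uk by (auto simp: scan_col_def Let_def)
    next
      case False
      then show ?thesis using w uk by (auto simp: scan_col_def Let_def)
    qed
  qed
  have "i + 1 + d \<le> K \<longrightarrow> scan_col K w p c i < scan_col K w p c (i + 1 + d)" if "1 \<le> i" for i d
  proof (induction d)
    case (Suc d) then show ?case using step[of "i + 1 + d"] that by fastforce
  qed (use step that in auto)
  note * = this
  show ?thesis
  proof (rule strict_mono_onI)
    fix i j assume "i \<in> {1..K}" "j \<in> {1..K}" "i < j"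
    then show "scan_col K w p c i < scan_col K w p c j" using *[of i "j - i - 1"] by simp
  qed
qed

lemma scan_col_le: "1 \<le> i \<Longrightarrow> i \<le> p \<Longrightarrow> scan_col K w p c i \<le> c i"
proof -
  assume i: "1 \<le> i" "i \<le> p"
  have "i \<le> K" using i p_le by simp
  then show ?thesis by (cases rule: scan_col_cases) (use w_le_c c_le i in auto)
qed

text \<open>Fewer paths with larger values mark fewer boxes, so their pointer never falls above the
  other one; at equal pointers, whenever the larger value marks, so does the smaller. A path leaves
  with the maximum of its value and the entry at its pointer.\<close>

lemma scan_col_monotone:
  assumes "scan K' w' p c" and K': "K' \<le> K" and le: "\<And>k. 1 \<le> k \<Longrightarrow> k \<le> K' \<Longrightarrow> w k \<le> w' k"
    and k: "1 \<le> k" "k \<le> K'"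
  shows "scan_col K w p c k \<le> scan_col K' w' p c k"
proof -
  interpret s: scan K' w' p c by fact
  have ptr: "scan_ptr K w p c (K - k) \<le> scan_ptr K' w' p c (K' - k)" if "k \<le> K'" for k
    using that
  proof (induction k rule: inc_induct)
    case base then show ?case using scan_ptr_le by simp
  next
    case (step k)
    define u where "u = scan_ptr K w p c (K - Suc k)"
    define u' where "u' = scan_ptr K' w' p c (K' - Suc k)"
    have "u \<le> u'" "w (Suc k) \<le> w' (Suc k)" using step le[of "Suc k"] by (auto simp: u_def u'_def)
    moreover have "scan_ptr K w p c (K - k) = (if 1 \<le> u \<and> w (Suc k) \<le> c u then u - 1 else u)"
      "scan_ptr K' w' p c (K' - k) = (if 1 \<le> u' \<and> w' (Suc k) \<le> c u' then u' - 1 else u')"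
      using step.hyps K' scan_ptr_step[of k] by (simp_all add: u_def u'_def Let_def)
    ultimately show ?case by (cases "u = u'") auto
  qed
  have kK: "k \<le> K" using k K' by simp
  show ?thesis
    using kK
  proof (cases rule: scan_col_cases)
    case 1
    then show ?thesis using le[OF k] scan_col_ge[of w' k K' p c] by simp
  next
    case (2 u)
    define u' where "u' = scan_ptr K' w' p c (K' - k)"
    have u': "u \<le> u'" "u' \<le> p" using ptr[of k] 2 k scan_ptr_le[of K' w' p c] by (simp_all add: u'_def)
    have "c u \<le> c u'" using c_le[of u u'] 2(1) u' by simp
    moreover have "c u' \<le> scan_col K' w' p c k"
      using 2(1) u' by (auto simp: scan_col_def Let_def u'_def[symmetric])
    ultimately show ?thesis using 2 by simp
  qed
qed

text \<open>The entry at the pointer never exceeds the value of the arriving path: an entry below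
  \<open>w (Suc m)\<close> that is itself a path value is at most \<open>w m\<close>. So at most
  equal values are marked and nothing rises.\<close>

lemma scan_col_subset:
  assumes sub: "c ` {1..p} \<subseteq> w ` {1..K}" and k: "1 \<le> k" "k \<le> K"
  shows "scan_col K w p c k = w k"
proof -
  have next_le: "c u \<le> w m" if "1 \<le> u" "u \<le> p" "1 \<le> m" "c u < w (Suc m)" "Suc m \<le> K" for u m
  proof -
    have "c u \<in> w ` {1..K}" using sub that by auto
    then obtain i where i: "1 \<le> i" "i \<le> K" "c u = w i" by auto
    have "i \<le> m"
    proof (rule ccontr)
      assume "\<not> i \<le> m"
      then have "w (Suc m) \<le> w i" using w_less[of "Suc m" i] i(2) by (cases "i = Suc m") auto
      then show False using that(4) i(3) by simp
    qed
    then show ?thesis using i w_less[of i m] that by (cases "i = m") auto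
  qed
  have inv: "1 \<le> scan_ptr K w p c (K - k) \<longrightarrow> c (scan_ptr K w p c (K - k)) \<le> w k" if "k \<le> K" "1 \<le> k" for k
    using that
  proof (induction k rule: inc_induct)
    case base
    have "c p \<le> w K" if "1 \<le> p"
    proof -
      have "c p \<in> w ` {1..K}" using sub that by auto
      then obtain i where "1 \<le> i" "i \<le> K" "c p = w i" by auto
      then show ?thesis using w_less[of i K] by (cases "i = K") auto
    qed
    then show ?case by simp
  next
    case (step k)
    let ?u = "scan_ptr K w p c (K - Suc k)"
    have IH: "1 \<le> ?u \<Longrightarrow> c ?u \<le> w (Suc k)" using step by simp
    have up: "?u \<le> p" by (rule scan_ptr_le)
    show ?case
    proof (cases "1 \<le> ?u \<and> w (Suc k) \<le> c ?u")
      case True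
      then have u: "scan_ptr K w p c (K - k) = ?u - 1" using step by (simp add: scan_ptr_step Let_def)
      have "c (?u - 1) \<le> w k" if "1 \<le> ?u - 1"
        by (rule next_le) (use that up IH True c_less[of "?u - 1" ?u] step in auto)
      then show ?thesis using u by simp
    next
      case False
      then have u: "scan_ptr K w p c (K - k) = ?u" using step by (auto simp: scan_ptr_step Let_def)
      have "c ?u \<le> w k" if "1 \<le> ?u" by (rule next_le) (use that up False step in auto)
      then show ?thesis using u by simp
    qed
  qed
  show ?thesis using inv[OF k(2,1)] by (auto simp: scan_col_def Let_def)
qed

text \<open>An entry \<open>c i\<close> missing from \<open>w\<close> is not marked before the first path starting below it, which
  therefore gets raised.\<close>

lemma scan_col_raises:
  assumes i: "1 \<le> i" "i \<le> p" "c i \<notin> w ` {1..K}" and m: "1 \<le> m" "m \<le> K" "w m < c i"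
  shows "\<exists>k. 1 \<le> k \<and> k \<le> K \<and> w k < scan_col K w p c k"
proof -
  define k where "k = Max {k \<in> {1..K}. w k < c i}"
  have "k \<in> {k \<in> {1..K}. w k < c i}" unfolding k_def using m by (intro Max_in) auto
  then have k: "1 \<le> k" "k \<le> K" "w k < c i" by auto
  have above: "c i < w k'" if "k < k'" "k' \<le> K" for k'
  proof -
    have "\<not> w k' < c i"
    proof
      assume "w k' < c i"
      then have "k' \<le> k" unfolding k_def using that k(1) by (intro Max_ge) auto
      then show False using that by simp
    qed
    moreover have "w k' \<in> w ` {1..K}" using that k(1) by simp
    then have "w k' \<noteq> c i" using i(3) by metis
    ultimately show ?thesis by simp
  qed
  have "i \<le> scan_ptr K w p c (K - k')" if "k' \<le> K" "k \<le> k'" for k'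
    using that
  proof (induction k' rule: inc_induct)
    case base then show ?case using i by simp
  next
    case (step k')
    then have "i \<le> scan_ptr K w p c (K - Suc k')" "c i < w (Suc k')" using above[of "Suc k'"] by auto
    then show ?case using step(2) by (cases "i = scan_ptr K w p c (K - Suc k')") (auto simp: scan_ptr_step Let_def)
  qed
  then have u: "i \<le> scan_ptr K w p c (K - k)" using k by simp
  then have "c i \<le> c (scan_ptr K w p c (K - k))" using c_le i(1) scan_ptr_le by simp
  then show ?thesis using k u i(1) by (intro exI[of _ k]) (auto simp: scan_col_def Let_def)
qed

end

text \<open>The dummy pair \<open>(0, v)\<close> supplies the threshold \<open>v\<close> as last
  value when nothing has been selected. Extension on the right permits induction over
  columns.\<close>

lemma ewis_from_snoc:
  "ewis_from v (xs @ [x]) = ewis_from v xs @ (if snd (last ((0, v) # ewis_from v xs)) \<le> snd x then [x] else [])"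
  by (induction xs arbitrary: v) auto

lemma ewis_snoc:
  assumes "xs \<noteq> []"
  shows "ewis (xs @ [x]) = ewis xs @ (if snd (last (ewis xs)) \<le> snd x then [x] else [])"
proof -
  obtain y ys where xs: "xs = y # ys" using assms by (cases xs) auto
  have "snd (last ((0, snd y) # ewis_from (snd y) ys)) = snd (last (y # ewis_from (snd y) ys))" by simp
  then show ?thesis using ewis_from_snoc[of "snd y" ys x] by (simp add: ewis_def xs)
qed

section \<open>Path-by-path scanning rewritten column by column\<close>

context shape
begin

text \<open>The candidate list of the scanning process with a variable right end \<open>e\<close>,
  needed for induction over columns.\<close>

definition cands :: "(nat \<times> nat \<Rightarrow> nat) \<Rightarrow> (nat \<Rightarrow> nat) \<Rightarrow> nat \<Rightarrow> nat \<Rightarrow> (nat \<times> nat) list" where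
  "cands T m l e = [(j, T (j, \<zeta> j - m j)). j \<leftarrow> [l..<e], m j < \<zeta> j]"

text \<open>The path from \<open>(l, k)\<close> has value \<open>path_val T l d k\<close> after
  passing columns \<open>l + 1\<close> to \<open>l + d\<close>.\<close>

primrec path_val :: "(nat \<times> nat \<Rightarrow> nat) \<Rightarrow> nat \<Rightarrow> nat \<Rightarrow> nat \<Rightarrow> nat" where
  "path_val T l 0 = (\<lambda>k. T (l, k))"
| "path_val T l (Suc d) = scan_col (\<zeta> l) (path_val T l d) (\<zeta> (l + Suc d)) (\<lambda>i. T (l + Suc d, i))"

text \<open>Index shift: \<open>path_ptr T l d\<close> belongs to column \<open>l + Suc d\<close>,
  which receives the values \<open>path_val T l d\<close>.\<close>

definition path_ptr :: "(nat \<times> nat \<Rightarrow> nat) \<Rightarrow> nat \<Rightarrow> nat \<Rightarrow> nat \<Rightarrow> nat" where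
  "path_ptr T l d = scan_ptr (\<zeta> l) (path_val T l d) (\<zeta> (l + Suc d)) (\<lambda>i. T (l + Suc d, i))"

text \<open>If the marks before step \<open>t\<close> agree with the pointers, appending one column
  extends the EWIS exactly when \<open>scan_col\<close> takes its entry. Nonemptiness is carried
  along for \<open>ewis_snoc\<close>.\<close>

lemma ewis_cands:
  assumes t: "t < \<zeta> l" and ml: "m l = t"
    and m: "\<And>d. m (l + Suc d) = \<zeta> (l + Suc d) - path_ptr T l d t"
  shows "cands T m l (Suc (l + d)) \<noteq> []
    \<and> snd (last (ewis (cands T m l (Suc (l + d))))) = path_val T l d (\<zeta> l - t)
    \<and> fst ` set (ewis (cands T m l (Suc (l + d)))) = insert l {l + Suc e |e. e < d \<and>
        1 \<le> path_ptr T l e t \<and> path_val T l e (\<zeta> l - t) \<le> T (l + Suc e, path_ptr T l e t)}"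
proof (induction d)
  case 0
  then show ?case using t ml by (simp add: cands_def ewis_def)
next
  case (Suc d)
  let ?u = "path_ptr T l d t"
  let ?w = "path_val T l d (\<zeta> l - t)"
  let ?j = "l + Suc d"
  let ?xs = "cands T m l (Suc (l + d))"
  have up: "?u \<le> \<zeta> ?j" unfolding path_ptr_def by (rule scan_ptr_le)
  have unm: "m ?j < \<zeta> ?j \<longleftrightarrow> 1 \<le> ?u" "\<zeta> ?j - m ?j = ?u" using m[of d] up by auto
  have ext: "cands T m l (Suc (l + Suc d)) = ?xs @ (if 1 \<le> ?u then [(?j, T (?j, ?u))] else [])"
    using unm by (simp add: cands_def)
  have val: "path_val T l (Suc d) (\<zeta> l - t) = (if 1 \<le> ?u \<and> ?w \<le> T (?j, ?u) then T (?j, ?u) else ?w)"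
    using t by (simp add: scan_col_def Let_def path_ptr_def)
  have ew: "ewis (cands T m l (Suc (l + Suc d))) =
      ewis ?xs @ (if 1 \<le> ?u \<and> ?w \<le> T (?j, ?u) then [(?j, T (?j, ?u))] else [])"
    unfolding ext using Suc.IH ewis_snoc[of ?xs "(?j, T (?j, ?u))"] by auto
  have set: "{l + Suc e |e. e < Suc d \<and> P e} = {l + Suc e |e. e < d \<and> P e} \<union> (if P d then {?j} else {})" for P
    by (auto simp: less_Suc_eq)
  have "fst ` set (ewis (cands T m l (Suc (l + Suc d)))) = insert l {l + Suc e |e. e < Suc d \<and>
        1 \<le> path_ptr T l e t \<and> path_val T l e (\<zeta> l - t) \<le> T (l + Suc e, path_ptr T l e t)}"
    unfolding ew set set_append image_Un using Suc.IH by auto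
  moreover have "snd (last (ewis (cands T m l (Suc (l + Suc d))))) = path_val T l (Suc d) (\<zeta> l - t)"
    unfolding ew val using Suc.IH by simp
  ultimately show ?case unfolding ext using Suc.IH by blast
qed

lemma scan_cands_eq: "l \<le> lam 1 \<Longrightarrow> scan_cands n lam T l m = cands T m l (Suc (l + (lam 1 - l)))"
  by (simp add: scan_cands_def cands_def)

lemma scan_marks_eq:
  assumes l: "l \<le> lam 1" and "t \<le> \<zeta> l"
  shows "scan_marks n lam T l t l = t
    \<and> (\<forall>d. scan_marks n lam T l t (l + Suc d) = \<zeta> (l + Suc d) - path_ptr T l d t)"
  using assms(2)
proof (induction t)
  case 0
  then show ?case by (simp add: scan_marks_def path_ptr_def)
next
  case (Suc t)
  let ?m = "scan_marks n lam T l t"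
  let ?s = "fst ` set (ewis (scan_cands n lam T l ?m))"
  have t: "t < \<zeta> l" using Suc by simp
  have IH: "?m l = t" "\<And>d. ?m (l + Suc d) = \<zeta> (l + Suc d) - path_ptr T l d t" using Suc by auto
  have step: "scan_marks n lam T l (Suc t) j = (if j \<in> ?s then Suc (?m j) else ?m j)" for j
    by (simp add: scan_marks_def scan_step_def Let_def)
  have s: "?s = insert l {l + Suc e |e. e < lam 1 - l \<and>
        1 \<le> path_ptr T l e t \<and> path_val T l e (\<zeta> l - t) \<le> T (l + Suc e, path_ptr T l e t)}"
    unfolding scan_cands_eq[OF l] using ewis_cands[OF t IH] by blast
  have "scan_marks n lam T l (Suc t) (l + Suc d) = \<zeta> (l + Suc d) - path_ptr T l d (Suc t)" for d
  proof (cases "d < lam 1 - l")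
    case True
    have up: "path_ptr T l d t \<le> \<zeta> (l + Suc d)" unfolding path_ptr_def by (rule scan_ptr_le)
    have mem: "l + Suc d \<in> ?s \<longleftrightarrow> 1 \<le> path_ptr T l d t \<and> path_val T l d (\<zeta> l - t) \<le> T (l + Suc d, path_ptr T l d t)"
      unfolding s using True by auto
    have nxt: "path_ptr T l d (Suc t) = (if 1 \<le> path_ptr T l d t \<and> path_val T l d (\<zeta> l - t) \<le> T (l + Suc d, path_ptr T l d t)
      then path_ptr T l d t - 1 else path_ptr T l d t)" by (simp add: path_ptr_def)
    show ?thesis unfolding step mem nxt IH(2) using up by auto
  next
    case False
    \<comment> \<open>Columns past \<open>lam 1\<close> are never scanned; having length
      \<open>0\<close>, they give no marks and pointer \<open>0\<close>, so the formula
      persists.\<close>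
    then have z0: "\<zeta> (l + Suc d) = 0" by (intro zeta_eq_0) simp
    have "l + Suc d \<notin> ?s" unfolding s using False by auto
    then show ?thesis unfolding step IH(2) using z0 by simp
  qed
  moreover have "scan_marks n lam T l (Suc t) l = Suc t" using s by (simp add: step IH(1))
  ultimately show ?case by blast
qed

lemma scanning_eq:
  assumes "(l, k) \<in> bxs"
  shows "scanning n lam T (l, k) = path_val T l (lam 1 - l) k"
proof -
  have l: "1 \<le> l" "l \<le> lam 1" "1 \<le> k" "k \<le> \<zeta> l" using assms by (simp_all add: boxes_iff)
  let ?t = "\<zeta> l - k"
  have t: "?t < \<zeta> l" "\<zeta> l - ?t = k" using l by auto
  have m: "scan_marks n lam T l ?t l = ?t"
    "\<And>d. scan_marks n lam T l ?t (l + Suc d) = \<zeta> (l + Suc d) - path_ptr T l d ?t"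
    using scan_marks_eq[OF l(2), of ?t T] t by auto
  have "scanning n lam T (l, k) = snd (last (ewis (scan_cands n lam T l (scan_marks n lam T l ?t))))"
    using assms by (simp add: scanning_def)
  also have "\<dots> = path_val T l (lam 1 - l) (\<zeta> l - ?t)"
    unfolding scan_cands_eq[OF l(2)] using ewis_cands[OF t(1) m, of "lam 1 - l"] by blast
  finally show ?thesis using t by simp
qed

lemma path_val_scan:
  assumes T: "tableau n lam T" and l: "1 \<le> l"
  shows "scan (\<zeta> l) (path_val T l d) (\<zeta> (l + Suc d)) (\<lambda>i. T (l + Suc d, i))"
proof (induction d)
  case 0
  show ?case
  proof
    show "strict_mono_on {1..\<zeta> l} (path_val T l 0)" using tableau_column_mono[OF T l] by simp
    show "strict_mono_on {1..\<zeta> (l + Suc 0)} (\<lambda>i. T (l + Suc 0, i))" using tableau_column_mono[OF T, of "l + Suc 0"] by simp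
    show "\<zeta> (l + Suc 0) \<le> \<zeta> l" by (rule zeta_antimono) simp
    fix i assume "1 \<le> i" "i \<le> \<zeta> (l + Suc 0)"
    then show "path_val T l 0 i \<le> T (l + Suc 0, i)" using tableau_row_mono[OF T l, of "l + Suc 0" i] by simp
  qed
next
  case (Suc d)
  then interpret s: scan "\<zeta> l" "path_val T l d" "\<zeta> (l + Suc d)" "\<lambda>i. T (l + Suc d, i)" .
  show ?case
  proof
    show "strict_mono_on {1..\<zeta> l} (path_val T l (Suc d))" using s.scan_col_mono by simp
    show "strict_mono_on {1..\<zeta> (l + Suc (Suc d))} (\<lambda>i. T (l + Suc (Suc d), i))"
      using tableau_column_mono[OF T, of "l + Suc (Suc d)"] by simp
    show "\<zeta> (l + Suc (Suc d)) \<le> \<zeta> l" by (rule zeta_antimono) simp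
    fix i assume i: "1 \<le> i" "i \<le> \<zeta> (l + Suc (Suc d))"
    have "\<zeta> (l + Suc (Suc d)) \<le> \<zeta> (l + Suc d)" by (rule zeta_antimono) simp
    \<comment> \<open>The hypothesis of \<open>scan\<close> survives a column: the outgoing value is
      at most the entry in the same row, which is at most the entry to its right.\<close>
    then have "path_val T l (Suc d) i \<le> T (l + Suc d, i)" using s.scan_col_le[of i] i by simp
    also have "\<dots> \<le> T (l + Suc (Suc d), i)" using tableau_row_mono[OF T, of "l + Suc d" "l + Suc (Suc d)" i] i by simp
    finally show "path_val T l (Suc d) i \<le> T (l + Suc (Suc d), i)" .
  qed
qed

lemma path_val_mono_d: "d \<le> e \<Longrightarrow> path_val T l d k \<le> path_val T l e k"
proof (induction rule: dec_induct)
  case (step e) then show ?case using scan_col_ge[of "path_val T l e" k] by (auto intro: le_trans)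
qed simp

lemma path_val_strict_mono:
  assumes "tableau n lam T" "1 \<le> l"
  shows "strict_mono_on {1..\<zeta> l} (path_val T l d)"
  using path_val_scan[OF assms, of d] by (simp add: scan_def)

lemma path_val_cases:
  assumes T: "tableau n lam T" and l: "1 \<le> l" and k: "1 \<le> k" "k \<le> \<zeta> l"
  shows "path_val T l d k = T (l, k) \<or>
    (\<exists>j i. l < j \<and> 1 \<le> i \<and> i \<le> \<zeta> j \<and> path_val T l d k = T (j, i))"
proof (induction d)
  case (Suc d)
  interpret s: scan "\<zeta> l" "path_val T l d" "\<zeta> (l + Suc d)" "\<lambda>i. T (l + Suc d, i)" by (rule path_val_scan[OF T l])
  show ?case
    using k(2)
  proof (cases rule: s.scan_col_cases)
    case 1 then show ?thesis using Suc by simp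
  next
    case (2 u) then show ?thesis by (intro disjI2 exI[of _ "l + Suc d"] exI[of _ u]) simp
  qed
qed simp

text \<open>After column \<open>Suc l\<close> the paths from column \<open>l\<close> lie below its
  entries, from which the second family starts. From then on both families pass the same columns,
  and \<open>scan_col_monotone\<close> preserves the comparison.\<close>

lemma path_val_le_next:
  assumes T: "tableau n lam T" and l: "1 \<le> l" and k: "1 \<le> k" "k \<le> \<zeta> (Suc l)"
  shows "path_val T l (Suc d) k \<le> path_val T (Suc l) d k"
  using k
proof (induction d arbitrary: k)
  case 0
  interpret s: scan "\<zeta> l" "path_val T l 0" "\<zeta> (l + Suc 0)" "\<lambda>i. T (l + Suc 0, i)" by (rule path_val_scan[OF T l])
  show ?case using s.scan_col_le[of k] 0 by simp
next
  case (Suc d)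
  interpret s: scan "\<zeta> l" "path_val T l (Suc d)" "\<zeta> (l + Suc (Suc d))" "\<lambda>i. T (l + Suc (Suc d), i)"
    by (rule path_val_scan[OF T l])
  have "scan (\<zeta> (Suc l)) (path_val T (Suc l) d) (\<zeta> (l + Suc (Suc d))) (\<lambda>i. T (l + Suc (Suc d), i))"
    using path_val_scan[OF T, of "Suc l" d] by simp
  moreover have "\<zeta> (Suc l) \<le> \<zeta> l" by (rule zeta_antimono) simp
  ultimately show ?case using s.scan_col_monotone[of "\<zeta> (Suc l)" "path_val T (Suc l) d" k] Suc by simp
qed

lemma scanning_ge:
  assumes "x \<in> bxs" shows "T x \<le> scanning n lam T x"
proof -
  obtain l k where "x = (l, k)" by fastforce
  then show ?thesis using assms scanning_eq[of l k T] path_val_mono_d[of 0 "lam 1 - l" T l k] by simp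
qed

lemma scanning_strict_mono:
  assumes T: "tableau n lam T" and l: "1 \<le> l" "l \<le> lam 1"
  shows "strict_mono_on {1..\<zeta> l} (\<lambda>k. scanning n lam T (l, k))"
  using path_val_strict_mono[OF T l(1), of "lam 1 - l"] l
  by (auto simp: strict_mono_on_def scanning_eq boxes_iff)

lemma scanning_cases:
  assumes T: "tableau n lam T" and "(l, k) \<in> bxs"
  obtains "scanning n lam T (l, k) = T (l, k)"
  | j i where "l < j" "(j, i) \<in> bxs" "scanning n lam T (l, k) = T (j, i)"
proof -
  have l: "1 \<le> l" "1 \<le> k" "k \<le> \<zeta> l" using assms(2) by (auto simp: boxes_iff)
  show ?thesis
    using path_val_cases[OF T l, of "lam 1 - l"] that l by (auto simp: scanning_eq[OF assms(2)] boxes_def)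
qed

lemma scanning_le_next:
  assumes T: "tableau n lam T" and "1 \<le> l" "(Suc l, k) \<in> bxs"
  shows "scanning n lam T (l, k) \<le> scanning n lam T (Suc l, k)"
proof -
  have *: "1 \<le> k" "k \<le> \<zeta> (Suc l)" "Suc l \<le> lam 1" using assms by (auto simp: boxes_iff)
  have "\<zeta> (Suc l) \<le> \<zeta> l" by (rule zeta_antimono) simp
  then have "(l, k) \<in> bxs" using * assms by (simp add: boxes_iff)
  moreover have "lam 1 - l = Suc (lam 1 - Suc l)" using * by simp
  ultimately show ?thesis
    using path_val_le_next[OF T assms(2) *(1,2), of "lam 1 - Suc l"] assms(3) by (simp add: scanning_eq)
qed

lemma scanning_key:
  assumes Y: "is_key n lam Y"
  shows "scanning n lam Y = Y"
proof
  fix x :: "nat \<times> nat"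
  have T: "tableau n lam Y" using Y by (simp add: is_key_def)
  obtain l k where x: "x = (l, k)" by fastforce
  show "scanning n lam Y x = Y x"
  proof (cases "(l, k) \<in> bxs")
    case True
    then have l: "1 \<le> l" "l \<le> lam 1" "1 \<le> k" "k \<le> \<zeta> l" by (auto simp: boxes_iff)
    have "d \<le> lam 1 - l \<longrightarrow> (\<forall>k\<in>{1..\<zeta> l}. path_val Y l d k = Y (l, k))" for d
    proof (induction d)
      case (Suc d)
      show ?case
      proof (intro impI ballI)
        fix k assume d: "Suc d \<le> lam 1 - l" and k: "k \<in> {1..\<zeta> l}"
        interpret s: scan "\<zeta> l" "path_val Y l d" "\<zeta> (l + Suc d)" "\<lambda>i. Y (l + Suc d, i)" by (rule path_val_scan[OF T l(1)])
        have "path_val Y l d ` {1..\<zeta> l} = col Y l" using Suc d by (auto simp: col_eq intro!: image_cong)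
        moreover have "col Y (l + Suc d) \<subseteq> col Y l" using Y l d by (simp add: is_key_def)
        ultimately show "path_val Y l (Suc d) k = Y (l, k)"
          using s.scan_col_subset[of k] k Suc d by (simp add: col_eq)
      qed
    qed simp
    then show ?thesis using x l scanning_eq[OF True] by simp
  next
    case False then show ?thesis using T x by (simp add: scanning_def tableau_def)
  qed
qed

text \<open>The raise already happens in the neighbouring column, and later columns never lower a
  path.\<close>

lemma scanning_raises:
  assumes T: "tableau n lam T" and l: "1 \<le> l" "Suc l \<le> lam 1"
    and v: "v \<in> col T (Suc l)" "v \<notin> col T l" and y: "y \<in> col T l" "y < v"
  shows "\<exists>k. (l, k) \<in> bxs \<and> T (l, k) < scanning n lam T (l, k)"
proof -
  interpret s: scan "\<zeta> l" "path_val T l 0" "\<zeta> (l + Suc 0)" "\<lambda>i. T (l + Suc 0, i)" by (rule path_val_scan[OF T l(1)])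
  obtain i where i: "1 \<le> i" "i \<le> \<zeta> (l + Suc 0)" "T (l + Suc 0, i) = v" using v(1) by (auto simp: col_eq)
  obtain m where m: "1 \<le> m" "m \<le> \<zeta> l" "T (l, m) = y" using y(1) by (auto simp: col_eq)
  obtain k where k: "1 \<le> k" "k \<le> \<zeta> l" "path_val T l 0 k < path_val T l (Suc 0) k"
    using s.scan_col_raises[OF i(1,2) _ m(1,2)] i m v(2) y(2) by (auto simp: col_eq)
  have "(l, k) \<in> bxs" using k l by (simp add: boxes_iff)
  moreover have "path_val T l (Suc 0) k \<le> path_val T l (lam 1 - l) k" using l by (intro path_val_mono_d) simp
  ultimately show ?thesis using k scanning_eq[of l k T] by (intro exI[of _ k]) simp
qed

end

section \<open>Convexity\<close>

context shape
begin

text \<open>No column length is skipped: if columns \<open>l\<close> and \<open>Suc l\<close> differ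
  as sets, their lengths are \<open>q (h + 1)\<close> and \<open>q h\<close>, and the chain
  condition at \<open>h\<close> applies.\<close>

lemma key_columns_gap:
  assumes s: "R_permutation n R \<sigma>" and G: "gapless_chain n R (chain_of n R \<sigma>)"
    and l: "1 \<le> l" "Suc l \<le> lam 1"
    and y: "y \<in> col (Ykey n lam \<sigma>) l - col (Ykey n lam \<sigma>) (Suc l)"
    and x: "x \<in> col (Ykey n lam \<sigma>) (Suc l)" and v: "y < v" "v < x"
  shows "v \<in> col (Ykey n lam \<sigma>) l"
proof -
  let ?Y = "Ykey n lam \<sigma>"
  have key: "is_key n lam ?Y" using Ykey_is_key s by (simp add: R_permutation_def)
  obtain h where h: "h \<le> r" "\<zeta> l = q (Suc h)" using zeta_cases[of l] l by auto
  obtain h' where h': "h' \<le> r" "\<zeta> (Suc l) = q (Suc h')" using zeta_cases[of "Suc l"] l by auto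
  have ne: "h \<noteq> h'" using key_same_length[OF key, of "Suc l" l] y h h' l by auto
  have "q (Suc h') \<le> q (Suc h)" using zeta_antimono[of l "Suc l"] h h' by simp
  then have lt: "h' < h" using q_less_iff[of "Suc h" "Suc h'"] h h' ne by (metis Suc_less_eq leD linorder_neqE_nat not_less_eq not_less_eq_eq)
  have "h \<in> {1..r}" using lt h by simp
  then obtain j where j: "1 \<le> j" "j \<le> lam 1" "\<zeta> j = q h" using ex_column by blast
  have "\<zeta> j < \<zeta> l" using j h q_less[of h "Suc h"] by simp
  then have "Suc l \<le> j" using zeta_antimono[of j l] by (metis leD not_less_eq_eq)
  \<comment> \<open>A column of length \<open>q h\<close> exists and lies right of column
    \<open>l\<close>, so column \<open>Suc l\<close> cannot be shorter than
    \<open>q h\<close>.\<close>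
  then have "q h \<le> q (Suc h')" using zeta_antimono[of "Suc l" j] j h' by simp
  then have "h \<le> Suc h'" using q_less[of "Suc h'" h] h by (metis leD le_SucI linorder_not_le)
  then have eq: "h = Suc h'" using lt by simp
  have "col ?Y l = chain_of n R \<sigma> (h + 1)" "col ?Y (Suc l) = chain_of n R \<sigma> h"
    using Ykey_col_chain[OF s, of "Suc h" l] Ykey_col_chain[OF s, of "Suc h'" "Suc l"] h h' l eq by simp_all
  then show ?thesis using G \<open>h \<in> {1..r}\<close> x y v unfolding gapless_chain_def by metis
qed

text \<open>Induction from the last column leftwards. Let \<open>v\<close> be the key entry. Either
  \<open>v\<close> bounds the next key column, or a new value at most \<open>v\<close> starts a run
  up to the maximum of that column, or all key values up to \<open>v\<close> are old and
  \<open>v\<close> keeps its row in the next column.\<close>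

lemma scanning_le_gapless_key:
  assumes s: "R_permutation n R \<sigma>" and G: "gapless_chain n R (chain_of n R \<sigma>)"
    and T: "tableau n lam T" and le: "\<And>x. T x \<le> Ykey n lam \<sigma> x"
    and l: "1 \<le> l" "l \<le> lam 1" and k: "(l, k) \<in> bxs"
  shows "scanning n lam T (l, k) \<le> Ykey n lam \<sigma> (l, k)"
  using l(2,1) k
proof (induction l arbitrary: k rule: inc_induct)
  case base
  show ?case
    by (rule scanning_cases[OF T base(2)]) (use le in \<open>auto simp: boxes_iff\<close>)
next
  case (step l)
  let ?Y = "Ykey n lam \<sigma>"
  let ?S = "scanning n lam T"
  let ?A = "col ?Y l"
  let ?C = "col ?Y (Suc l)"
  have key: "is_key n lam ?Y" using Ykey_is_key s by (simp add: R_permutation_def)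
  then have TY: "tableau n lam ?Y" by (simp add: is_key_def)
  have l: "1 \<le> l" "Suc l \<le> lam 1" using step by auto
  have sub: "?C \<subseteq> ?A" using key l by (simp add: is_key_def)
  \<comment> \<open>A scanning entry is the entry of \<open>T\<close> itself or one from further
    right; the latter are bounded by key entries, all of which occur in the next key column.\<close>
  have high: "?S (l, k) \<le> ?Y (l, k)" if "(l, k) \<in> bxs" "\<And>x. x \<in> ?C \<Longrightarrow> x \<le> ?Y (l, k)" for k
  proof (rule scanning_cases[OF T that(1)])
    fix j i assume j: "l < j" "(j, i) \<in> bxs" "?S (l, k) = T (j, i)"
    have "?Y (j, i) \<in> col ?Y j" using j by (auto simp: col_eq boxes_iff)
    also have "col ?Y j \<subseteq> ?C" using key j by (simp add: is_key_def boxes_iff)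
    finally have "?Y (j, i) \<le> ?Y (l, k)" using that(2) by blast
    then show ?thesis using le[of "(j, i)"] j by simp
  qed (use le in simp)
  let ?v = "?Y (l, k)"
  have k: "1 \<le> k" "k \<le> \<zeta> l" using step.prems by (auto simp: boxes_iff)
  have vA: "?v \<in> ?A" using k by (auto simp: col_eq)
  have v: "?v = nth_smallest ?A k" using tableau_eq_nth_smallest[OF TY step.prems(2)] .
  have crd: "card ?A = \<zeta> l" "card ?C = \<zeta> (Suc l)" using col_card[OF TY] l by auto
  show ?case
  proof (cases "\<forall>x\<in>?C. x \<le> ?v")
    case True then show ?thesis using high[OF step.prems(2)] by blast
  next
    case False
    then obtain x where x: "x \<in> ?C" "?v < x" by auto
    show ?thesis
    proof (cases "\<exists>y\<in>?A - ?C. y \<le> ?v")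
      case True
      then obtain y where y: "y \<in> ?A - ?C" "y \<le> ?v" by blast
      define m where "m = Max ?C"
      have m: "m \<in> ?C" "\<And>x. x \<in> ?C \<Longrightarrow> x \<le> m" using x(1) col_finite unfolding m_def by (auto intro: Max_in)
      have vm: "?v < m" using m(2)[OF x(1)] x(2) by simp
      have run: "{?v..m} \<subseteq> ?A"
      proof
        fix u assume u: "u \<in> {?v..m}"
        have "u \<in> ?A" if "y < u" "u < m" using key_columns_gap[OF s G l y(1) m(1)] that .
        then show "u \<in> ?A" using u y vA m(1) sub by (cases "u = m"; cases "u = y") auto
      qed
      define k' where "k' = k + (m - ?v)"
      have "k' \<le> card ?A \<and> nth_smallest ?A k' = ?v + (m - ?v)"
        unfolding k'_def v by (rule nth_smallest_interval[OF col_finite k(1)]) (use run vm v k crd in auto)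
      then have k': "k' \<le> \<zeta> l" "nth_smallest ?A k' = m" using vm crd by auto
      have k'b: "(l, k') \<in> bxs" using k k' step.prems l by (simp add: boxes_iff k'_def)
      have "?Y (l, k') = m" using tableau_eq_nth_smallest[OF TY k'b] k' by simp
      then have Sm: "?S (l, k') \<le> m" using high[OF k'b] m(2) by simp
      \<comment> \<open>From row \<open>k'\<close>, where the bound is \<open>m\<close>, strict
        increase lowers the bound by at least one per row, and in the run the key drops by exactly
        one per row.\<close>
      have "strict_mono_on {0<..\<zeta> l} (\<lambda>k. ?S (l, k))"
        using scanning_strict_mono[OF T l(1)] l(2) by (simp add: atLeastSucAtMost_greaterThanAtMost[symmetric])
      then have "?S (l, k) + (k' - k) \<le> ?S (l, k')"
        by (rule strict_mono_on_diff_le) (use k k' in \<open>auto simp: k'_def\<close>)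
      then show ?thesis using Sm vm by (simp add: k'_def)
    next
      case False
      \<comment> \<open>The two key columns agree up to \<open>?v\<close>, so \<open>?v\<close> has
        rank \<open>k\<close> in both and the bound passes from the next column.\<close>
      then have "{u \<in> ?C. u \<le> ?v} = {u \<in> ?A. u \<le> ?v}" and vC: "?v \<in> ?C" using sub vA by auto
      moreover have "card {u \<in> ?A. u \<le> ?v} = k" unfolding v by (rule card_le_nth_smallest) (use k crd col_finite in auto)
      ultimately have c: "card {u \<in> ?C. u \<le> ?v} = k" by simp
      then have nth: "nth_smallest ?C k = ?v" using nth_smallest_eqI[OF col_finite vC] by simp
      have "card {u \<in> ?C. u \<le> ?v} \<le> card ?C" using col_finite by (intro card_mono) auto
      then have kb: "(Suc l, k) \<in> bxs" using c crd l k by (simp add: boxes_iff)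
      have "?S (l, k) \<le> ?S (Suc l, k)" by (rule scanning_le_next[OF T l(1) kb])
      also have "\<dots> \<le> ?Y (Suc l, k)" using step.IH[of k] kb by simp
      also have "\<dots> = ?v" using tableau_eq_nth_smallest[OF TY kb] nth by simp
      finally show ?thesis .
    qed
  qed
qed

lemma Demazure_gapless:
  assumes s: "R_permutation n R \<sigma>" and G: "gapless_chain n R (chain_of n R \<sigma>)"
  shows "Demazure n lam \<sigma> = {T. tableau n lam T \<and> (\<forall>x. T x \<le> Ykey n lam \<sigma> x)}"
proof (intro set_eqI iffI)
  fix T assume "T \<in> Demazure n lam \<sigma>"
  then have T: "tableau n lam T" "\<And>x. scanning n lam T x \<le> Ykey n lam \<sigma> x" by (auto simp: Demazure_def)
  have "T x \<le> Ykey n lam \<sigma> x" for x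
  proof (cases "x \<in> bxs")
    case True then show ?thesis using scanning_ge[of x T] T(2)[of x] by simp
  next
    case False then show ?thesis using T(1) by (cases x) (simp add: tableau_def)
  qed
  then show "T \<in> {T. tableau n lam T \<and> (\<forall>x. T x \<le> Ykey n lam \<sigma> x)}" using T by simp
next
  fix T assume T: "T \<in> {T. tableau n lam T \<and> (\<forall>x. T x \<le> Ykey n lam \<sigma> x)}"
  have "scanning n lam T x \<le> Ykey n lam \<sigma> x" for x
  proof (cases "x \<in> bxs")
    case True
    obtain l k where x: "x = (l, k)" by fastforce
    have "tableau n lam T" "\<And>x. T x \<le> Ykey n lam \<sigma> x" using T by blast+
    from scanning_le_gapless_key[OF s G this, of l k] show ?thesis using x True by (simp add: boxes_iff)
  next
    case False then show ?thesis by (cases x) (simp add: scanning_def)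
  qed
  then show "T \<in> Demazure n lam \<sigma>" using T by (simp add: Demazure_def)
qed

lemma principal_ideal_polytope:
  "convex_polytope bxs {T. tableau n lam T \<and> (\<forall>x. T x \<le> Y x)}"
proof -
  define e :: "nat \<times> nat \<Rightarrow> nat \<times> nat \<Rightarrow> int" where "e y = (\<lambda>x. if x = y then 1 else 0)" for y
  define colp where "colp = {(y, y'). y \<in> bxs \<and> y' \<in> bxs \<and> fst y = fst y' \<and> snd y' = snd y + 1}"
  define rowp where "rowp = {(y, y'). y \<in> bxs \<and> y' \<in> bxs \<and> snd y = snd y' \<and> fst y' = fst y + 1}"
  \<comment> \<open>Over the integers the strict column inequality becomes a difference at most
    \<open>- 1\<close>; \<open>min n (Y y)\<close> joins the entry range with the bound by
    \<open>Y\<close>.\<close>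
  define sys where "sys = (\<lambda>y. (\<lambda>x. - e y x, - 1)) ` bxs \<union> (\<lambda>y. (e y, int (min n (Y y)))) ` bxs
    \<union> (\<lambda>(y, y'). (\<lambda>x. e y x - e y' x, - 1)) ` colp \<union> (\<lambda>(y, y'). (\<lambda>x. e y x - e y' x, 0)) ` rowp"
  have "colp \<subseteq> bxs \<times> bxs" "rowp \<subseteq> bxs \<times> bxs" by (auto simp: colp_def rowp_def)
  then have "finite colp" "finite rowp" using finite_boxes by (auto intro: finite_subset)
  then have fin: "finite sys" using finite_boxes by (simp add: sys_def)
  have sum: "(\<Sum>x\<in>bxs. e y x * X x) = X y" if "y \<in> bxs" for y X
  proof -
    have "(\<Sum>x\<in>bxs. e y x * X x) = (\<Sum>x\<in>bxs. if x = y then X x else 0)" by (intro sum.cong) (auto simp: e_def)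
    then show ?thesis using that finite_boxes by (simp add: sum.delta')
  qed
  have sum_neg: "(\<Sum>x\<in>bxs. - e y x * X x) = - X y" if "y \<in> bxs" for y X
    using sum[OF that, of X] by (simp add: sum_negf)
  have sum_diff: "(\<Sum>x\<in>bxs. (e y x - e y' x) * X x) = X y - X y'" if "y \<in> bxs" "y' \<in> bxs" for y y' X
    using sum[OF that(1), of X] sum[OF that(2), of X] by (simp add: left_diff_distrib sum_subtractf)
  have sys_iff: "(\<forall>(a, b)\<in>sys. (\<Sum>x\<in>bxs. a x * X x) \<le> b) \<longleftrightarrow>
      (\<forall>y\<in>bxs. 1 \<le> X y) \<and> (\<forall>y\<in>bxs. X y \<le> int (min n (Y y))) \<and>
      (\<forall>(y, y')\<in>colp. X y < X y') \<and> (\<forall>(y, y')\<in>rowp. X y \<le> X y')" for X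
  proof -
    have "(\<forall>y\<in>bxs. (\<Sum>x\<in>bxs. - e y x * X x) \<le> - 1) \<longleftrightarrow> (\<forall>y\<in>bxs. 1 \<le> X y)"
      by (intro ball_cong refl) (subst sum_neg, auto)
    moreover have "(\<forall>y\<in>bxs. (\<Sum>x\<in>bxs. e y x * X x) \<le> int (min n (Y y))) \<longleftrightarrow> (\<forall>y\<in>bxs. X y \<le> int (min n (Y y)))"
      by (intro ball_cong refl) (subst sum, auto)
    moreover have "(\<forall>(y, y')\<in>colp. (\<Sum>x\<in>bxs. (e y x - e y' x) * X x) \<le> - 1) \<longleftrightarrow> (\<forall>(y, y')\<in>colp. X y < X y')"
      by (intro ball_cong refl) (auto simp: colp_def sum_diff)
    moreover have "(\<forall>(y, y')\<in>rowp. (\<Sum>x\<in>bxs. (e y x - e y' x) * X x) \<le> 0) \<longleftrightarrow> (\<forall>(y, y')\<in>rowp. X y \<le> X y')"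
      by (intro ball_cong refl) (auto simp: rowp_def sum_diff)
    ultimately show ?thesis
      unfolding sys_def ball_Un ball_simps(9) split_def fst_conv snd_conv by (simp only: conj_assoc)
  qed
  have "(\<exists>T\<in>{T. tableau n lam T \<and> (\<forall>x. T x \<le> Y x)}. X = (\<lambda>x. int (T x))) \<longleftrightarrow>
      (\<forall>(a, b)\<in>sys. (\<Sum>x\<in>bxs. a x * X x) \<le> b)" if zero: "\<forall>x. x \<notin> bxs \<longrightarrow> X x = 0" for X :: "nat \<times> nat \<Rightarrow> int"
    unfolding sys_iff
  proof
    assume "\<exists>T\<in>{T. tableau n lam T \<and> (\<forall>x. T x \<le> Y x)}. X = (\<lambda>x. int (T x))"
    then obtain T where T: "tableau n lam T" "\<And>x. T x \<le> Y x" "X = (\<lambda>x. int (T x))" by blast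
    have "T y < T y'" if yy: "(y, y') \<in> colp" for y y'
    proof -
      obtain j i where "y = (j, i)" "y' = (j, i + 1)" using yy by (cases y; cases y') (auto simp: colp_def)
      then show ?thesis using T(1) yy unfolding tableau_def colp_def by (simp add: boxes_iff)
    qed
    moreover have "T y \<le> T y'" if yy: "(y, y') \<in> rowp" for y y'
    proof -
      obtain j i where "y = (j, i)" "y' = (j + 1, i)" using yy by (cases y; cases y') (auto simp: rowp_def)
      then show ?thesis using T(1) yy unfolding tableau_def rowp_def by (simp add: boxes_iff)
    qed
    ultimately show "(\<forall>y\<in>bxs. 1 \<le> X y) \<and> (\<forall>y\<in>bxs. X y \<le> int (min n (Y y))) \<and>
      (\<forall>(y, y')\<in>colp. X y < X y') \<and> (\<forall>(y, y')\<in>rowp. X y \<le> X y')"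
      using tableau_range[OF T(1)] T(2,3) by fastforce
  next
    assume *: "(\<forall>y\<in>bxs. 1 \<le> X y) \<and> (\<forall>y\<in>bxs. X y \<le> int (min n (Y y))) \<and>
      (\<forall>(y, y')\<in>colp. X y < X y') \<and> (\<forall>(y, y')\<in>rowp. X y \<le> X y')"
    define T where "T x = nat (X x)" for x
    have XT: "X x = int (T x)" for x
    proof (cases "x \<in> bxs")
      case True
      then have "1 \<le> X x" using * by blast
      then show ?thesis by (simp add: T_def)
    next
      case False
      then have "X x = 0" using zero by blast
      then show ?thesis by (simp add: T_def)
    qed
    have T0: "T x = 0" if "x \<notin> bxs" for x
    proof -
      have "X x = 0" using zero that by blast
      then show ?thesis by (simp add: T_def)
    qed
    have "tableau n lam T"
      unfolding tableau_def
    proof (intro conjI allI ballI impI)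
      fix x assume "x \<in> bxs"
      then have "1 \<le> X x" "X x \<le> int (min n (Y x))" using * by blast+
      then show "T x \<in> {1..n}" unfolding XT by simp
    next
      fix j i assume ji: "1 \<le> i \<and> (j, i + 1) \<in> bxs"
      then have "((j, i), (j, i + 1)) \<in> colp" by (simp add: colp_def boxes_iff)
      then have "X (j, i) < X (j, i + 1)" using * by blast
      then show "T (j, i) < T (j, i + 1)" unfolding XT by simp
    next
      fix j i assume ji: "1 \<le> j \<and> (j + 1, i) \<in> bxs"
      then have "((j, i), (j + 1, i)) \<in> rowp"
        using zeta_antimono[of j "j + 1"] by (auto simp: rowp_def boxes_iff)
      then have "X (j, i) \<le> X (j + 1, i)" using * by blast
      then show "T (j, i) \<le> T (j + 1, i)" unfolding XT by simp
    qed (simp add: T0)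
    moreover have "T x \<le> Y x" for x
    proof (cases "x \<in> bxs")
      case True
      then have "X x \<le> int (min n (Y x))" using * by blast
      then show ?thesis unfolding XT by simp
    qed (simp add: T0)
    ultimately show "\<exists>T\<in>{T. tableau n lam T \<and> (\<forall>x. T x \<le> Y x)}. X = (\<lambda>x. int (T x))"
      using XT by blast
  qed
  then show ?thesis unfolding convex_polytope_def using fin by blast
qed

section \<open>Gaps destroy convexity\<close>

lemma key_in_Demazure:
  assumes "is_key n lam Y" "\<And>x. Y x \<le> Ykey n lam \<sigma> x"
  shows "Y \<in> Demazure n lam \<sigma>"
  using assms scanning_key[of Y] by (simp add: Demazure_def is_key_def)

end

text \<open>Take \<open>v\<close> as the least missing value above \<open>y0\<close>, then
  \<open>y\<close> and \<open>x\<close> as its nearest neighbours in \<open>A - C\<close> below and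
  in \<open>C\<close> above. Values between \<open>y0\<close> and \<open>v\<close> are in
  \<open>A\<close>, so by maximality of \<open>y\<close> those above \<open>y\<close> are in
  \<open>C\<close>.\<close>

lemma minimal_gap:
  fixes A C :: "nat set"
  assumes fin: "finite A" "C \<subseteq> A" and gap: "y0 \<in> A - C" "x0 \<in> C" "y0 < z0" "z0 < x0" "z0 \<notin> A"
  obtains y v x where "y \<in> A - C" "v \<notin> A" "x \<in> C" "y < v" "v < x"
    "\<And>u. y < u \<Longrightarrow> u < v \<Longrightarrow> u \<in> C" "\<And>u. u \<in> C \<Longrightarrow> v < u \<Longrightarrow> x \<le> u"
proof -
  define v where "v = (LEAST z. y0 < z \<and> z \<notin> A)"
  have z0: "y0 < z0 \<and> z0 \<notin> A" using gap by simp
  have v: "y0 < v \<and> v \<notin> A" "v \<le> z0" "\<And>u. y0 < u \<Longrightarrow> u < v \<Longrightarrow> u \<in> A"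
    unfolding v_def using LeastI[of "\<lambda>z. y0 < z \<and> z \<notin> A", OF z0]
      Least_le[of "\<lambda>z. y0 < z \<and> z \<notin> A", OF z0] not_less_Least[of _ "\<lambda>z. y0 < z \<and> z \<notin> A"] by blast+
  define y where "y = Max {y \<in> A - C. y < v}"
  have fy: "finite {y \<in> A - C. y < v}" "y0 \<in> {y \<in> A - C. y < v}" using fin gap v by auto
  then have "y \<in> {y \<in> A - C. y < v}" unfolding y_def by (intro Max_in) auto
  then have y: "y \<in> A - C" "y < v" by auto
  have ymax: "u \<le> y" if "u \<in> A - C" "u < v" for u unfolding y_def using that fy(1) by (intro Max_ge) auto
  define x where "x = Min {x \<in> C. v < x}"
  have "finite C" using fin finite_subset by blast
  then have fx: "finite {x \<in> C. v < x}" "x0 \<in> {x \<in> C. v < x}" using gap v by auto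
  then have "x \<in> {x \<in> C. v < x}" unfolding x_def by (intro Min_in) auto
  then have x: "x \<in> C" "v < x" by auto
  have xmin: "x \<le> u" if "u \<in> C" "v < u" for u unfolding x_def using that fx(1) by (intro Min_le) auto
  have "u \<in> C" if "y < u" "u < v" for u
  proof -
    have "y0 \<le> y" using ymax[of y0] fy(2) by simp
    then have "u \<in> A" using v(3) that by simp
    then show ?thesis using ymax[of u] that by auto
  qed
  then show ?thesis using that y v(1) x xmin by blast
qed

text \<open>The interval \<open>(y, v)\<close> is shifted down by one, which makes room for moving \<open>x\<close> to any
  \<open>w \<in> {v - 1..x}\<close>; only the positions \<open>w = v - 1\<close> and \<open>w = x\<close> avoid the gap \<open>v\<close>.\<close>

definition shift :: "nat \<Rightarrow> nat \<Rightarrow> nat \<Rightarrow> nat \<Rightarrow> nat \<Rightarrow> nat" where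
  "shift y v x w u = (if y < u \<and> u < v then u - 1 else if u = x then w else u)"

locale gap =
  fixes A C :: "nat set" and y v x :: nat
  assumes C_subset: "C \<subseteq> A" and y: "y \<in> A - C" and v: "v \<notin> A" and x: "x \<in> C"
    and less: "y < v" "v < x"
    and below: "\<And>u. y < u \<Longrightarrow> u < v \<Longrightarrow> u \<in> C" and above: "\<And>u. u \<in> C \<Longrightarrow> v < u \<Longrightarrow> x \<le> u"
begin

text \<open>The freed places are safe: \<open>y\<close> is not in \<open>C\<close>, so the run may
  move down onto it and ends at most at \<open>v - 2\<close>; no element of \<open>C\<close> lies
  between \<open>v\<close> and \<open>x\<close>. This covers \<open>w = v\<close> as well.\<close>

lemma shift_strict_mono:
  assumes "v - 1 \<le> w" "w \<le> x"
  shows "strict_mono_on C (shift y v x w)"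
proof (rule strict_mono_onI)
  fix u u' assume u: "u \<in> C" "u' \<in> C" "u < u'"
  have "u \<noteq> y" "u' \<noteq> y" "u \<noteq> v" "u' \<noteq> v" using u y v C_subset by auto
  then show "shift y v x w u < shift y v x w u'"
    using u assms less above[of u] above[of u'] by (auto simp: shift_def)
qed

lemma shift_le: "w \<le> x \<Longrightarrow> shift y v x w u \<le> u"
  by (simp add: shift_def)

text \<open>Shifted values are \<open>y\<close> or lie strictly between \<open>y\<close> and
  \<open>v\<close>, hence in \<open>A\<close>, and so is \<open>v - 1\<close>. The position
  \<open>w = v\<close> is excluded since \<open>v \<notin> A\<close>.\<close>

lemma shift_in:
  assumes "w = v - 1 \<or> w = x" "u \<in> C" shows "shift y v x w u \<in> A"
proof -
  have "u - 1 \<in> A" if "y < u" "u < v"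
    using below[of "u - 1"] that y C_subset by (cases "u - 1 = y") auto
  moreover have "v - 1 \<in> A" using below[of "v - 1"] less y C_subset by (cases "v - 1 = y") auto
  ultimately show ?thesis using assms C_subset by (auto simp: shift_def)
qed

lemma shift_x: "shift y v x w x = w" using less by (simp add: shift_def)

end

lemma affine_between:
  fixes \<alpha> \<beta> s t u b :: int
  assumes "s \<le> t" "t \<le> u" "\<alpha> + s * \<beta> \<le> b" "\<alpha> + u * \<beta> \<le> b"
  shows "\<alpha> + t * \<beta> \<le> b"
proof (cases "0 \<le> \<beta>")
  case True
  then show ?thesis using mult_right_mono[OF assms(2), of \<beta>] assms by simp
next
  case False
  then have "t * \<beta> \<le> s * \<beta>" using mult_right_mono_neg[OF assms(1), of \<beta>] by simp
  then show ?thesis using assms(3) by linarith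
qed

context shape
begin

lemma not_gapless_not_polytope:
  assumes s: "R_permutation n R \<sigma>" and G: "\<not> gapless_chain n R (chain_of n R \<sigma>)"
  shows "\<not> convex_polytope bxs (Demazure n lam \<sigma>)"
proof
  assume poly: "convex_polytope bxs (Demazure n lam \<sigma>)"
  let ?B = "chain_of n R \<sigma>"
  let ?Y = "Ykey n lam \<sigma>"
  have B: "R_chain n R ?B" by (rule chain_of_R_chain[OF s])
  have key: "is_key n lam ?Y" using Ykey_is_key s by (simp add: R_permutation_def)
  then have TY: "tableau n lam ?Y" by (simp add: is_key_def)
  obtain h x0 y0 z0 where h: "h \<in> {1..r}" and g0: "y0 \<in> ?B (h + 1) - ?B h" "x0 \<in> ?B h" "y0 < z0" "z0 < x0" "z0 \<notin> ?B (h + 1)"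
    using B G unfolding gapless_chain_def by blast
  have "z0 \<in> {1..n}" using g0 R_chain_subset[OF B, of h] by auto
  then have hr: "h < r" using h g0(5) B by (cases "h = r") (auto simp: R_chain_def)
  have sub: "?B h \<subseteq> ?B (h + 1)" using R_chain_mono[OF B, of h "h + 1"] hr by simp
  obtain y v x where "y \<in> ?B (h + 1) - ?B h" "v \<notin> ?B (h + 1)" "x \<in> ?B h" "y < v" "v < x"
    "\<And>u. y < u \<Longrightarrow> u < v \<Longrightarrow> u \<in> ?B h" "\<And>u. u \<in> ?B h \<Longrightarrow> v < u \<Longrightarrow> x \<le> u"
    using minimal_gap[OF R_chain_finite[OF B] sub g0] by blast
  then interpret g: gap "?B (h + 1)" "?B h" y v x using sub by unfold_locales
  let ?f = "shift y v x"
  \<comment> \<open>Only columns of length at most \<open>q h\<close> are shifted, with entries in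
    \<open>B h\<close>, where the shift increases. Longer columns contain all of
    \<open>B (h + 1)\<close>, so nestedness survives at the two endpoints.\<close>
  define U where "U w b = (if b \<in> bxs then if \<zeta> (fst b) \<le> q h then ?f w (?Y b) else ?Y b else 0)" for w b
  have short: "col ?Y j \<subseteq> ?B h" if j: "1 \<le> j" "j \<le> lam 1" "\<zeta> j \<le> q h" for j
  proof -
    obtain m where m: "m \<le> r" "\<zeta> j = q (Suc m)" using zeta_cases[OF j(1,2)] .
    then have "Suc m \<le> h" using q_less_iff[of h "Suc m"] j h hr by simp
    then show ?thesis using R_chain_mono[OF B, of "Suc m" h] Ykey_col_chain[OF s, of "Suc m" j] m j h by simp
  qed
  have long: "?B (h + 1) \<subseteq> col ?Y j" if j: "1 \<le> j" "j \<le> lam 1" "\<not> \<zeta> j \<le> q h" for j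
  proof -
    obtain m where m: "m \<le> r" "\<zeta> j = q (Suc m)" using zeta_cases[OF j(1,2)] .
    then have "h + 1 \<le> Suc m" using q_less_iff[of h "Suc m"] j h hr by simp
    then show ?thesis using R_chain_mono[OF B, of "h + 1" "Suc m"] Ykey_col_chain[OF s, of "Suc m" j] m j by simp
  qed
  have entry: "?Y (j, i) \<in> ?B h" if "(j, i) \<in> bxs" "\<zeta> j \<le> q h" for j i
    using short[of j] that by (auto simp: boxes_iff col_eq)
  have colU: "col (U w) j = (if \<zeta> j \<le> q h then ?f w ` col ?Y j else col ?Y j)" if "1 \<le> j" "j \<le> lam 1" for w j
    using that by (auto simp: col_eq U_def boxes_iff image_image intro!: image_cong)
  have in_D: "U w \<in> Demazure n lam \<sigma>" if w: "w = v - 1 \<or> w = x" for w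
  proof (rule key_in_Demazure)
    have wb: "v - 1 \<le> w" "w \<le> x" using w g.less by auto
    show "U w b \<le> ?Y b" for b using g.shift_le[OF wb(2)] by (simp add: U_def)
    show "is_key n lam (U w)"
    proof (rule is_keyI)
      fix b assume b: "b \<in> bxs"
      obtain j i where ji: "b = (j, i)" by fastforce
      have "?f w (?Y b) \<in> {1..n}" if "\<zeta> j \<le> q h"
        using g.shift_in[OF w entry[of j i]] R_chain_subset[OF B, of "h + 1"] that b ji by blast
      moreover have "?Y b \<in> {1..n}" using tableau_range[OF TY b] .
      ultimately show "U w b \<in> {1..n}" unfolding U_def ji using b ji by (simp del: atLeastAtMost_iff)
    next
      fix j assume j: "1 \<le> j" "j \<le> lam 1"
      show "strict_mono_on {1..\<zeta> j} (\<lambda>i. U w (j, i))"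
      proof (rule strict_mono_onI)
        fix i k assume ik: "i \<in> {1..\<zeta> j}" "k \<in> {1..\<zeta> j}" "i < k"
        have b: "(j, i) \<in> bxs" "(j, k) \<in> bxs" using ik j by (auto simp: boxes_iff)
        have lt: "?Y (j, i) < ?Y (j, k)" using strict_mono_onD[OF tableau_column_mono[OF TY j(1)] ik] .
        show "U w (j, i) < U w (j, k)"
        proof (cases "\<zeta> j \<le> q h")
          case True
          then have "?f w (?Y (j, i)) < ?f w (?Y (j, k))"
            using strict_mono_onD[OF g.shift_strict_mono[OF wb] _ _ lt] entry b by blast
          then show ?thesis using b True by (simp add: U_def)
        next
          case False then show ?thesis using b lt by (simp add: U_def)
        qed
      qed
    next
      fix l j assume lj: "1 \<le> l" "l \<le> j" "j \<le> lam 1"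
      have nest: "col ?Y j \<subseteq> col ?Y l" using key lj by (simp add: is_key_def)
      have "\<zeta> j \<le> \<zeta> l" using lj by (intro zeta_antimono)
      then consider "\<zeta> l \<le> q h" "\<zeta> j \<le> q h" | "\<not> \<zeta> l \<le> q h" "\<zeta> j \<le> q h" | "\<not> \<zeta> l \<le> q h" "\<not> \<zeta> j \<le> q h"
        by linarith
      then show "col (U w) j \<subseteq> col (U w) l"
      proof cases
        case 1 then show ?thesis using colU[of j w] colU[of l w] nest lj by (simp add: image_mono)
      next
        case 2
        have "?f w ` col ?Y j \<subseteq> ?B (h + 1)" using g.shift_in[OF w] short[of j] 2 lj by auto
        then show ?thesis using colU[of j w] colU[of l w] long[of l] 2 lj by auto
      next
        case 3 then show ?thesis using colU[of j w] colU[of l w] nest lj by simp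
      qed
    qed (simp add: U_def)
  qed
  \<comment> \<open>\<open>E\<close> marks the boxes where \<open>x\<close> is replaced by
    \<open>w\<close>, the direction of the affine line. \<open>U 0\<close> is merely its constant
    term and need not be a tableau.\<close>
  define E where "E b = (if b \<in> bxs \<and> \<zeta> (fst b) \<le> q h \<and> ?Y b = x then 1 else 0 :: int)" for b
  have affine: "int (U w b) = int (U 0 b) + int w * E b" for w b
    using g.less by (auto simp: U_def E_def shift_def)
  obtain sys where sys: "\<And>X. (\<forall>b. b \<notin> bxs \<longrightarrow> X b = 0) \<Longrightarrow>
      (\<exists>T\<in>Demazure n lam \<sigma>. X = (\<lambda>b. int (T b))) \<longleftrightarrow> (\<forall>(a, b)\<in>sys. (\<Sum>t\<in>bxs. a t * X t) \<le> b)"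
    using poly unfolding convex_polytope_def by blast
  have U_iff: "(\<exists>T\<in>Demazure n lam \<sigma>. (\<lambda>b. int (U w b)) = (\<lambda>b. int (T b))) \<longleftrightarrow>
      (\<forall>(a, b)\<in>sys. (\<Sum>t\<in>bxs. a t * int (U w t)) \<le> b)" for w
    by (rule sys) (simp add: U_def)
  have sum: "(\<Sum>t\<in>bxs. a t * int (U w t)) = (\<Sum>t\<in>bxs. a t * int (U 0 t)) + int w * (\<Sum>t\<in>bxs. a t * E t)" for a w
    by (subst affine) (simp add: distrib_left sum.distrib sum_distrib_left mult.left_commute)
  have "\<forall>(a, b)\<in>sys. (\<Sum>t\<in>bxs. a t * int (U v t)) \<le> b"
  proof (intro ballI, clarify)
    fix a b assume ab: "(a, b) \<in> sys"
    have *: "(\<Sum>t\<in>bxs. a t * int (U w t)) \<le> b" if "w = v - 1 \<or> w = x" for w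
      using U_iff[of w] in_D[OF that] ab by blast
    show "(\<Sum>t\<in>bxs. a t * int (U v t)) \<le> b"
      unfolding sum[of a v] by (rule affine_between[of "int (v - 1)" _ "int x"])
        (use *[of "v - 1"] *[of x] sum[of a "v - 1"] sum[of a x] g.less in auto)
  qed
  then obtain T where T: "T \<in> Demazure n lam \<sigma>" "(\<lambda>b. int (U v b)) = (\<lambda>b. int (T b))" using U_iff[of v] by blast
  have "U v = T"
  proof
    fix b show "U v b = T b" using fun_cong[OF T(2), of b] by simp
  qed
  then have D: "tableau n lam (U v)" "\<And>b. scanning n lam (U v) b \<le> ?Y b" using T(1) by (auto simp: Demazure_def)
  \<comment> \<open>The last column longer than \<open>q h\<close> has length
    \<open>q (h + 1)\<close>, and its right neighbour has length \<open>q h\<close>. There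
    \<open>v\<close> occurs on the right but not in column \<open>l\<close>, which contains the
    smaller \<open>y\<close>; scanning thus raises an entry of column \<open>l\<close>, where
    \<open>U v\<close> still equals the key.\<close>
  define l where "l = Max {j \<in> {1..lam 1}. q h < \<zeta> j}"
  obtain j where j: "1 \<le> j" "j \<le> lam 1" "\<zeta> j = q (h + 1)" using ex_column[of "h + 1"] hr by auto
  obtain j' where j': "1 \<le> j'" "j' \<le> lam 1" "\<zeta> j' = q h" using ex_column[OF h] by blast
  have qlt: "q h < q (h + 1)" using q_less[of h "h + 1"] hr by simp
  have jm: "j \<in> {j \<in> {1..lam 1}. q h < \<zeta> j}" using j qlt by simp
  then have "l \<in> {j \<in> {1..lam 1}. q h < \<zeta> j}" unfolding l_def by (intro Max_in) auto
  then have l: "1 \<le> l" "l \<le> lam 1" "q h < \<zeta> l" by auto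
  have lmax: "m \<le> l" if "1 \<le> m" "m \<le> lam 1" "q h < \<zeta> m" for m unfolding l_def using that by (intro Max_ge) auto
  have "\<zeta> l \<le> q (h + 1)" using zeta_antimono[of j l] lmax[of j] j qlt by simp
  moreover obtain m where m: "m \<le> r" "\<zeta> l = q (Suc m)" using zeta_cases[OF l(1,2)] .
  ultimately have "Suc m = h + 1"
    using q_less_iff[of h "Suc m"] q_less_iff[of "h + 1" "Suc m"] l(3) hr by simp
  then have zl: "\<zeta> l = q (h + 1)" using m by simp
  have lj': "Suc l \<le> j'" using zeta_antimono[of j' l] j' l(3) by (metis leD not_less_eq_eq)
  then have l2: "Suc l \<le> lam 1" using j' by simp
  have "\<not> q h < \<zeta> (Suc l)" using lmax[of "Suc l"] l2 by auto
  then have zl2: "\<zeta> (Suc l) = q h" using zeta_antimono[OF lj'] j' by simp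
  have colA: "col (U v) l = ?B (h + 1)"
    using colU[OF l(1,2)] Ykey_col_chain[OF s, of "h + 1" l] zl qlt l hr by simp
  have colC: "col (U v) (Suc l) = ?f v ` ?B h"
    using colU[of "Suc l"] Ykey_col_chain[OF s, of h "Suc l"] zl2 l2 h by simp
  have "v \<in> col (U v) (Suc l)" unfolding colC using g.x g.shift_x[of v] by (metis imageI)
  then obtain k where k: "(l, k) \<in> bxs" "U v (l, k) < scanning n lam (U v) (l, k)"
    using scanning_raises[OF D(1) l(1) l2, of v y] g.v g.y g.less unfolding colA by blast
  moreover have "U v (l, k) = ?Y (l, k)" using k(1) l(3) by (simp add: U_def)
  ultimately show False using D(2)[of "(l, k)"] by simp
qed

lemma polytope_iff_avoiding:
  assumes s: "R_permutation n R \<sigma>"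
  shows "convex_polytope bxs (Demazure n lam \<sigma>) \<longleftrightarrow> \<not> R_312_containing n R \<sigma>"
proof (cases "gapless_chain n R (chain_of n R \<sigma>)")
  case True
  then show ?thesis
    unfolding Demazure_gapless[OF s True] using principal_ideal_polytope avoiding_iff_gapless[OF s] by simp
next
  case False
  then show ?thesis using not_gapless_not_polytope[OF s] avoiding_iff_gapless[OF s] by simp
qed

text \<open>Each key is fixed by scanning and lies in its own Demazure set, so equal sets bound each
  of the two keys by the other.\<close>

lemma Demazure_inj:
  assumes s: "R_permutation n R \<sigma>" and t: "R_permutation n R \<tau>"
    and eq: "Demazure n lam \<sigma> = Demazure n lam \<tau>"
  shows "\<sigma> = \<tau>"
proof (rule Ykey_inj[OF s t])
  have key: "is_key n lam (Ykey n lam \<sigma>)" "is_key n lam (Ykey n lam \<tau>)"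
    using Ykey_is_key s t by (simp_all add: R_permutation_def)
  have "Ykey n lam \<sigma> \<in> Demazure n lam \<tau>" "Ykey n lam \<tau> \<in> Demazure n lam \<sigma>"
    using key_in_Demazure[OF key(1)] key_in_Demazure[OF key(2)] eq by auto
  then have "\<forall>x. Ykey n lam \<sigma> x \<le> Ykey n lam \<tau> x" "\<forall>x. Ykey n lam \<tau> x \<le> Ykey n lam \<sigma> x"
    unfolding Demazure_def mem_Collect_eq scanning_key[OF key(1)] scanning_key[OF key(2)] by blast+
  then show "Ykey n lam \<sigma> = Ykey n lam \<tau>" by (intro ext antisym) blast+
qed

end

theorem theorem9p1:
  fixes n :: nat and R :: "nat set" and lam :: "nat \<Rightarrow> nat"
  assumes "1 \<le> n"
    and "R \<subseteq> {1..n - 1}"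
    and "is_partition n lam"
    and "R_lam n lam = R"
  shows "(C_count n R = card {w. multiset_word n R w \<and> avoids_231 n w}) \<and>
    (C_count n R = card {\<gamma>. gapless_R_tuple n R \<gamma>}) \<and>
    (C_count n R = card {mu. mu_tuple n R mu}) \<and>
    (C_count n R = card {B. R_chain n R B \<and> rightmost_clump_deleting n R B}) \<and>
    (C_count n R = card {Y. gapless_key n R lam Y}) \<and>
    (C_count n R = card {\<sigma>. R_permutation n R \<sigma> \<and> convex_polytope (boxes n lam) (Demazure n lam \<sigma>)}) \<and>
    (C_count n R = card {Demazure n lam \<sigma> | \<sigma>. R_permutation n R \<sigma> \<and> convex_polytope (boxes n lam) (Demazure n lam \<sigma>)})"
proof -
  interpret shape n R lam using assms by unfold_locales
  let ?P = "{\<sigma>. R_permutation n R \<sigma> \<and> convex_polytope (boxes n lam) (Demazure n lam \<sigma>)}"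
  have P: "?P = {\<sigma>. R_permutation n R \<sigma> \<and> \<not> R_312_containing n R \<sigma>}"
    using polytope_iff_avoiding by blast
  have "inj_on (Demazure n lam) ?P" by (rule inj_onI) (use Demazure_inj in blast)
  then have "card (Demazure n lam ` ?P) = C_count n R" unfolding C_count_def P by (rule card_image)
  moreover have "{Demazure n lam \<sigma> | \<sigma>. R_permutation n R \<sigma> \<and> convex_polytope (boxes n lam) (Demazure n lam \<sigma>)}
      = Demazure n lam ` ?P" by blast
  ultimately show ?thesis
    using C_count_eq card_words card_gapless_tuples card_mu_tuples card_gapless_keys P
    by (simp add: C_count_def clump_deleting_iff_gapless)
qed

end
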